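(* Assume: (A1) $\psi$ is proper, closed and convex, $\mathrm{dom}(F)\neq\emptyset$, and $F^\star:=\inf_x F(x)>-\infty$; (A2) $\mathbb{E}_\xi[\|\nabla f_\xi(x)-\nabla f_\xi(y)\|^2]\le L^2\|x-y\|^2$ for all $x,y\in\mathrm{dom}(F)$, with $L\in(0,\infty)$; (A3) $\mathbb{E}_\xi[\|\nabla f_\xi(x)-\nabla f(x)\|^2]\le\sigma^2$ for all $x\in\mathrm{dom}(F)$, with $\sigma\in[0,\infty)$. Let $\{x_t^{(s)}\}_{t=0,\dots,m}^{s=1,\dots,S}$ be generated by the mini-batch restarting algorithm ProxHSGD-RS (see context, with mini-batch sizes $b,\hat b\in\mathbb{N}_+$ and initial batch size $\tilde b\in\mathbb{N}_+$ at every stage, $\hat b\le\tilde b(m+1)$) applied to $\min_xF(x)$ from $\overline{x}^{(0)}$ with $\eta_t=\eta\in(0,\frac1L)$, $\delta:=\frac2\eta-2L>0$, $\beta:=1-\frac{\hat b^{1/2}}{[\tilde b(m+1)]^{1/2}}$, and $$\gamma_m:=\frac\delta L,\qquad \gamma_t:=\frac{\delta b}{Lb+L(1+L^2\eta^2)\big[\beta^2\gamma_{t+1}+\beta^4\gamma_{t+2}+\cdots+\beta^{2(m-t)}\gamma_m\big]},\quad t=0,\dots,m-1,$$ where $\eta$ is such that $\gamma_t\in(0,1]$ for all $t$ (i.e. $\delta\le L$). Let $\Sigma_m:=\sum_{t=0}^m\gamma_t$. Then: (a) If $\overline{x}_T$ is chosen at random from the iterates $x_t^{(s)}$ with $\mathbb{P}(\overline{x}_T=x_t^{(s)})=\frac{\gamma_t}{S\Sigma_m}$,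 then $$\mathbb{E}\big[\|\mathcal{G}_\eta(\overline{x}_T)\|^2\big]\le\frac{8\sqrt2\Big[\hat b^{1/4}b^{1/2}L+[\tilde b(m+1)]^{1/4}\sqrt{L\delta}\Big]}{L\eta^2\delta S(m+1)\hat b^{1/4}b^{1/2}}\big[F(\overline{x}^{(0)})-F^\star\big]+\frac{8\sigma^2}{L^2\eta^2[\hat b\tilde b(m+1)]^{1/2}}.$$ (b) Given $\varepsilon>0$ and $c_1>\frac1{m+1}$, choose $\hat b=b\in\mathbb{N}_+$ with $1\le b\le\frac{2\sqrt{6\delta}}{L\sqrt L\,\eta\varepsilon}$, and $$\tilde b:=\frac{24c_1}{L^2\eta^2\varepsilon^2}\max\{\sigma^2,1\},\qquad m+1:=\frac{24}{c_1L^2\eta^2b\varepsilon^2}\max\{\sigma^2,1\}.$$ Then the total number of iterations $T$ needed to achieve $\mathbb{E}[\|\mathcal{G}_\eta(\overline{x}_T)\|^2]\le\varepsilon^2$ is at most $$T:=(m+1)S=\Big\lfloor\frac{96\sqrt3\max\{1,\sigma\}}{\eta^3L\sqrt{L\delta}\,b\,\varepsilon^3}\big[F(\overline{x}^{(0)})-F^\star\big]\Big\rfloor.$$ This is also the total number of proximal operations $\mathrm{prox}_{\eta\psi}$. The total number of stochastic gradient evaluations is at most $$\mathcal{T}_{\nabla f}:=\Big\lfloor(c_1^2+3)\frac{96\sqrt3\max\{1,\sigma\}}{\eta^3L\sqrt{L\delta}\,\varepsilon^3}\big[F(\overline{x}^{(0)})-F^\star\big]\Big\rfloor.$$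
   Context: Problem: minimize $F(x):=f(x)+\psi(x)$ over $x\in\mathbb{R}^p$, where $f(x)=\mathbb{E}_{\xi\sim\mathbb{P}}[f_\xi(x)]$, each $f_\xi:\mathbb{R}^p\to\mathbb{R}$ is smooth (possibly nonconvex), stochastic gradients are unbiased ($\mathbb{E}_\xi[\nabla f_\xi(x)]=\nabla f(x)$), and $\psi:\mathbb{R}^p\to\mathbb{R}\cup\{+\infty\}$. Proximal operator: $\mathrm{prox}_{\eta\psi}(x):=\arg\min_u\{\eta\psi(u)+\frac12\|u-x\|^2\}$. Gradient mapping: $\mathcal{G}_\eta(x):=\frac1\eta\big(x-\mathrm{prox}_{\eta\psi}(x-\eta\nabla f(x))\big)$. Mini-batch ProxHSGD (started from a point $x_0\in\mathrm{dom}(F)$): compute $\hat v_0:=\frac1{\tilde b}\sum_{\tilde\xi_i\in\widetilde{\mathcal{B}}}\nabla f_{\tilde\xi_i}(x_0)$ with $\widetilde{\mathcal B}$ a fresh batch of $\tilde b$ i.i.d. samples of $\xi$; set $\widehat{x}_1:=\mathrm{prox}_{\eta\psi}(x_0-\eta\hat v_0)$ and $x_1:=(1-\gamma_0)x_0+\gamma_0\widehat{x}_1$. For $t=1,\dots,m$: draw independent mini-batches $\mathcal{B}_t$ (of $b$ i.i.d. samples of $\xi$) and $\hat{\mathcal{B}}_t$ (of $\hat b$ i.i.d. samples of $\xi$), independent of the past; set $$\hat v_t:=\beta\hat v_{t-1}+\frac{\beta}{b}\sum_{\xi_t\in\mathcal{B}_t}\big(\nabla f_{\xi_t}(x_t)-\nabla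 f_{\xi_t}(x_{t-1})\big)+\frac{1-\beta}{\hat b}\sum_{\zeta_t\in\hat{\mathcal{B}}_t}\nabla f_{\zeta_t}(x_t);$$ set $\widehat{x}_{t+1}:=\mathrm{prox}_{\eta\psi}(x_t-\eta\hat v_t)$ and $x_{t+1}:=(1-\gamma_t)x_t+\gamma_t\widehat{x}_{t+1}$ (with $\gamma_t\in(0,1]$). Mini-batch ProxHSGD-RS: given $\overline{x}^{(0)}\in\mathrm{dom}(F)$, for $s=1,\dots,S$ run mini-batch ProxHSGD from $x_0^{(s)}:=\overline{x}^{(s-1)}$, producing $x_0^{(s)},\dots,x_{m+1}^{(s)}$, and set $\overline{x}^{(s)}:=x_{m+1}^{(s)}$. $\mathbb{E}[\cdot]$ is expectation over all randomness, including the independent random choice of $\overline{x}_T$. Convention on counts in (b): integer rounding is ignored, i.e. $\tilde b$, $m+1$ and $S$ are identified with real numbers; the number of stochastic gradient evaluations is counted as $[\tilde b+3b(m+1)]S$ and the number of proximal operations as $(m+1)S$, where $S$ is the number of stages needed. *)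

theory Defs
  imports "HOL-Probability.Probability"
begin

definition grad :: "('a::euclidean_space \<Rightarrow> real) \<Rightarrow> 'a \<Rightarrow> 'a" where
  "grad g x = (THE d. GDERIV g x :> d)"

definition C1_fun :: "('a::euclidean_space \<Rightarrow> real) \<Rightarrow> bool" where
  "C1_fun g \<longleftrightarrow> (\<forall>x. g differentiable (at x)) \<and> continuous_on UNIV (grad g)"

definition edom :: "('a \<Rightarrow> ereal) \<Rightarrow> 'a set" where
  "edom h = {x. h x < \<infinity>}"

definition eepigraph :: "('a \<Rightarrow> ereal) \<Rightarrow> ('a \<times> real) set" where
  "eepigraph h = {(x, r). h x \<le> ereal r}"

definition proper_fun :: "('a \<Rightarrow> ereal) \<Rightarrow> bool" where
  "proper_fun h \<longleftrightarrow> (\<forall>x. h x \<noteq> -\<infinity>) \<and> edom h \<noteq> {}"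

definition closed_fun :: "('a::euclidean_space \<Rightarrow> ereal) \<Rightarrow> bool" where
  "closed_fun h \<longleftrightarrow> closed (eepigraph h)"

definition convex_fun :: "('a::euclidean_space \<Rightarrow> ereal) \<Rightarrow> bool" where
  "convex_fun h \<longleftrightarrow> convex (eepigraph h)"

definition prox :: "real \<Rightarrow> ('a::euclidean_space \<Rightarrow> ereal) \<Rightarrow> 'a \<Rightarrow> 'a" where
  "prox \<eta> \<psi> x = (ARG_MIN (\<lambda>u. ereal \<eta> * \<psi> u + ereal (1/2 * (norm (u - x))\<^sup>2)) u. True)"

definition grad_map ::
    "('a::euclidean_space \<Rightarrow> real) \<Rightarrow> ('a \<Rightarrow> ereal) \<Rightarrow> real \<Rightarrow> 'a \<Rightarrow> 'a" where
  "grad_map f \<psi> \<eta> x = (1/\<eta>) *\<^sub>R (x - prox \<eta> \<psi> (x - \<eta> *\<^sub>R grad f x))"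

text \<open>Labels of the individual samples: \<open>Init s i\<close> belongs to the initial batch (size \<open>bt\<close>)
  of stage \<open>s\<close>; in iteration \<open>t\<close> of stage \<open>s\<close>, \<open>Diff s t i\<close> belongs to the batch used for
  gradient differences (size \<open>b\<close>) and \<open>Fresh s t i\<close> to the other, independent one (size \<open>bh\<close>).\<close>

datatype sample_label = Init nat nat | Diff nat nat nat | Fresh nat nat nat

definition sample_labels :: "nat \<Rightarrow> nat \<Rightarrow> nat \<Rightarrow> nat \<Rightarrow> nat \<Rightarrow> sample_label set" where
  "sample_labels S m bt b bh =
     {Init s i | s i. s \<in> {1..S} \<and> i < bt} \<union>
     {Diff s t i | s t i. s \<in> {1..S} \<and> t \<in> {1..m} \<and> i < b} \<union>
     {Fresh s t i | s t i. s \<in> {1..S} \<and> t \<in> {1..m} \<and> i < bh}"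

text \<open>Iterates \<open>x\<^sub>t\<close> and estimators \<open>v\<^sub>t\<close> of stage \<open>s\<close> started at \<open>x0\<close>, for a fixed
  realization \<open>Z\<close> of all samples.\<close>

fun hsgd_x :: "('z \<Rightarrow> 'a::euclidean_space \<Rightarrow> real) \<Rightarrow> ('a \<Rightarrow> ereal) \<Rightarrow> real \<Rightarrow> real \<Rightarrow> (nat \<Rightarrow> real)
      \<Rightarrow> nat \<Rightarrow> nat \<Rightarrow> nat \<Rightarrow> (sample_label \<Rightarrow> 'z) \<Rightarrow> nat \<Rightarrow> 'a \<Rightarrow> nat \<Rightarrow> 'a"
  and hsgd_v :: "('z \<Rightarrow> 'a \<Rightarrow> real) \<Rightarrow> ('a \<Rightarrow> ereal) \<Rightarrow> real \<Rightarrow> real \<Rightarrow> (nat \<Rightarrow> real)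
      \<Rightarrow> nat \<Rightarrow> nat \<Rightarrow> nat \<Rightarrow> (sample_label \<Rightarrow> 'z) \<Rightarrow> nat \<Rightarrow> 'a \<Rightarrow> nat \<Rightarrow> 'a"
where
  "hsgd_x fs \<psi> \<eta> \<beta> \<gamma> bt b bh Z s x0 0 = x0"
| "hsgd_x fs \<psi> \<eta> \<beta> \<gamma> bt b bh Z s x0 (Suc t) =
     (1 - \<gamma> t) *\<^sub>R hsgd_x fs \<psi> \<eta> \<beta> \<gamma> bt b bh Z s x0 t
     + \<gamma> t *\<^sub>R prox \<eta> \<psi> (hsgd_x fs \<psi> \<eta> \<beta> \<gamma> bt b bh Z s x0 t
                           - \<eta> *\<^sub>R hsgd_v fs \<psi> \<eta> \<beta> \<gamma> bt b bh Z s x0 t)"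
| "hsgd_v fs \<psi> \<eta> \<beta> \<gamma> bt b bh Z s x0 0 =
     (1 / real bt) *\<^sub>R (\<Sum>i<bt. grad (fs (Z (Init s i))) x0)"
| "hsgd_v fs \<psi> \<eta> \<beta> \<gamma> bt b bh Z s x0 (Suc t) =
     \<beta> *\<^sub>R hsgd_v fs \<psi> \<eta> \<beta> \<gamma> bt b bh Z s x0 t
     + (\<beta> / real b) *\<^sub>R (\<Sum>i<b. grad (fs (Z (Diff s (Suc t) i)))
                                   (hsgd_x fs \<psi> \<eta> \<beta> \<gamma> bt b bh Z s x0 (Suc t))
                               - grad (fs (Z (Diff s (Suc t) i)))
                                   (hsgd_x fs \<psi> \<eta> \<beta> \<gamma> bt b bh Z s x0 t))
     + ((1 - \<beta>) / real bh) *\<^sub>R (\<Sum>i<bh. grad (fs (Z (Fresh s (Suc t) i)))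
                                   (hsgd_x fs \<psi> \<eta> \<beta> \<gamma> bt b bh Z s x0 (Suc t)))"

primrec rs_xbar :: "('z \<Rightarrow> 'a::euclidean_space \<Rightarrow> real) \<Rightarrow> ('a \<Rightarrow> ereal) \<Rightarrow> real \<Rightarrow> real
      \<Rightarrow> (nat \<Rightarrow> real) \<Rightarrow> nat \<Rightarrow> nat \<Rightarrow> nat \<Rightarrow> nat \<Rightarrow> (sample_label \<Rightarrow> 'z) \<Rightarrow> 'a \<Rightarrow> nat \<Rightarrow> 'a"
where
  "rs_xbar fs \<psi> \<eta> \<beta> \<gamma> m bt b bh Z xb0 0 = xb0"
| "rs_xbar fs \<psi> \<eta> \<beta> \<gamma> m bt b bh Z xb0 (Suc s) =
     hsgd_x fs \<psi> \<eta> \<beta> \<gamma> bt b bh Z (Suc s) (rs_xbar fs \<psi> \<eta> \<beta> \<gamma> m bt b bh Z xb0 s) (m + 1)"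

text \<open>The iterate with stage index \<open>s \<ge> 1\<close> and inner index \<open>t\<close>.\<close>

definition rs_iterate :: "('z \<Rightarrow> 'a::euclidean_space \<Rightarrow> real) \<Rightarrow> ('a \<Rightarrow> ereal) \<Rightarrow> real \<Rightarrow> real
      \<Rightarrow> (nat \<Rightarrow> real) \<Rightarrow> nat \<Rightarrow> nat \<Rightarrow> nat \<Rightarrow> nat \<Rightarrow> (sample_label \<Rightarrow> 'z) \<Rightarrow> 'a \<Rightarrow> nat \<Rightarrow> nat \<Rightarrow> 'a"
where
  "rs_iterate fs \<psi> \<eta> \<beta> \<gamma> m bt b bh Z xb0 s t =
     hsgd_x fs \<psi> \<eta> \<beta> \<gamma> bt b bh Z s (rs_xbar fs \<psi> \<eta> \<beta> \<gamma> m bt b bh Z xb0 (s - 1)) t"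

text \<open>Operation counts. The number of stages is a real number here, since integer rounding of
  the number of stages is ignored when complexities are counted.\<close>

definition num_prox :: "nat \<Rightarrow> real \<Rightarrow> real" where
  "num_prox m S = (real m + 1) * S"

definition num_grad :: "nat \<Rightarrow> nat \<Rightarrow> nat \<Rightarrow> real \<Rightarrow> real" where
  "num_grad bt b m S = (real bt + 3 * real b * (real m + 1)) * S"

end

theory Submission
  imports Defs
begin

text \<open>
  One proximal step with an estimator of error \<open>e\<close> and displacement \<open>d\<close> decreases \<open>F\<close> by
  \<open>L \<eta>\<^sup>2 \<gamma> \<bar>G\<bar>\<^sup>2 / 4 + \<gamma> (\<delta> - L \<gamma>) \<bar>d\<bar>\<^sup>2 / 2 - (1 + L\<^sup>2 \<eta>\<^sup>2) \<gamma> \<bar>e\<bar>\<^sup>2 / (2 L)\<close>.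
  Telescoping this pathwise over all stages needs no integrability of \<open>F\<close>. Adding the fresh samples one
  at a time, independence gives the recursion of \<open>E \<bar>e\<bar>\<^sup>2\<close> with contraction \<open>\<beta>\<^sup>2\<close>, and the weights
  \<open>\<gamma>\<close> are exactly those for which the accumulated \<open>\<bar>d\<bar>\<^sup>2\<close> terms cancel.

  Writing \<open>\<gamma>\<^sub>t = (\<delta> / L) / (1 + y\<^sub>m\<^sub>-\<^sub>t)\<close>, the sequence \<open>y\<close> satisfies
  \<open>y' = \<beta>\<^sup>2 (y + \<kappa> / (1 + y))\<close> with \<open>\<kappa> \<le> 3/2\<close>. The weights need not increase in \<open>t\<close>, but
  \<open>\<gamma>\<^sub>s \<le> (1 + 2 \<beta>) \<gamma>\<^sub>t\<close> for \<open>s \<le> t\<close>, and a Chebyshev-type sum inequality with this loss still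
  yields the stated noise term. The bound on \<open>y\<close> makes the first term of (a) hold with half the stated
  constant; this spare factor 2 absorbs the rounding in (b), where the number of iterations is only known
  to be at least the floor of the real threshold.
\<close>

section \<open>Proximal operator and descent lemma\<close>

text \<open>The choice of \<beta> balances two noise sources. With \<theta> = 1 / sqrt (bh bt (m +
  1)), both the time average of the decaying initial-batch noise and the accumulated fresh-sample
  noise are at most \<theta> \<sigma>^2 / (1 + \<beta>). A loss of 1 + 2 \<beta> on the first makes
  their sum 2 \<theta> \<sigma>^2 exactly, which is what the noise term of (a) allows; hence the
  loss is sought in this form. The bound 3/2 on \<kappa> comes from \<gamma>_m \<le> 1, which forces
  L \<eta> \<ge> 2/3. The Lipschitz and variance assumptions hold on dom F only, so the iterates are
  kept there as convex combinations and every Lipschitz estimate is confined to that set. Cancelling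
  the displacement terms under the expectation needs finite second moments. Nothing bounds the
  iterates, so moments are propagated from the starting point; the variance recursion is therefore
  proved first for nonnegative integrals, where infinite values are harmless.\<close>

lemma proper_fun_real_on_edom:
  fixes h :: "'a \<Rightarrow> ereal"
  assumes "proper_fun h" "x \<in> edom h"
  shows "h x = ereal (real_of_ereal (h x))"
  using assms by (cases "h x") (auto simp: proper_fun_def edom_def)

locale prox_friendly =
  fixes \<psi> :: "'a::euclidean_space \<Rightarrow> ereal"
  assumes proper: "proper_fun \<psi>" and closed: "closed_fun \<psi>" and convex: "convex_fun \<psi>"
begin

abbreviation p :: "'a \<Rightarrow> real" where "p u \<equiv> real_of_ereal (\<psi> u)"

lemma psi_eq: "u \<in> edom \<psi> \<Longrightarrow> \<psi> u = ereal (p u)"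
  using proper by (rule proper_fun_real_on_edom)

lemma epigraph_iff: "(u, r) \<in> eepigraph \<psi> \<longleftrightarrow> u \<in> edom \<psi> \<and> p u \<le> r"
proof -
  have "\<psi> u \<noteq> -\<infinity>" using proper by (simp add: proper_fun_def)
  then show ?thesis by (cases "\<psi> u") (auto simp: eepigraph_def edom_def)
qed

lemma convex_comb:
  assumes "u \<in> edom \<psi>" "v \<in> edom \<psi>" "0 \<le> t" "t \<le> 1"
  shows "(1 - t) *\<^sub>R u + t *\<^sub>R v \<in> edom \<psi>"
    and "p ((1 - t) *\<^sub>R u + t *\<^sub>R v) \<le> (1 - t) * p u + t * p v"
proof -
  have "(1 - t) *\<^sub>R (u, p u) + t *\<^sub>R (v, p v) \<in> eepigraph \<psi>"
    using convex assms unfolding convex_fun_def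
    by (intro convexD) (auto simp: epigraph_iff)
  then show "(1 - t) *\<^sub>R u + t *\<^sub>R v \<in> edom \<psi>"
    and "p ((1 - t) *\<^sub>R u + t *\<^sub>R v) \<le> (1 - t) * p u + t * p v"
    by (auto simp: epigraph_iff)
qed

text \<open>Strict separation of the closed convex epigraph from the point one unit below its graph.
  Comparing the functional at \<open>(u0, p u0)\<close> and \<open>(u0, p u0 - 1)\<close> makes the
  last coordinate of the normal positive, so the hyperplane is the graph of an affine
  function.\<close>

lemma affine_minorant:
  obtains c a where "\<And>u. u \<in> edom \<psi> \<Longrightarrow> c - inner a u \<le> p u"
proof -
  obtain u0 where u0: "u0 \<in> edom \<psi>" using proper by (auto simp: proper_fun_def)
  have "(u0, p u0 - 1) \<notin> eepigraph \<psi>" by (simp add: epigraph_iff)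
  then obtain w :: "'a \<times> real" and c where w: "inner w (u0, p u0 - 1) < c"
      "\<And>x. x \<in> eepigraph \<psi> \<Longrightarrow> inner w x > c"
    using separating_hyperplane_closed_point[of "eepigraph \<psi>" "(u0, p u0 - 1)"] closed convex
    unfolding closed_fun_def convex_fun_def by blast
  obtain a \<rho> where [simp]: "w = (a, \<rho>)" by (cases w)
  have "inner a u0 + \<rho> * p u0 > c" using w(2)[of "(u0, p u0)"] u0 by (simp add: epigraph_iff)
  with w(1) have \<rho>: "\<rho> > 0" by (simp add: algebra_simps)
  show ?thesis
  proof (rule that)
    fix u assume "u \<in> edom \<psi>"
    then have "c < inner a u + \<rho> * p u" using w(2)[of "(u, p u)"] by (simp add: epigraph_iff)
    then have "c / \<rho> < inner a u / \<rho> + p u" using \<rho> by (simp add: field_simps)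
    then show "c / \<rho> - inner (a /\<^sub>R \<rho>) u \<le> p u" using \<rho> by (simp add: field_simps)
  qed
qed

text \<open>\<psi> is only lower semicontinuous, so the minimum is taken over pairs
  \<open>(u, r)\<close> of the epigraph, on which the objective with \<open>r\<close> in place of
  \<open>p u\<close> is continuous. The affine minorant and the quadratic term bound the sublevel
  set \<open>K\<close>.\<close>

lemma prox_objective_attains_min:
  assumes \<eta>: "\<eta> > 0"
  obtains u where "u \<in> edom \<psi>"
    "\<And>v. v \<in> edom \<psi> \<Longrightarrow> \<eta> * p u + (norm (u - x))\<^sup>2 / 2 \<le> \<eta> * p v + (norm (v - x))\<^sup>2 / 2"
proof -
  obtain u0 where u0: "u0 \<in> edom \<psi>" using proper by (auto simp: proper_fun_def)
  obtain c a where ca: "\<And>u. u \<in> edom \<psi> \<Longrightarrow> c - inner a u \<le> p u"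
    using affine_minorant by blast
  let ?q = "\<lambda>w. \<eta> * snd w + (norm (fst w - x))\<^sup>2 / 2"
  define q0 where "q0 = ?q (u0, p u0)"
  define K where "K = eepigraph \<psi> \<inter> {w. ?q w \<le> q0}"
  have clK: "Topological_Spaces.closed K"
    unfolding K_def using closed unfolding closed_fun_def
    by (intro closed_Int closed_Collect_le continuous_intros) auto
  \<comment> \<open>Completing the square turns the sublevel bound into a ball about
    \<open>x + \<eta> *\<^sub>R a\<close>; the absolute value spares an argument about the sign of
    the radicand.\<close>
  define R where "R = norm (x + \<eta> *\<^sub>R a) + sqrt (\<bar>2 * (q0 - \<eta> * c) + (norm (x + \<eta> *\<^sub>R a))\<^sup>2 - (norm x)\<^sup>2\<bar>)"
  have bd: "norm u \<le> R \<and> \<bar>r\<bar> \<le> \<bar>q0 / \<eta>\<bar> + \<bar>c\<bar> + norm a * R" if "(u, r) \<in> K" for u r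
  proof -
    have u: "u \<in> edom \<psi>" "p u \<le> r" "\<eta> * r + (norm (u - x))\<^sup>2 / 2 \<le> q0"
      using that by (auto simp: K_def epigraph_iff)
    have r: "c - inner a u \<le> r" using ca[OF u(1)] u(2) by simp
    then have "\<eta> * (c - inner a u) \<le> \<eta> * r" using \<eta> by simp
    with u(3) have "(norm (u - x))\<^sup>2 \<le> 2 * (q0 - \<eta> * c + \<eta> * inner a u)"
      by (simp add: algebra_simps)
    moreover have "(norm (u - (x + \<eta> *\<^sub>R a)))\<^sup>2 =
        (norm (u - x))\<^sup>2 - 2 * \<eta> * inner a u + (norm (x + \<eta> *\<^sub>R a))\<^sup>2 - (norm x)\<^sup>2"
      unfolding power2_norm_eq_inner by (simp add: algebra_simps inner_commute)
    ultimately have "(norm (u - (x + \<eta> *\<^sub>R a)))\<^sup>2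
        \<le> 2 * (q0 - \<eta> * c) + (norm (x + \<eta> *\<^sub>R a))\<^sup>2 - (norm x)\<^sup>2" by (simp add: algebra_simps)
    also have "\<dots> \<le> \<bar>\<dots>\<bar>" by (rule abs_ge_self)
    finally have "(norm (u - (x + \<eta> *\<^sub>R a)))\<^sup>2
        \<le> \<bar>2 * (q0 - \<eta> * c) + (norm (x + \<eta> *\<^sub>R a))\<^sup>2 - (norm x)\<^sup>2\<bar>" .
    from real_le_rsqrt[OF this] have "norm (u - (x + \<eta> *\<^sub>R a)) \<le> R - norm (x + \<eta> *\<^sub>R a)"
      by (simp only: R_def add_diff_cancel_left')
    then have nu: "norm u \<le> R" using norm_triangle_sub[of u "x + \<eta> *\<^sub>R a"] by linarith
    have "\<eta> * r \<le> q0" using u(3) zero_le_power2[of "norm (u - x)"] by linarith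
    then have "r \<le> q0 / \<eta>" using \<eta> by (simp add: field_simps)
    moreover have "\<bar>inner a u\<bar> \<le> norm a * R"
      using Cauchy_Schwarz_ineq2[of a u] mult_left_mono[OF nu norm_ge_zero[of a]] by linarith
    ultimately have "\<bar>r\<bar> \<le> \<bar>q0 / \<eta>\<bar> + \<bar>c\<bar> + norm a * R" using r by linarith
    with nu show ?thesis by simp
  qed
  have "K \<subseteq> cball 0 R \<times> cball 0 (\<bar>q0 / \<eta>\<bar> + \<bar>c\<bar> + norm a * R)"
    by (rule subsetI) (use bd in \<open>auto simp: dist_norm\<close>)
  then have "bounded K" by (rule bounded_subset[rotated]) (intro bounded_Times bounded_cball)
  with clK have "compact K" by (simp add: compact_eq_bounded_closed)
  moreover have "(u0, p u0) \<in> K" using u0 by (simp add: K_def q0_def epigraph_iff)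
  moreover have "continuous_on K ?q" by (intro continuous_intros) simp
  ultimately obtain w where w: "w \<in> K" "\<And>w'. w' \<in> K \<Longrightarrow> ?q w \<le> ?q w'"
    using continuous_attains_inf[of K ?q] by force
  obtain u r where [simp]: "w = (u, r)" by (cases w)
  have u: "u \<in> edom \<psi>" "p u \<le> r" "?q w \<le> q0" using w(1) by (auto simp: K_def epigraph_iff)
  show ?thesis
  proof (rule that[OF u(1)])
    fix v assume v: "v \<in> edom \<psi>"
    have "?q w \<le> ?q (v, p v)"
    proof (cases "?q (v, p v) \<le> q0")
      case True
      then show ?thesis using w(2)[of "(v, p v)"] v by (simp add: K_def epigraph_iff)
    qed (use u(3) in simp)
    moreover have "\<eta> * p u \<le> \<eta> * r" using u(2) \<eta> by simp
    ultimately show "\<eta> * p u + (norm (u - x))\<^sup>2 / 2 \<le> \<eta> * p v + (norm (v - x))\<^sup>2 / 2" by simp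
  qed
qed

text \<open>\<open>prox\<close> picks some minimizer by choice, so it is attainment of the minimum
  that gives it a meaning. A minimizer has a finite value and hence lies in the domain.\<close>

lemma prox_properties:
  assumes \<eta>: "\<eta> > 0"
  shows prox_in_edom: "prox \<eta> \<psi> x \<in> edom \<psi>"
    and prox_minimizes: "v \<in> edom \<psi> \<Longrightarrow> \<eta> * p (prox \<eta> \<psi> x) + (norm (prox \<eta> \<psi> x - x))\<^sup>2 / 2
           \<le> \<eta> * p v + (norm (v - x))\<^sup>2 / 2"
proof -
  let ?f = "\<lambda>u. ereal \<eta> * \<psi> u + ereal (1/2 * (norm (u - x))\<^sup>2)"
  have fin: "?f u = ereal (\<eta> * p u + (norm (u - x))\<^sup>2 / 2)" if "u \<in> edom \<psi>" for u
    by (subst psi_eq[OF that]) simp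
  have inf: "?f u = \<infinity>" if "u \<notin> edom \<psi>" for u
    using that \<eta> by (simp add: edom_def)
  obtain u where u: "u \<in> edom \<psi>"
    "\<And>v. v \<in> edom \<psi> \<Longrightarrow> \<eta> * p u + (norm (u - x))\<^sup>2 / 2 \<le> \<eta> * p v + (norm (v - x))\<^sup>2 / 2"
    using prox_objective_attains_min[OF \<eta>, of x] by blast
  have "is_arg_min ?f (\<lambda>_. True) u"
    unfolding is_arg_min_linorder
  proof (intro conjI allI impI)
    fix v show "?f u \<le> ?f v"
    proof (cases "v \<in> edom \<psi>")
      case True
      then show ?thesis unfolding fin[OF u(1)] fin[OF True] using u(2) by simp
    next
      case False
      then show ?thesis unfolding inf[OF False] by simp
    qed
  qed simp
  then have "is_arg_min ?f (\<lambda>_. True) (prox \<eta> \<psi> x)"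
    unfolding prox_def arg_min_def by (rule someI)
  then have le: "?f (prox \<eta> \<psi> x) \<le> ?f v" for v by (simp add: is_arg_min_linorder)
  show dom: "prox \<eta> \<psi> x \<in> edom \<psi>"
  proof (rule ccontr)
    assume "prox \<eta> \<psi> x \<notin> edom \<psi>"
    from le[of u] show False unfolding inf[OF \<open>prox \<eta> \<psi> x \<notin> edom \<psi>\<close>] fin[OF u(1)] by simp
  qed
  show "\<eta> * p (prox \<eta> \<psi> x) + (norm (prox \<eta> \<psi> x - x))\<^sup>2 / 2 \<le> \<eta> * p v + (norm (v - x))\<^sup>2 / 2"
    if "v \<in> edom \<psi>"
    using le[of v] unfolding fin[OF that] fin[OF dom] by simp
qed

text \<open>First-order optimality: \<open>x - prox \<eta> \<psi> x\<close> is \<eta> times a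
  subgradient at the proximal point. Comparison with the point at fraction t of the segment towards
  \<open>u\<close> leaves, after division by t, a remainder of order t, which vanishes in the
  limit.\<close>

lemma prox_variational_inequality:
  assumes \<eta>: "\<eta> > 0" and u: "u \<in> edom \<psi>"
  shows "\<eta> * p (prox \<eta> \<psi> x) + inner (x - prox \<eta> \<psi> x) (u - prox \<eta> \<psi> x) \<le> \<eta> * p u"
proof -
  define z where "z = prox \<eta> \<psi> x"
  define A where "A = \<eta> * p u - \<eta> * p z - inner (x - z) (u - z)"
  have *: "0 \<le> A + t * ((norm (u - z))\<^sup>2 / 2)" if t: "0 < t" "t \<le> 1" for t
  proof -
    let ?w = "(1 - t) *\<^sub>R z + t *\<^sub>R u"
    have z: "z \<in> edom \<psi>" unfolding z_def by (rule prox_in_edom[OF \<eta>])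
    have w: "?w \<in> edom \<psi>" "p ?w \<le> (1 - t) * p z + t * p u"
      using convex_comb[OF z u, of t] t by auto
    have "\<eta> * p z + (norm (z - x))\<^sup>2 / 2 \<le> \<eta> * p ?w + (norm (?w - x))\<^sup>2 / 2"
      unfolding z_def by (rule prox_minimizes[OF \<eta>]) (use w(1) z_def in simp)
    also have "\<dots> \<le> \<eta> * ((1 - t) * p z + t * p u) + (norm (?w - x))\<^sup>2 / 2"
      using w(2) \<eta> by simp
    also have "(norm (?w - x))\<^sup>2 = (norm (z - x))\<^sup>2 - 2 * t * inner (x - z) (u - z) + t\<^sup>2 * (norm (u - z))\<^sup>2"
      unfolding power2_norm_eq_inner
      by (simp add: algebra_simps inner_commute power2_eq_square)
    finally have "0 \<le> \<eta> * ((1 - t) * p z + t * p u) - \<eta> * p z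
        - t * inner (x - z) (u - z) + t\<^sup>2 * (norm (u - z))\<^sup>2 / 2" by (simp add: field_simps)
    also have "\<dots> = t * (A + t * ((norm (u - z))\<^sup>2 / 2))"
      unfolding A_def by algebra
    finally have "0 \<le> t * (A + t * ((norm (u - z))\<^sup>2 / 2))" .
    then show ?thesis using t by (simp add: zero_le_mult_iff)
  qed
  have "0 \<le> A"
  proof (rule tendsto_lowerbound)
    show "((\<lambda>t. A + t * ((norm (u - z))\<^sup>2 / 2)) \<longlongrightarrow> A) (at_right 0)"
      by (auto intro!: tendsto_eq_intros)
    show "\<forall>\<^sub>F t in at_right 0. 0 \<le> A + t * ((norm (u - z))\<^sup>2 / 2)"
      using * by (auto simp: eventually_at_right[of 0 1] intro!: exI[of _ 1])
  qed simp
  then show ?thesis by (simp add: A_def z_def)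
qed

text \<open>Each proximal point is tested against the other one. The sum of the two inequalities is
  firm nonexpansiveness, and Cauchy-Schwarz finishes.\<close>

lemma prox_nonexpansive:
  assumes \<eta>: "\<eta> > 0"
  shows "norm (prox \<eta> \<psi> x - prox \<eta> \<psi> y) \<le> norm (x - y)"
proof -
  define a where "a = prox \<eta> \<psi> x"
  define c where "c = prox \<eta> \<psi> y"
  have "inner (x - a) (c - a) + inner (y - c) (a - c) \<le> 0"
    using prox_variational_inequality[OF \<eta> prox_in_edom[OF \<eta>], of x y]
      prox_variational_inequality[OF \<eta> prox_in_edom[OF \<eta>], of y x]
    unfolding a_def c_def by linarith
  then have "(norm (a - c))\<^sup>2 \<le> inner (x - y) (a - c)"
    unfolding power2_norm_eq_inner by (simp add: algebra_simps inner_commute)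
  also have "\<dots> \<le> norm (x - y) * norm (a - c)" by (rule norm_cauchy_schwarz)
  finally have "norm (a - c) * norm (a - c) \<le> norm (x - y) * norm (a - c)"
    by (simp add: power2_eq_square)
  then have "norm (a - c) \<le> norm (x - y)"
    by (cases "norm (a - c) = 0") (auto dest: mult_right_le_imp_le)
  then show ?thesis by (simp add: a_def c_def)
qed

lemma prox_borel_measurable: "\<eta> > 0 \<Longrightarrow> prox \<eta> \<psi> \<in> borel_measurable borel"
  by (intro borel_measurable_continuous_onI lipschitz_on_continuous_on[of 1])
     (auto simp: lipschitz_on_def dist_norm prox_nonexpansive)

end

section \<open>Gradients and the quadratic upper bound\<close>

lemma GDERIV_grad:
  fixes g :: "'a::euclidean_space \<Rightarrow> real"
  assumes "g differentiable (at x)"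
  shows "GDERIV g x :> grad g x"
proof -
  obtain g' where g': "(g has_derivative g') (at x)" using assms by (auto simp: differentiable_def)
  interpret bounded_linear g' using g' by (rule has_derivative_bounded_linear)
  define d where "d = (\<Sum>i\<in>Basis. g' i *\<^sub>R i)"
  have "g' = (\<lambda>h. inner h d)"
  proof
    fix h
    have "g' h = g' (\<Sum>i\<in>Basis. inner h i *\<^sub>R i)" by (simp add: euclidean_representation)
    also have "\<dots> = inner h d" by (simp add: d_def sum scaleR inner_sum_right mult.commute)
    finally show "g' h = inner h d" .
  qed
  with g' have "GDERIV g x :> d" by (simp add: gderiv_def)
  moreover have "d' = d" if "GDERIV g x :> d'" for d'
    using has_derivative_unique[of g "\<lambda>h. inner h d" x "\<lambda>h. inner h d'"] that \<open>GDERIV g x :> d\<close>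
    by (auto simp: gderiv_def fun_eq_iff) (metis inner_commute vector_eq_ldot)
  ultimately show ?thesis unfolding grad_def by (rule theI)
qed

text \<open>Subtracting from f, along the segment, its linear part and the quadratic term leaves a
  function of nonpositive derivative. The Lipschitz condition is required on a convex set
  \<open>D\<close> only, because it will be available on the domain only.\<close>

lemma lipschitz_gradient_descent_lemma:
  fixes f :: "'a::euclidean_space \<Rightarrow> real"
  assumes diff: "\<And>x. f differentiable (at x)" and D: "convex D" "x \<in> D" "y \<in> D"
    and lip: "\<And>x y. x \<in> D \<Longrightarrow> y \<in> D \<Longrightarrow> norm (grad f x - grad f y) \<le> L * norm (x - y)"
  shows "f y \<le> f x + inner (grad f x) (y - x) + L / 2 * (norm (y - x))\<^sup>2"
proof -
  define h where "h = y - x"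
  let ?\<phi> = "\<lambda>t. f (x + t *\<^sub>R h) - t * inner (grad f x) h - L * t\<^sup>2 / 2 * (norm h)\<^sup>2"
  have "?\<phi> 1 \<le> ?\<phi> 0"
  proof (rule DERIV_nonpos_imp_nonincreasing[where f = ?\<phi> and a = 0 and b = 1])
    fix t :: real assume t: "0 \<le> t" "t \<le> 1"
    let ?z = "x + t *\<^sub>R h"
    have "?z = (1 - t) *\<^sub>R x + t *\<^sub>R y" by (simp add: h_def algebra_simps)
    then have z: "?z \<in> D" using D t by (simp add: convexD)
    have "(f has_derivative (\<lambda>h. inner h (grad f ?z))) (at ?z)"
      using GDERIV_grad[OF diff] by (simp add: gderiv_def)
    moreover have "((\<lambda>t. x + t *\<^sub>R h) has_derivative (\<lambda>s. s *\<^sub>R h)) (at t)"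
      by (auto intro!: derivative_eq_intros)
    ultimately have "((\<lambda>t. f (x + t *\<^sub>R h)) has_derivative (\<lambda>s. inner (s *\<^sub>R h) (grad f ?z))) (at t)"
      using diff_chain_at[of "\<lambda>t. x + t *\<^sub>R h" "\<lambda>s. s *\<^sub>R h" t f] by (fastforce simp: o_def)
    then have "((\<lambda>t. f (x + t *\<^sub>R h)) has_real_derivative inner (grad f ?z) h) (at t)"
      by (simp add: has_field_derivative_def inner_commute mult_commute_abs)
    then have der: "(?\<phi> has_real_derivative
        (inner (grad f ?z) h - inner (grad f x) h - L * t * (norm h)\<^sup>2)) (at t)"
      by (auto intro!: derivative_eq_intros)
    have "inner (grad f ?z) h - inner (grad f x) h \<le> L * t * (norm h)\<^sup>2"
    proof -
      have "inner (grad f ?z - grad f x) h \<le> norm (grad f ?z - grad f x) * norm h"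
        by (rule norm_cauchy_schwarz)
      also have "\<dots> \<le> (L * norm (?z - x)) * norm h"
        using lip[OF z D(2)] by (rule mult_right_mono) simp
      finally show ?thesis using t by (simp add: inner_diff_left power2_eq_square)
    qed
    then show "\<exists>y. (?\<phi> has_real_derivative y) (at t) \<and> y \<le> 0"
      by (intro exI[of _ "inner (grad f ?z) h - inner (grad f x) h - L * t * (norm h)\<^sup>2"] conjI der) simp
  qed simp
  then show ?thesis by (simp add: h_def)
qed

section \<open>Second moments and independent samples\<close>

text \<open>A Caratheodory function is jointly measurable: with a simple approximation as second
  argument only finitely many sections occur, and continuity permits the limit. Measurability of
  random gradients at random iterates rests on this.\<close>

lemma borel_measurable_pair_continuous_snd:
  fixes g :: "'z \<Rightarrow> 'a::euclidean_space \<Rightarrow> 'b::euclidean_space"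
  assumes meas: "\<And>x. (\<lambda>z. g z x) \<in> borel_measurable P"
    and cont: "\<And>z. z \<in> space P \<Longrightarrow> continuous_on UNIV (g z)"
  shows "(\<lambda>(z, x). g z x) \<in> borel_measurable (P \<Otimes>\<^sub>M borel)"
proof -
  obtain h :: "nat \<Rightarrow> 'a \<Rightarrow> 'a" where h: "\<And>i. simple_function borel (h i)" "\<And>x. (\<lambda>i. h i x) \<longlonglongrightarrow> x"
    using borel_measurable_implies_sequence_metric[of "\<lambda>x::'a. x" borel 0] by auto
  show ?thesis
  proof (rule borel_measurable_LIMSEQ_metric)
    show "(\<lambda>w. g (fst w) (h i (snd w))) \<in> borel_measurable (P \<Otimes>\<^sub>M borel)" for i
    proof (rule measurable_compose_countable'[where f = "\<lambda>c w. g (fst w) c" and g = "\<lambda>w. h i (snd w)" and I = "range (h i)"])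
      show "(\<lambda>w. h i (snd w)) \<in> P \<Otimes>\<^sub>M borel \<rightarrow>\<^sub>M count_space (range (h i))"
        using h(1)[of i] by (intro measurable_compose[OF measurable_snd])
          (simp add: simple_function_def measurable_count_space_eq2)
      show "countable (range (h i))"
        using h(1)[of i] by (auto simp: simple_function_def intro: countable_finite)
      show "(\<lambda>w. g (fst w) c) \<in> borel_measurable (P \<Otimes>\<^sub>M borel)" for c
        by (rule measurable_compose[OF measurable_fst meas])
    qed
    show "(\<lambda>i. g (fst w) (h i (snd w))) \<longlonglongrightarrow> (case w of (z, x) \<Rightarrow> g z x)"
      if "w \<in> space (P \<Otimes>\<^sub>M borel)" for w
    proof -
      have "isCont (g (fst w)) (snd w)"
        using cont[of "fst w"] that by (auto simp: space_pair_measure continuous_on_eq_continuous_at)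
      from isCont_tendsto_compose[OF this h(2)] show ?thesis by (simp add: case_prod_beta)
    qed
  qed
qed

lemma norm_add_power2_le:
  fixes a c :: "'a::real_inner"
  shows "(norm (a + c))\<^sup>2 \<le> 2 * (norm a)\<^sup>2 + 2 * (norm c)\<^sup>2"
proof -
  have "(norm (a + c))\<^sup>2 + (norm (a - c))\<^sup>2 = 2 * (norm a)\<^sup>2 + 2 * (norm c)\<^sup>2"
    unfolding power2_norm_eq_inner by (simp add: algebra_simps inner_commute)
  then show ?thesis using zero_le_power2[of "norm (a - c)"] by linarith
qed

lemma (in prob_space) nn_integral_norm_add_power2:
  fixes H :: "'a \<Rightarrow> 'b::euclidean_space"
  assumes H: "integrable M H" and fin: "(\<integral>\<^sup>+z. ennreal ((norm (H z))\<^sup>2) \<partial>M) < \<infinity>"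
  shows "(\<integral>\<^sup>+z. ennreal ((norm (a + H z))\<^sup>2) \<partial>M)
    = ennreal ((norm a)\<^sup>2 + 2 * inner a (LINT z|M. H z) + (LINT z|M. (norm (H z))\<^sup>2))"
    and "(\<integral>\<^sup>+z. ennreal ((norm (H z))\<^sup>2) \<partial>M) = ennreal (LINT z|M. (norm (H z))\<^sup>2)"
proof -
  have [measurable]: "H \<in> borel_measurable M" using H by simp
  have sq: "integrable M (\<lambda>z. (norm (H z))\<^sup>2)"
    using fin by (intro integrableI_bounded) auto
  then show "(\<integral>\<^sup>+z. ennreal ((norm (H z))\<^sup>2) \<partial>M) = ennreal (LINT z|M. (norm (H z))\<^sup>2)"
    by (intro nn_integral_eq_integral) auto
  have eq: "(norm (a + H z))\<^sup>2 = (norm a)\<^sup>2 + 2 * inner a (H z) + (norm (H z))\<^sup>2" for z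
    unfolding power2_norm_eq_inner by (simp add: algebra_simps inner_commute)
  have int: "integrable M (\<lambda>z. (norm a)\<^sup>2 + 2 * inner a (H z) + (norm (H z))\<^sup>2)"
    using H sq by simp
  have "(\<integral>\<^sup>+z. ennreal ((norm (a + H z))\<^sup>2) \<partial>M)
      = ennreal (LINT z|M. (norm a)\<^sup>2 + 2 * inner a (H z) + (norm (H z))\<^sup>2)"
    unfolding eq[symmetric]
    by (intro nn_integral_eq_integral) (use int in \<open>simp_all add: eq[symmetric]\<close>)
  also have "(LINT z|M. (norm a)\<^sup>2 + 2 * inner a (H z) + (norm (H z))\<^sup>2)
      = (norm a)\<^sup>2 + 2 * inner a (LINT z|M. H z) + (LINT z|M. (norm (H z))\<^sup>2)"
    using H sq by (simp add: prob_space)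
  finally show "(\<integral>\<^sup>+z. ennreal ((norm (a + H z))\<^sup>2) \<partial>M)
    = ennreal ((norm a)\<^sup>2 + 2 * inner a (LINT z|M. H z) + (LINT z|M. (norm (H z))\<^sup>2))" .
qed

text \<open>The cross term vanishes by centering. An infinite second moment makes the claim trivial,
  so the estimate is usable before any moment is known to be finite.\<close>

lemma (in prob_space) second_moment_add_centered_le:
  fixes H :: "'a \<Rightarrow> 'b::euclidean_space"
  assumes H: "integrable M H" "(LINT z|M. H z) = 0"
  shows "(\<integral>\<^sup>+z. ennreal ((norm (a + H z))\<^sup>2) \<partial>M)
    \<le> ennreal ((norm a)\<^sup>2) + (\<integral>\<^sup>+z. ennreal ((norm (H z))\<^sup>2) \<partial>M)"
proof (cases "(\<integral>\<^sup>+z. ennreal ((norm (H z))\<^sup>2) \<partial>M) < \<infinity>")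
  case True
  then show ?thesis
    using nn_integral_norm_add_power2(1)[OF H(1) True, of a]
      nn_integral_norm_add_power2(2)[OF H(1) True] H(2) by simp
next
  case False
  then show ?thesis by (simp add: less_top[symmetric])
qed

text \<open>The second moment is the sum of the variance and the squared norm of the mean, both
  nonnegative. The first claim carries the Lipschitz constant over to the gradient of f, the second
  bounds the noise of a gradient difference.\<close>

lemma (in prob_space) mean_square_and_variance_le_second_moment:
  fixes H :: "'a \<Rightarrow> 'b::euclidean_space"
  assumes H: "integrable M H" and B: "(\<integral>\<^sup>+z. ennreal ((norm (H z))\<^sup>2) \<partial>M) \<le> ennreal B" "0 \<le> B"
  shows "(norm (LINT z|M. H z))\<^sup>2 \<le> B"
    and "(\<integral>\<^sup>+z. ennreal ((norm (H z - (LINT z|M. H z)))\<^sup>2) \<partial>M) \<le> ennreal B"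
proof -
  let ?m = "LINT z|M. H z" and ?Q = "LINT z|M. (norm (H z))\<^sup>2"
  have fin: "(\<integral>\<^sup>+z. ennreal ((norm (H z))\<^sup>2) \<partial>M) < \<infinity>"
    using B(1) by (rule le_less_trans) simp
  note eqs = nn_integral_norm_add_power2[OF H fin]
  have Q: "?Q \<le> B" using B eqs(2) by (simp add: ennreal_le_iff)
  have "(\<integral>\<^sup>+z. ennreal ((norm (H z - ?m))\<^sup>2) \<partial>M) = ennreal (?Q - (norm ?m)\<^sup>2)"
    using eqs(1)[of "- ?m"] by (simp add: power2_norm_eq_inner algebra_simps)
  also have "\<dots> \<le> ennreal B"
    using Q by (intro ennreal_leI) (use zero_le_power2[of "norm ?m"] in linarith)
  finally show "(\<integral>\<^sup>+z. ennreal ((norm (H z - ?m))\<^sup>2) \<partial>M) \<le> ennreal B" .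
  have "0 \<le> (LINT z|M. (norm (H z - ?m))\<^sup>2)" by simp
  also have "(LINT z|M. (norm (H z - ?m))\<^sup>2) = ?Q - (norm ?m)\<^sup>2"
  proof -
    have sq: "integrable M (\<lambda>z. (norm (H z))\<^sup>2)"
      using fin H by (intro integrableI_bounded) auto
    have "(LINT z|M. (norm (H z - ?m))\<^sup>2) = (LINT z|M. (norm (H z))\<^sup>2 - 2 * inner ?m (H z) + (norm ?m)\<^sup>2)"
      unfolding power2_norm_eq_inner by (simp add: algebra_simps inner_commute)
    also have "\<dots> = ?Q - (norm ?m)\<^sup>2"
      using H sq by (simp add: prob_space power2_norm_eq_inner)
    finally show ?thesis .
  qed
  finally show "(norm ?m)\<^sup>2 \<le> B" using Q by simp
qed

section \<open>Redrawing single coordinates of a finite product space\<close>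

context
  fixes P :: "'z measure" and I :: "'i set"
  assumes P: "prob_space P" and I: "finite I"
begin

interpretation product_sigma_finite "\<lambda>_::'i. P"
  using P by (simp add: product_sigma_finite_def prob_space_imp_sigma_finite)

text \<open>The form in which independence is used: overwriting one coordinate by an independent
  copy does not change the law. After Fubini the old value of that coordinate is overwritten, so
  integrating over it contributes only total mass one.\<close>

lemma nn_integral_PiM_resample:
  assumes l: "l \<in> I" and f: "f \<in> borel_measurable (PiM I (\<lambda>_. P))"
  shows "(\<integral>\<^sup>+\<zeta>. f \<zeta> \<partial>PiM I (\<lambda>_. P))
    = (\<integral>\<^sup>+\<zeta>. (\<integral>\<^sup>+z. f (\<zeta>(l := z)) \<partial>P) \<partial>PiM I (\<lambda>_. P))"
proof -
  interpret P: prob_space P by (rule P)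
  define I' where "I' = I - {l}"
  have I': "finite I'" "l \<notin> I'" "I = insert l I'" using I l by (auto simp: I'_def)
  have f': "f \<in> borel_measurable (PiM (insert l I') (\<lambda>_. P))" using f I'(3) by simp
  have upd: "(\<lambda>w. (fst w)(l := snd w)) \<in> PiM (insert l I') (\<lambda>_. P) \<Otimes>\<^sub>M P \<rightarrow>\<^sub>M PiM (insert l I') (\<lambda>_. P)"
  proof (rule measurable_PiM_single')
    fix i assume i: "i \<in> insert l I'"
    show "(\<lambda>w. ((fst w)(l := snd w)) i) \<in> PiM (insert l I') (\<lambda>_. P) \<Otimes>\<^sub>M P \<rightarrow>\<^sub>M P"
    proof (cases "i = l")
      case False
      then have "i \<in> insert l I'" "i \<noteq> l" using i by auto
      then show ?thesis by simp
    qed simp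
  qed (auto simp: space_pair_measure space_PiM PiE_def extensional_def)
  have m2: "(\<lambda>\<zeta>. (\<integral>\<^sup>+z. f (\<zeta>(l := z)) \<partial>P)) \<in> borel_measurable (PiM (insert l I') (\<lambda>_. P))"
  proof (rule sigma_finite_measure.borel_measurable_nn_integral[OF prob_space_imp_sigma_finite[OF P]])
    show "(\<lambda>(\<zeta>, z). f (\<zeta>(l := z))) \<in> borel_measurable (PiM (insert l I') (\<lambda>_. P) \<Otimes>\<^sub>M P)"
      using measurable_compose[OF upd f'] by (simp add: case_prod_beta)
  qed
  have "(\<integral>\<^sup>+\<zeta>. (\<integral>\<^sup>+z. f (\<zeta>(l := z)) \<partial>P) \<partial>PiM (insert l I') (\<lambda>_. P))
      = (\<integral>\<^sup>+\<zeta>. (\<integral>\<^sup>+y. (\<integral>\<^sup>+z. f ((\<zeta>(l := y))(l := z)) \<partial>P) \<partial>P) \<partial>PiM I' (\<lambda>_. P))"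
    by (rule product_nn_integral_insert[OF I'(1,2) m2])
  also have "\<dots> = (\<integral>\<^sup>+\<zeta>. (\<integral>\<^sup>+z. f (\<zeta>(l := z)) \<partial>P) \<partial>PiM I' (\<lambda>_. P))"
    by (simp add: P.emeasure_space_1)
  also have "\<dots> = (\<integral>\<^sup>+\<zeta>. f \<zeta> \<partial>PiM (insert l I') (\<lambda>_. P))"
    by (rule product_nn_integral_insert[OF I'(1,2) f', symmetric])
  finally show ?thesis by (simp add: I'(3))
qed

text \<open>Invariance of \<open>a\<close> and \<open>H\<close> under \<open>\<zeta>(l := z)\<close>
  says that they belong to the past of sample \<open>l\<close>. Conditioning on the past is then
  integration over this one coordinate, without conditional expectations.\<close>

lemma second_moment_add_fresh_sample:
  fixes a :: "('i \<Rightarrow> 'z) \<Rightarrow> 'a::euclidean_space" and H :: "('i \<Rightarrow> 'z) \<Rightarrow> 'z \<Rightarrow> 'a"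
  defines "Q \<equiv> PiM I (\<lambda>_. P)"
  assumes l: "l \<in> I"
    and a: "a \<in> borel_measurable Q" "\<And>\<zeta> z. a (\<zeta>(l := z)) = a \<zeta>"
    and H: "(\<lambda>(\<zeta>, z). H \<zeta> z) \<in> borel_measurable (Q \<Otimes>\<^sub>M P)" "\<And>\<zeta> z. H (\<zeta>(l := z)) = H \<zeta>"
    and int: "\<And>\<zeta>. \<zeta> \<in> space Q \<Longrightarrow> integrable P (H \<zeta>)"
    and mean: "\<And>\<zeta>. \<zeta> \<in> space Q \<Longrightarrow> (LINT z|P. H \<zeta> z) = 0"
    and V: "\<And>\<zeta>. \<zeta> \<in> space Q \<Longrightarrow> (\<integral>\<^sup>+z. ennreal ((norm (H \<zeta> z))\<^sup>2) \<partial>P) \<le> V \<zeta>"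
    and Vm: "V \<in> borel_measurable Q"
  shows "(\<integral>\<^sup>+\<zeta>. ennreal ((norm (a \<zeta> + H \<zeta> (\<zeta> l)))\<^sup>2) \<partial>Q)
    \<le> (\<integral>\<^sup>+\<zeta>. ennreal ((norm (a \<zeta>))\<^sup>2) \<partial>Q) + (\<integral>\<^sup>+\<zeta>. V \<zeta> \<partial>Q)"
proof -
  interpret P: prob_space P by (rule P)
  have [measurable]: "(\<lambda>\<zeta>. H \<zeta> (\<zeta> l)) \<in> borel_measurable Q"
  proof -
    have "(\<lambda>\<zeta>. (\<zeta>, \<zeta> l)) \<in> Q \<rightarrow>\<^sub>M Q \<Otimes>\<^sub>M P" using l by (simp add: Q_def)
    from measurable_compose[OF this H(1)] show ?thesis by simp
  qed
  note [measurable] = a(1) Vm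
  have "(\<integral>\<^sup>+\<zeta>. ennreal ((norm (a \<zeta> + H \<zeta> (\<zeta> l)))\<^sup>2) \<partial>Q)
      = (\<integral>\<^sup>+\<zeta>. (\<integral>\<^sup>+z. ennreal ((norm (a \<zeta> + H \<zeta> z))\<^sup>2) \<partial>P) \<partial>Q)"
    unfolding Q_def by (subst nn_integral_PiM_resample[OF l]) (simp_all add: a(2) H(2) flip: Q_def)
  also have "\<dots> \<le> (\<integral>\<^sup>+\<zeta>. ennreal ((norm (a \<zeta>))\<^sup>2) + V \<zeta> \<partial>Q)"
  proof (rule nn_integral_mono)
    fix \<zeta> assume \<zeta>: "\<zeta> \<in> space Q"
    have "(\<integral>\<^sup>+z. ennreal ((norm (a \<zeta> + H \<zeta> z))\<^sup>2) \<partial>P)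
        \<le> ennreal ((norm (a \<zeta>))\<^sup>2) + (\<integral>\<^sup>+z. ennreal ((norm (H \<zeta> z))\<^sup>2) \<partial>P)"
      by (rule P.second_moment_add_centered_le[OF int[OF \<zeta>] mean[OF \<zeta>]])
    then show "(\<integral>\<^sup>+z. ennreal ((norm (a \<zeta> + H \<zeta> z))\<^sup>2) \<partial>P) \<le> ennreal ((norm (a \<zeta>))\<^sup>2) + V \<zeta>"
      using V[OF \<zeta>] by (meson add_left_mono order_trans)
  qed
  also have "\<dots> = (\<integral>\<^sup>+\<zeta>. ennreal ((norm (a \<zeta>))\<^sup>2) \<partial>Q) + (\<integral>\<^sup>+\<zeta>. V \<zeta> \<partial>Q)"
    by (intro nn_integral_add) auto
  finally show ?thesis .
qed

text \<open>By injectivity of \<open>l\<close> the partial sum does not read the next label, so it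
  counts as past for the next sample. Variances therefore add up, giving the factor n rather than
  n^2.\<close>

lemma second_moment_add_fresh_batch:
  fixes a :: "('i \<Rightarrow> 'z) \<Rightarrow> 'a::euclidean_space" and H :: "('i \<Rightarrow> 'z) \<Rightarrow> 'z \<Rightarrow> 'a"
  defines "Q \<equiv> PiM I (\<lambda>_. P)"
  assumes l: "\<And>i. i < n \<Longrightarrow> l i \<in> I" "inj_on l {..<n}"
    and a: "a \<in> borel_measurable Q" "\<And>\<zeta> z i. i < n \<Longrightarrow> a (\<zeta>(l i := z)) = a \<zeta>"
    and H: "(\<lambda>(\<zeta>, z). H \<zeta> z) \<in> borel_measurable (Q \<Otimes>\<^sub>M P)"
      "\<And>\<zeta> z i. i < n \<Longrightarrow> H (\<zeta>(l i := z)) = H \<zeta>"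
    and int: "\<And>\<zeta>. \<zeta> \<in> space Q \<Longrightarrow> integrable P (H \<zeta>)"
    and mean: "\<And>\<zeta>. \<zeta> \<in> space Q \<Longrightarrow> (LINT z|P. H \<zeta> z) = 0"
    and V: "\<And>\<zeta>. \<zeta> \<in> space Q \<Longrightarrow> (\<integral>\<^sup>+z. ennreal ((norm (H \<zeta> z))\<^sup>2) \<partial>P) \<le> V \<zeta>"
    and Vm: "V \<in> borel_measurable Q"
  shows "(\<integral>\<^sup>+\<zeta>. ennreal ((norm (a \<zeta> + (\<Sum>i<n. H \<zeta> (\<zeta> (l i)))))\<^sup>2) \<partial>Q)
    \<le> (\<integral>\<^sup>+\<zeta>. ennreal ((norm (a \<zeta>))\<^sup>2) \<partial>Q) + of_nat n * (\<integral>\<^sup>+\<zeta>. V \<zeta> \<partial>Q)"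
  using l a(2) H(2)
proof (induction n)
  case (Suc n)
  let ?a = "\<lambda>\<zeta>. a \<zeta> + (\<Sum>i<n. H \<zeta> (\<zeta> (l i)))"
  have Hm: "(\<lambda>\<zeta>. H \<zeta> (\<zeta> (l i))) \<in> borel_measurable Q" if "i < Suc n" for i
  proof -
    have "(\<lambda>\<zeta>. (\<zeta>, \<zeta> (l i))) \<in> Q \<rightarrow>\<^sub>M Q \<Otimes>\<^sub>M P" using Suc.prems(1)[OF that] by (simp add: Q_def)
    from measurable_compose[OF this H(1)] show ?thesis by simp
  qed
  have am: "?a \<in> borel_measurable Q" using a(1) Hm by (intro borel_measurable_add borel_measurable_sum) auto
  have ne: "l i \<noteq> l n" if "i < n" for i
    using Suc.prems(2) that by (auto simp: inj_on_def)
  have "(\<integral>\<^sup>+\<zeta>. ennreal ((norm (?a \<zeta> + H \<zeta> (\<zeta> (l n))))\<^sup>2) \<partial>Q)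
    \<le> (\<integral>\<^sup>+\<zeta>. ennreal ((norm (?a \<zeta>))\<^sup>2) \<partial>Q) + (\<integral>\<^sup>+\<zeta>. V \<zeta> \<partial>Q)"
    unfolding Q_def
  proof (rule second_moment_add_fresh_sample)
    show "l n \<in> I" using Suc.prems(1) by simp
    show "?a (\<zeta>(l n := z)) = ?a \<zeta>" for \<zeta> z
      unfolding Suc.prems(3)[OF lessI] Suc.prems(4)[OF lessI] using ne by simp
    show "H (\<zeta>(l n := z)) = H \<zeta>" for \<zeta> z
      by (rule Suc.prems(4)[OF lessI])
  qed (use am H(1) int mean V Vm in \<open>simp_all add: Q_def\<close>)
  also have "\<dots> \<le> (\<integral>\<^sup>+\<zeta>. ennreal ((norm (a \<zeta>))\<^sup>2) \<partial>Q) + of_nat n * (\<integral>\<^sup>+\<zeta>. V \<zeta> \<partial>Q) + (\<integral>\<^sup>+\<zeta>. V \<zeta> \<partial>Q)"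
    by (intro add_right_mono Suc.IH) (use Suc.prems in \<open>auto intro: inj_on_subset\<close>)
  finally show ?case by (simp add: algebra_simps)
qed simp

end

section \<open>The weights\<close>

text \<open>Chebyshev's sum inequality for oppositely ordered sequences, up to the factor
  \<open>K\<close> by which \<gamma> may fail to increase: a two-index inequality is summed over all
  pairs.\<close>

lemma sum_mult_le_of_almost_monotone:
  fixes \<gamma> \<alpha> :: "nat \<Rightarrow> real"
  assumes K: "K \<ge> 1"
    and \<gamma>: "\<And>t. t \<le> m \<Longrightarrow> 0 \<le> \<gamma> t" "\<And>s t. s \<le> t \<Longrightarrow> t \<le> m \<Longrightarrow> \<gamma> s \<le> K * \<gamma> t"
    and \<alpha>: "\<And>t. 0 \<le> \<alpha> t" "\<And>s t. s \<le> t \<Longrightarrow> \<alpha> t \<le> \<alpha> s"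
  shows "(real m + 1) * (\<Sum>t\<le>m. \<gamma> t * \<alpha> t) \<le> K * (\<Sum>t\<le>m. \<gamma> t) * (\<Sum>t\<le>m. \<alpha> t)"
proof -
  have ord: "\<gamma> t * \<alpha> t + \<gamma> s * \<alpha> s \<le> K * (\<gamma> t * \<alpha> s + \<gamma> s * \<alpha> t)" if st: "s \<le> t" "t \<le> m" for s t
  proof -
    have K0: "\<alpha> t \<le> K * \<alpha> t" "\<alpha> s \<le> K * \<alpha> s"
      using mult_right_mono[OF K \<alpha>(1)] by auto
    show ?thesis
    \<comment> \<open>If \<alpha> drops by at most the factor \<open>K\<close>, each diagonal
      product is dominated by one mixed product. Otherwise
      \<open>\<alpha> s - K * \<alpha> t\<close> is positive and may multiply
      \<open>\<gamma> s \<le> K * \<gamma> t\<close>, which leaves a surplus of K^2 - 1 times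
      \<open>\<gamma> t * \<alpha> t\<close>.\<close>
    proof (cases "\<alpha> s \<le> K * \<alpha> t")
      case True
      have "0 \<le> \<gamma> t * (K * \<alpha> s - \<alpha> t)"
        using \<gamma>(1)[of t] K0 \<alpha>(2)[OF st(1)] st by (intro mult_nonneg_nonneg) auto
      moreover have "0 \<le> \<gamma> s * (K * \<alpha> t - \<alpha> s)"
        using \<gamma>(1)[of s] True st by (intro mult_nonneg_nonneg) auto
      ultimately show ?thesis by (simp add: algebra_simps)
    next
      case False
      then have "(\<alpha> s - K * \<alpha> t) * \<gamma> s \<le> (\<alpha> s - K * \<alpha> t) * (K * \<gamma> t)"
        using \<gamma>(2)[OF st] by (intro mult_left_mono) auto
      moreover have "0 \<le> \<gamma> t * \<alpha> t * (K * K - 1)"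
        using \<gamma>(1)[of t] st \<alpha>(1)[of t] K mult_mono[OF K K] by (intro mult_nonneg_nonneg) auto
      ultimately show ?thesis by (simp add: algebra_simps)
    qed
  qed
  have sym: "\<gamma> t * \<alpha> t + \<gamma> s * \<alpha> s \<le> K * (\<gamma> t * \<alpha> s + \<gamma> s * \<alpha> t)" if "s \<le> m" "t \<le> m" for s t
    using ord[of s t] ord[of t s] that by (cases "s \<le> t") (auto simp: algebra_simps)
  have "(\<Sum>s\<le>m. \<Sum>t\<le>m. \<gamma> t * \<alpha> t + \<gamma> s * \<alpha> s)
      \<le> (\<Sum>s\<le>m. \<Sum>t\<le>m. K * (\<gamma> t * \<alpha> s + \<gamma> s * \<alpha> t))"
    using sym by (intro sum_mono) auto
  also have "(\<Sum>s\<le>m. \<Sum>t\<le>m. \<gamma> t * \<alpha> t + \<gamma> s * \<alpha> s) = 2 * ((real m + 1) * (\<Sum>t\<le>m. \<gamma> t * \<alpha> t))"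
    by (simp add: sum.distrib algebra_simps flip: sum_distrib_left)
  also have "(\<Sum>s\<le>m. \<Sum>t\<le>m. K * (\<gamma> t * \<alpha> s + \<gamma> s * \<alpha> t)) = 2 * (K * (\<Sum>t\<le>m. \<gamma> t) * (\<Sum>t\<le>m. \<alpha> t))"
  proof -
    have "(\<Sum>s\<le>m. \<Sum>t\<le>m. \<gamma> t * \<alpha> s + \<gamma> s * \<alpha> t)
        = (\<Sum>s\<le>m. (\<Sum>t\<le>m. \<gamma> t) * \<alpha> s + \<gamma> s * (\<Sum>t\<le>m. \<alpha> t))"
      by (simp add: sum.distrib sum_distrib_left sum_distrib_right)
    also have "\<dots> = 2 * ((\<Sum>t\<le>m. \<gamma> t) * (\<Sum>t\<le>m. \<alpha> t))"
      by (simp add: sum.distrib flip: sum_distrib_left sum_distrib_right)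
    finally have "(\<Sum>s\<le>m. \<Sum>t\<le>m. \<gamma> t * \<alpha> s + \<gamma> s * \<alpha> t)
        = 2 * ((\<Sum>t\<le>m. \<gamma> t) * (\<Sum>t\<le>m. \<alpha> t))" .
    then show ?thesis by (simp flip: sum_distrib_left)
  qed
  finally show ?thesis by simp
qed

section \<open>The scalar recursion behind the weights\<close>

locale weight_recursion =
  fixes y :: "nat \<Rightarrow> real" and \<beta> \<kappa> :: real and m :: nat
  assumes y0: "y 0 = 0"
    and y_Suc: "\<And>r. r < m \<Longrightarrow> y (Suc r) = \<beta>\<^sup>2 * (y r + \<kappa> / (1 + y r))"
    and \<beta>: "0 \<le> \<beta>" "\<beta> < 1" and \<kappa>: "0 \<le> \<kappa>" "\<kappa> \<le> 3/2"
begin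

lemma \<beta>2: "\<beta>\<^sup>2 < 1" "\<beta>\<^sup>2 \<le> \<beta>"
  using \<beta> by (auto simp: power2_eq_square mult_left_le intro: mult_less_cancel_left2[THEN iffD2])
     (meson less_eq_real_def mult_left_le order_le_less_trans)

lemma y_nonneg: "r \<le> m \<Longrightarrow> 0 \<le> y r"
proof (induction r)
  case (Suc r)
  then show ?case using y_Suc[of r] \<kappa>(1) by simp
qed (simp add: y0)

text \<open>The root is a barrier \<open>Y\<close>: since y + \<kappa> / (1 + y) is convex in y, on
  [0, Y] it is at most the larger of its endpoint values, and multiplication by \<beta>^2 brings
  both of them below \<open>Y\<close>. The facts \<open>base\<close> and \<open>top\<close> treat
  the two endpoints.\<close>

lemma y_le_sqrt:
  assumes A: "\<kappa> \<le> 2 * A" "0 \<le> A" and r: "r \<le> m"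
  shows "y r \<le> sqrt (2 * A / (1 - \<beta>))"
proof -
  define Y where "Y = sqrt (2 * A / (1 - \<beta>))"
  have Y: "0 \<le> Y" "(1 - \<beta>) * Y\<^sup>2 = 2 * A"
    using A \<beta> by (auto simp: Y_def)
  have base: "\<beta>\<^sup>2 * \<kappa> \<le> Y"
    unfolding Y_def
  proof (rule real_le_rsqrt)
    have "\<beta> * (1 - \<beta>) \<le> 1/4"
      using zero_le_power2[of "\<beta> - 1/2"] by (simp add: power2_eq_square algebra_simps)
    moreover have "\<beta>\<^sup>2 * \<beta> \<le> 1" using \<beta>2 \<beta> mult_le_one[of "\<beta>\<^sup>2" \<beta>] by simp
    ultimately have "(\<beta>\<^sup>2 * \<beta>) * (\<beta> * (1 - \<beta>)) \<le> 1 * (1/4)"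
      using \<beta> by (intro mult_mono) auto
    then have q: "\<beta>^4 * (1 - \<beta>) \<le> 1/4" by (simp add: power2_eq_square power4_eq_xxxx)
    have "(\<beta>\<^sup>2 * \<kappa>)\<^sup>2 * (1 - \<beta>) = (\<beta>^4 * (1 - \<beta>)) * (\<kappa> * \<kappa>)"
      by (simp add: power2_eq_square power4_eq_xxxx)
    also have "\<dots> \<le> 1/4 * ((3/2) * (2 * A))"
      using q \<beta> \<kappa> A by (intro mult_mono) auto
    also have "\<dots> \<le> 2 * A" using A by simp
    finally show "(\<beta>\<^sup>2 * \<kappa>)\<^sup>2 \<le> 2 * A / (1 - \<beta>)" using \<beta> by (simp add: field_simps)
  qed
  have top: "\<beta>\<^sup>2 * (Y + \<kappa> / (1 + Y)) \<le> Y"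
  proof -
    have "\<beta>\<^sup>2 * \<kappa> \<le> \<kappa>" using \<beta>2 \<kappa> by (simp add: mult_left_le_one_le)
    also have "\<dots> \<le> (1 - \<beta>) * Y\<^sup>2" using Y A by simp
    also have "\<dots> \<le> (1 - \<beta>\<^sup>2) * Y\<^sup>2" using \<beta>2 by (intro mult_right_mono) auto
    also have "\<dots> \<le> (1 - \<beta>\<^sup>2) * (Y * (1 + Y))"
      using \<beta>2 Y(1) by (intro mult_left_mono) (auto simp: power2_eq_square algebra_simps)
    finally have "\<beta>\<^sup>2 * (Y * (1 + Y) + \<kappa>) \<le> Y * (1 + Y)" by (simp add: algebra_simps)
    then show ?thesis using Y(1) by (simp add: field_simps)
  qed
  show ?thesis unfolding Y_def[symmetric] using r
  proof (induction r)
    case (Suc r)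
    then have yr: "0 \<le> y r" "y r \<le> Y" using y_nonneg by auto
    \<comment> \<open>Convexity by hand: in the first case the secant towards \<open>Y\<close> has
      nonnegative slope, so the right endpoint dominates; in the second \<kappa> exceeds 1 + y_r and
      the value at 0 dominates.\<close>
    have "y r + \<kappa> / (1 + y r) \<le> max \<kappa> (Y + \<kappa> / (1 + Y))"
    proof (cases "\<kappa> \<le> (1 + y r) * (1 + Y)")
      case True
      have "\<kappa> / (1 + y r) - \<kappa> / (1 + Y) = \<kappa> / ((1 + y r) * (1 + Y)) * (Y - y r)"
        using yr by (simp add: field_simps)
      also have "\<dots> \<le> 1 * (Y - y r)"
        using True yr by (intro mult_right_mono) auto
      finally show ?thesis by simp
    next
      case False
      have "1 + y r \<le> (1 + y r) * (1 + Y)" using yr Y(1) by (simp add: algebra_simps)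
      then have "y r * (1 + y r) \<le> y r * \<kappa>" using False yr by (intro mult_left_mono) linarith+
      then have "y r + \<kappa> / (1 + y r) \<le> \<kappa>" using yr by (simp add: field_simps)
      then show ?thesis by simp
    qed
    then have "y (Suc r) \<le> \<beta>\<^sup>2 * max \<kappa> (Y + \<kappa> / (1 + Y))"
      using y_Suc[of r] Suc.prems by (simp add: mult_left_mono)
    also have "\<dots> \<le> Y" using base top by (simp add: max_def)
    finally show ?case .
  qed (simp add: y0 Y)
qed

text \<open>For \<open>\<beta>\<^sup>2 \<ge> 1/3\<close> the sequence is monotone; for smaller \<open>\<beta>\<close> it need not be, but then it is
  bounded by \<open>2 \<beta>\<close>.\<close>

lemma y_almost_mono:
  assumes "q \<le> r" "r \<le> m"
  shows "1 + y q \<le> (1 + 2 * \<beta>) * (1 + y r)"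
proof (cases "\<beta>\<^sup>2 \<ge> 1/3")
  case True
  \<comment> \<open>Here the bound 3/2 matters: (1 - \<beta>^2) \<kappa> \<le> (2/3) (3/2) = 1.
    Hence the secant slope 1 - \<kappa> / ((1 + y) (1 + y')) of the recursion map is nonnegative as
    soon as y' \<ge> \<beta>^2 \<kappa>, which the second conjunct of the following induction
    carries along.\<close>
  have k: "\<kappa> \<le> 1 + \<beta>\<^sup>2 * \<kappa>"
  proof -
    have "(1 - \<beta>\<^sup>2) * \<kappa> \<le> (2/3) * (3/2)" using True \<kappa> \<beta>2 by (intro mult_mono) auto
    then show ?thesis by (simp add: algebra_simps)
  qed
  have "Suc r \<le> m \<Longrightarrow> y r \<le> y (Suc r) \<and> \<beta>\<^sup>2 * \<kappa> \<le> y (Suc r)" for r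
  proof (induction r)
    case 0
    then show ?case using y_Suc[of 0] y0 \<kappa> by simp
  next
    case (Suc r)
    then have IH: "y r \<le> y (Suc r)" "\<beta>\<^sup>2 * \<kappa> \<le> y (Suc r)" by auto
    have nn: "0 \<le> y r" "0 \<le> y (Suc r)" using y_nonneg Suc.prems by auto
    have "1 * (1 + \<beta>\<^sup>2 * \<kappa>) \<le> (1 + y r) * (1 + y (Suc r))"
      using nn IH \<kappa> by (intro mult_mono) auto
    with k have "\<kappa> / ((1 + y r) * (1 + y (Suc r))) \<le> 1" using nn by simp
    then have "\<kappa> / ((1 + y r) * (1 + y (Suc r))) * (y (Suc r) - y r) \<le> 1 * (y (Suc r) - y r)"
      using IH by (intro mult_right_mono) auto
    also have "\<kappa> / ((1 + y r) * (1 + y (Suc r))) * (y (Suc r) - y r)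
        = \<kappa> / (1 + y r) - \<kappa> / (1 + y (Suc r))" using nn by (simp add: field_simps)
    finally have "\<beta>\<^sup>2 * (y r + \<kappa> / (1 + y r)) \<le> \<beta>\<^sup>2 * (y (Suc r) + \<kappa> / (1 + y (Suc r)))"
      by (intro mult_left_mono) auto
    then show ?case using y_Suc[of r] y_Suc[of "Suc r"] Suc.prems IH by simp
  qed
  then have step: "y r \<le> y (Suc r)" if "Suc r \<le> m" for r using that by blast
  have "y q \<le> y r"
    using assms
  proof (induction r rule: dec_induct)
    case (step n)
    then show ?case using \<open>\<And>r. Suc r \<le> m \<Longrightarrow> y r \<le> y (Suc r)\<close>[of n] by simp
  qed simp
  moreover have "1 * (1 + y r) \<le> (1 + 2 * \<beta>) * (1 + y r)"
    using \<beta> y_nonneg[OF assms(2)] by (intro mult_right_mono) auto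
  ultimately show ?thesis by simp
next
  case False
  have bd: "y r \<le> 2 * \<beta>" if "r \<le> m" for r
    using that
  proof (induction r)
    case (Suc r)
    then have yr: "0 \<le> y r" "y r \<le> 2 * \<beta>" using y_nonneg by auto
    \<comment> \<open>\<beta>^2 < 1/3 < (3/5)^2. With this, 2 \<beta>^2 + (3/2) \<beta> is below 2/3
      + 9/10 < 2, which closes the induction for the bound 2 \<beta>.\<close>
    have "\<beta> \<le> 3/5"
    proof (rule ccontr)
      assume "\<not> \<beta> \<le> 3/5"
      then have "(3/5)\<^sup>2 \<le> \<beta>\<^sup>2" by (intro power_mono) auto
      with False show False by (simp add: power2_eq_square)
    qed
    have "\<kappa> / (1 + y r) \<le> \<kappa>" using \<kappa> yr by (simp add: field_simps)
    then have "\<beta>\<^sup>2 * (y r + \<kappa> / (1 + y r)) \<le> \<beta>\<^sup>2 * (2 * \<beta> + 3/2)"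
      using yr \<kappa> by (intro mult_left_mono) auto
    also have "\<dots> = \<beta> * (2 * \<beta>\<^sup>2 + 3/2 * \<beta>)" by (simp add: power2_eq_square algebra_simps)
    also have "\<dots> \<le> \<beta> * 2"
      using False \<beta> \<open>\<beta> \<le> 3/5\<close> by (intro mult_left_mono) auto
    finally show ?case using y_Suc[of r] Suc.prems by simp
  qed (simp add: y0 \<beta>)
  have "1 + y q \<le> (1 + 2 * \<beta>) * 1" using bd[of q] assms by simp
  also have "\<dots> \<le> (1 + 2 * \<beta>) * (1 + y r)"
    using \<beta> y_nonneg[OF assms(2)] by (intro mult_left_mono) auto
  finally show ?thesis .
qed

end

section \<open>The step-size weights as an instance of the recursion\<close>

locale hsgd_weights =
  fixes L \<eta> \<delta> \<beta> :: real and \<gamma> :: "nat \<Rightarrow> real" and m b :: nat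
  assumes L: "0 < L" and \<eta>: "0 < \<eta>" "\<eta> < 1 / L" and \<delta>: "\<delta> = 2 / \<eta> - 2 * L"
    and b: "1 \<le> b" and \<beta>: "0 \<le> \<beta>" "\<beta> < 1"
    and \<gamma>_m: "\<gamma> m = \<delta> / L"
    and \<gamma>_t: "\<And>t. t < m \<Longrightarrow> \<gamma> t = \<delta> * real b /
        (L * real b + L * (1 + L\<^sup>2 * \<eta>\<^sup>2) * (\<Sum>k=t+1..m. \<beta> ^ (2 * (k - t)) * \<gamma> k))"
    and \<gamma>_range: "\<And>t. t \<le> m \<Longrightarrow> 0 < \<gamma> t \<and> \<gamma> t \<le> 1"
begin

text \<open>The cost of the displacement of step t in later errors: it enters the variance at t + 1
  and is damped to \<beta>^(2 (k - t)) when step k charges it with weight \<gamma>_k.\<close>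

definition A :: "nat \<Rightarrow> real" where
  "A t = (\<Sum>k=t+1..m. \<beta> ^ (2 * (k - t)) * \<gamma> k)"

definition \<kappa> :: real where "\<kappa> = (1 + L\<^sup>2 * \<eta>\<^sup>2) * (\<delta> / L) / real b"

text \<open>Counting from the end turns the backward definition of the weights into a forward
  recursion that starts at 0.\<close>

definition y :: "nat \<Rightarrow> real" where
  "y r = (1 + L\<^sup>2 * \<eta>\<^sup>2) * A (m - r) / real b"

lemma L\<eta>: "L * \<eta> < 1" using \<eta> L by (simp add: field_simps)

lemma L\<eta>2: "L\<^sup>2 * \<eta>\<^sup>2 < 1"
proof -
  have "(L * \<eta>)\<^sup>2 < 1" using L\<eta> L \<eta> by (simp add: power_less_one_iff)
  then show ?thesis by (simp add: power_mult_distrib)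
qed

lemma \<delta>_pos: "0 < \<delta>" using L\<eta> \<eta> by (simp add: \<delta> field_simps)

lemma A_nonneg: "0 \<le> A t"
  unfolding A_def using \<gamma>_range \<beta> by (intro sum_nonneg mult_nonneg_nonneg) (auto simp: less_imp_le)

lemma A_Suc: "t < m \<Longrightarrow> A t = \<beta>\<^sup>2 * (\<gamma> (Suc t) + A (Suc t))"
proof -
  assume t: "t < m"
  have "A t = \<beta> ^ (2 * (Suc t - t)) * \<gamma> (Suc t) + (\<Sum>k=Suc (Suc t)..m. \<beta> ^ (2 * (k - t)) * \<gamma> k)"
    unfolding A_def using t by (simp add: sum.atLeast_Suc_atMost)
  also have "(\<Sum>k=Suc (Suc t)..m. \<beta> ^ (2 * (k - t)) * \<gamma> k)
      = (\<Sum>k=Suc (Suc t)..m. \<beta>\<^sup>2 * (\<beta> ^ (2 * (k - Suc t)) * \<gamma> k))"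
  proof (rule sum.cong)
    fix k assume "k \<in> {Suc (Suc t)..m}"
    then have "2 * (k - t) = 2 + 2 * (k - Suc t)" by auto
    then show "\<beta> ^ (2 * (k - t)) * \<gamma> k = \<beta>\<^sup>2 * (\<beta> ^ (2 * (k - Suc t)) * \<gamma> k)"
      by (simp only: power_add mult.assoc)
  qed simp
  finally show ?thesis by (simp add: A_def sum_distrib_left algebra_simps power2_eq_square)
qed

lemma y_nn: "0 \<le> y r"
  unfolding y_def using A_nonneg by simp

lemma \<gamma>_eq: "t \<le> m \<Longrightarrow> \<gamma> t = (\<delta> / L) / (1 + y (m - t))"
proof (cases "t = m")
  case True
  then show ?thesis by (simp add: \<gamma>_m y_def A_def)
next
  case False
  assume "t \<le> m"
  with False have t: "t < m" by simp
  have "L * real b + L * (1 + L\<^sup>2 * \<eta>\<^sup>2) * A t = L * real b * (1 + y (m - t))"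
    using t b by (simp add: y_def field_simps)
  then have "\<gamma> t = \<delta> * real b / (L * real b * (1 + y (m - t)))"
    using \<gamma>_t[OF t] by (simp add: A_def)
  also have "\<dots> = \<delta> / (L * (1 + y (m - t)))" using b by simp
  finally show ?thesis by simp
qed

text \<open>The defining fraction with its denominator cleared. It identifies \<delta> - L
  \<gamma>_t, by which a step is credited for its squared displacement, with the charge that this
  displacement collects later through \<open>A t\<close>.\<close>

lemma \<gamma>_balance:
  assumes "t \<le> m"
  shows "L * \<gamma> t + L * \<gamma> t * (1 + L\<^sup>2 * \<eta>\<^sup>2) / real b * A t = \<delta>"
proof -
  have "L * \<gamma> t * (1 + y (m - t)) = \<delta>"
    using \<gamma>_eq[OF assms] y_nn[of "m - t"] L by simp
  then show ?thesis using assms by (simp add: y_def algebra_simps)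
qed

text \<open>With u = L \<eta>, the condition \<gamma>_m \<le> 1 reads 2 / u - 2 \<le> 1, so u \<ge>
  2/3. On [2/3, 1] the product (1 + u^2) (2 / u - 2) is largest at 2/3, with value 13/9 < 3/2, and
  dividing by b \<ge> 1 only helps.\<close>

lemma \<kappa>_bounds: "0 \<le> \<kappa>" "\<kappa> \<le> 3/2" "\<kappa> \<le> 2 * (\<delta> / (L * real b))"
proof -
  have d: "\<delta> / L \<le> 1" using \<gamma>_range[of m] \<gamma>_m by simp
  show "0 \<le> \<kappa>" unfolding \<kappa>_def using \<delta>_pos L by simp
  have "(1 + L\<^sup>2 * \<eta>\<^sup>2) * (\<delta> / (L * real b)) \<le> 2 * (\<delta> / (L * real b))"
    using L\<eta>2 \<delta>_pos L by (intro mult_right_mono) auto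
  then show "\<kappa> \<le> 2 * (\<delta> / (L * real b))" by (simp add: \<kappa>_def)
  define u where "u = L * \<eta>"
  have u: "0 < u" "u < 1" using L\<eta> L \<eta> by (auto simp: u_def)
  have du: "\<delta> / L = 2 / u - 2" using L \<eta> by (simp add: \<delta> u_def field_simps)
  with d have u23: "2/3 \<le> u" using u by (simp add: field_simps)
  have "(1 + u\<^sup>2) * (1 - u) \<le> 3/4 * u"
  proof -
    \<comment> \<open>Division of the cubic by u - 2/3: the remainder 1/54 is its value at 2/3, and
      the quotient is nonnegative for u \<ge> 2/3.\<close>
    have "(3/4 * u - (1 + u\<^sup>2) * (1 - u)) = (u - 2/3) * (u * (u - 1/3) + 55/36) + 1/54"
      by (simp add: power2_eq_square field_simps)
    moreover have "0 \<le> (u - 2/3) * (u * (u - 1/3) + 55/36)"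
      using u23 u by (intro mult_nonneg_nonneg add_nonneg_nonneg) auto
    ultimately show ?thesis by linarith
  qed
  then have "(1 + u\<^sup>2) * (2 / u - 2) \<le> 3/2" using u by (simp add: field_simps)
  then have "(1 + L\<^sup>2 * \<eta>\<^sup>2) * (\<delta> / L) \<le> 3/2" by (simp add: du u_def power_mult_distrib)
  moreover have "0 \<le> (1 + L\<^sup>2 * \<eta>\<^sup>2) * (\<delta> / L)" using \<delta>_pos L by simp
  ultimately have "(1 + L\<^sup>2 * \<eta>\<^sup>2) * (\<delta> / L) / real b \<le> (3/2) / 1"
    using b by (intro frac_le) auto
  then show "\<kappa> \<le> 3/2" by (simp add: \<kappa>_def)
qed

sublocale weight_recursion y \<beta> \<kappa> m
proof
  show "y 0 = 0" by (simp add: y_def A_def)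
  show "y (Suc r) = \<beta>\<^sup>2 * (y r + \<kappa> / (1 + y r))" if r: "r < m" for r
  proof -
    have s: "Suc (m - Suc r) = m - r" using r by simp
    have "y (Suc r) = (1 + L\<^sup>2 * \<eta>\<^sup>2) * (\<beta>\<^sup>2 * (\<gamma> (m - r) + A (m - r))) / real b"
      using A_Suc[of "m - Suc r"] r unfolding s y_def by simp
    also have "\<dots> = \<beta>\<^sup>2 * (y r + (1 + L\<^sup>2 * \<eta>\<^sup>2) * \<gamma> (m - r) / real b)"
      by (simp add: y_def algebra_simps add_divide_distrib)
    also have "(1 + L\<^sup>2 * \<eta>\<^sup>2) * \<gamma> (m - r) / real b = \<kappa> / (1 + y r)"
      using \<gamma>_eq[of "m - r"] r by (simp add: \<kappa>_def)
    finally show ?thesis .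
  qed
qed (use \<beta> \<kappa>_bounds in auto)

lemma \<gamma>_almost_mono:
  assumes "s \<le> t" "t \<le> m"
  shows "\<gamma> s \<le> (1 + 2 * \<beta>) * \<gamma> t"
proof -
  have "1 + y (m - t) \<le> (1 + 2 * \<beta>) * (1 + y (m - s))"
    using assms by (intro y_almost_mono) auto
  then have "1 / (1 + y (m - s)) \<le> (1 + 2 * \<beta>) / (1 + y (m - t))"
    using y_nn[of "m - t"] y_nn[of "m - s"] by (simp add: field_simps)
  then have "(\<delta> / L) * (1 / (1 + y (m - s))) \<le> (\<delta> / L) * ((1 + 2 * \<beta>) / (1 + y (m - t)))"
    using \<delta>_pos L by (intro mult_left_mono) auto
  then show ?thesis
    using assms by (simp add: \<gamma>_eq mult.commute)
qed

text \<open>Each weight is bounded below separately, by the barrier for \<open>y\<close> with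
  parameter \<delta> / (L b). Only the root carries the factor sqrt 2; it is granted to
  \<open>L\<close> as well so that both terms share it, as in (a).\<close>

lemma sum_\<gamma>_lower:
  "(real m + 1) * \<delta> \<le> sqrt 2 * (L + sqrt (L * \<delta> / (real b * (1 - \<beta>)))) * (\<Sum>t\<le>m. \<gamma> t)"
proof -
  define W where "W = sqrt 2 * (L + sqrt (L * \<delta> / (real b * (1 - \<beta>))))"
  have "\<delta> \<le> W * \<gamma> t" if t: "t \<le> m" for t
  proof -
    have "L * y (m - t) \<le> L * sqrt (2 * (\<delta> / (L * real b)) / (1 - \<beta>))"
      using y_le_sqrt[OF \<kappa>_bounds(3)] \<delta>_pos L by (intro mult_left_mono) auto
    also have "\<dots> = sqrt (L\<^sup>2 * (2 * (\<delta> / (L * real b)) / (1 - \<beta>)))"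
      unfolding real_sqrt_mult[of "L\<^sup>2"] using L by simp
    also have "L\<^sup>2 * (2 * (\<delta> / (L * real b)) / (1 - \<beta>)) = 2 * (L * \<delta> / (real b * (1 - \<beta>)))"
      using L by (simp add: power2_eq_square)
    finally have "L * y (m - t) \<le> sqrt 2 * sqrt (L * \<delta> / (real b * (1 - \<beta>)))"
      by (simp add: real_sqrt_mult real_sqrt_divide)
    moreover have "1 * L \<le> sqrt 2 * L" using L by (intro mult_right_mono) auto
    ultimately have "L * (1 + y (m - t)) \<le> W" by (simp add: W_def algebra_simps)
    then have "L * (1 + y (m - t)) * \<gamma> t \<le> W * \<gamma> t"
      using \<gamma>_range[OF t] by (intro mult_right_mono) auto
    moreover have "L * (1 + y (m - t)) * \<gamma> t = \<delta>"
      using \<gamma>_eq[OF t] y_nn[of "m - t"] L by simp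
    ultimately show ?thesis by simp
  qed
  then have "(\<Sum>t\<le>m. \<delta>) \<le> (\<Sum>t\<le>m. W * \<gamma> t)" by (intro sum_mono) auto
  then have "(real m + 1) * \<delta> \<le> W * (\<Sum>t\<le>m. \<gamma> t)"
    by (simp add: algebra_simps flip: sum_distrib_left)
  then show ?thesis by (simp only: W_def)
qed

lemma geometric_le: "(\<Sum>j<n. \<beta> ^ (2 * j)) \<le> 1 / (1 - \<beta>\<^sup>2)"
proof -
  have "(\<Sum>j<n. (\<beta>\<^sup>2) ^ j) \<le> (\<Sum>j. (\<beta>\<^sup>2) ^ j)"
    using \<beta>2 by (intro sum_le_suminf summable_geometric) auto
  then show ?thesis using suminf_geometric[of "\<beta>\<^sup>2"] \<beta>2 by (simp add: power_mult)
qed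

text \<open>The recursion for \<open>E\<close> is unrolled before it is weighted: the displacements
  then collect the coefficients \<open>A\<close>, which \<open>\<gamma>_balance\<close> converts
  into the credits on the right, and the equations for \<theta> put initial and fresh noise on a
  common scale. The claim concerns plain real sequences, so no probability enters.\<close>

lemma weighted_error_bound:
  fixes E D :: "nat \<Rightarrow> real"
  assumes w: "1 - \<beta> = real bh * \<theta>" "real bt * (real m + 1) * (1 - \<beta>) * \<theta> = 1" "0 < \<theta>"
      "1 \<le> bh" "1 \<le> bt"
    and E0: "E 0 \<le> v / real bt"
    and E_Suc: "\<And>t. t < m \<Longrightarrow> E (Suc t) \<le> \<beta>\<^sup>2 * E t + \<beta>\<^sup>2 * L\<^sup>2 * (\<gamma> t)\<^sup>2 / real b * D t + (1 - \<beta>)\<^sup>2 * v / real bh"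
    and v: "0 \<le> v"
  shows "(1 + L\<^sup>2 * \<eta>\<^sup>2) / (2 * L) * (\<Sum>t\<le>m. \<gamma> t * E t)
    \<le> (\<Sum>t\<le>m. \<gamma> t / 2 * (\<delta> - L * \<gamma> t) * D t) + 2 * \<theta> * v / L * (\<Sum>t\<le>m. \<gamma> t)"
proof -
  let ?\<nu> = "(1 - \<beta>)\<^sup>2 * v / real bh" and ?\<rho> = "\<lambda>k. L\<^sup>2 * (\<gamma> k)\<^sup>2 / real b * D k"
  have unroll: "E t \<le> \<beta> ^ (2 * t) * (v / real bt) + (\<Sum>k<t. \<beta> ^ (2 * (t - k)) * ?\<rho> k)
      + (\<Sum>j<t. \<beta> ^ (2 * j)) * ?\<nu>" if "t \<le> m" for t
    using that
  proof (induction t)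
    case (Suc t)
    have "E (Suc t) \<le> \<beta>\<^sup>2 * E t + \<beta>\<^sup>2 * ?\<rho> t + ?\<nu>" using E_Suc[of t] Suc.prems by simp
    also have "\<dots> \<le> \<beta>\<^sup>2 * (\<beta> ^ (2 * t) * (v / real bt) + (\<Sum>k<t. \<beta> ^ (2 * (t - k)) * ?\<rho> k)
      + (\<Sum>j<t. \<beta> ^ (2 * j)) * ?\<nu>) + \<beta>\<^sup>2 * ?\<rho> t + ?\<nu>"
      using Suc by (intro add_right_mono mult_left_mono) auto
    also have "\<dots> = \<beta> ^ (2 * Suc t) * (v / real bt)
        + ((\<Sum>k<t. \<beta>\<^sup>2 * (\<beta> ^ (2 * (t - k)) * ?\<rho> k)) + \<beta> ^ (2 * (Suc t - t)) * ?\<rho> t)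
        + (1 + (\<Sum>j<t. \<beta>\<^sup>2 * \<beta> ^ (2 * j))) * ?\<nu>"
    proof -
      have e: "\<beta> ^ (2 * (Suc t - t)) = \<beta>\<^sup>2" "\<beta> ^ (2 * Suc t) = \<beta>\<^sup>2 * \<beta> ^ (2 * t)"
        by (auto simp: power2_eq_square)
      show ?thesis unfolding e sum_distrib_left[symmetric] by (simp only: algebra_simps)
    qed
    also have "(\<Sum>k<t. \<beta>\<^sup>2 * (\<beta> ^ (2 * (t - k)) * ?\<rho> k)) = (\<Sum>k<t. \<beta> ^ (2 * (Suc t - k)) * ?\<rho> k)"
    proof (rule sum.cong)
      fix k assume "k \<in> {..<t}"
      then have "2 * (Suc t - k) = 2 + 2 * (t - k)" by auto
      then show "\<beta>\<^sup>2 * (\<beta> ^ (2 * (t - k)) * ?\<rho> k) = \<beta> ^ (2 * (Suc t - k)) * ?\<rho> k"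
        by (simp only: power_add mult.assoc)
    qed simp
    also have "1 + (\<Sum>j<t. \<beta>\<^sup>2 * \<beta> ^ (2 * j)) = (\<Sum>j<Suc t. \<beta> ^ (2 * j))"
      by (subst sum.lessThan_Suc_shift) (simp add: power_add power2_eq_square algebra_simps)
    finally show ?case by simp
  qed (use E0 in simp)
  let ?c = "(1 + L\<^sup>2 * \<eta>\<^sup>2) / (2 * L)"
  have c: "0 \<le> ?c" "?c \<le> 1 / L" using L L\<eta>2 by (auto simp: field_simps)
  let ?\<Sigma> = "\<Sum>t\<le>m. \<gamma> t"
  have \<Sigma>: "0 \<le> ?\<Sigma>" using \<gamma>_range by (intro sum_nonneg) (auto simp: less_imp_le)
  have b1: "0 < 1 - \<beta>\<^sup>2" "1 - \<beta>\<^sup>2 = (1 - \<beta>) * (1 + \<beta>)"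
    using \<beta>2 by (auto simp: power2_eq_square algebra_simps)
  have per: "\<gamma> t * E t \<le> \<gamma> t * \<beta> ^ (2 * t) * (v / real bt)
      + (\<Sum>k<t. \<gamma> t * \<beta> ^ (2 * (t - k)) * ?\<rho> k) + \<gamma> t * (\<theta> * v / (1 + \<beta>))" if t: "t \<le> m" for t
  proof -
    have "(\<Sum>j<t. \<beta> ^ (2 * j)) * ?\<nu> \<le> 1 / (1 - \<beta>\<^sup>2) * ?\<nu>"
      using geometric_le v by (intro mult_right_mono) auto
    also have "\<dots> = \<theta> * v / (1 + \<beta>)"
    proof -
      have "1 / (1 - \<beta>\<^sup>2) * ?\<nu> = (1 - \<beta>) * v / (real bh * (1 + \<beta>))"
        unfolding b1(2) using \<beta> by (simp add: power2_eq_square)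
      also have "\<dots> = \<theta> * v / (1 + \<beta>)" unfolding w(1) using w(4) by simp
      finally show ?thesis .
    qed
    finally have "E t \<le> \<beta> ^ (2 * t) * (v / real bt) + (\<Sum>k<t. \<beta> ^ (2 * (t - k)) * ?\<rho> k) + \<theta> * v / (1 + \<beta>)"
      using unroll[OF t] by linarith
    then have "\<gamma> t * E t \<le> \<gamma> t * (\<beta> ^ (2 * t) * (v / real bt) + (\<Sum>k<t. \<beta> ^ (2 * (t - k)) * ?\<rho> k) + \<theta> * v / (1 + \<beta>))"
      using \<gamma>_range[OF t] by (intro mult_left_mono) auto
    also have "\<dots> = \<gamma> t * \<beta> ^ (2 * t) * (v / real bt)
      + (\<Sum>k<t. \<gamma> t * \<beta> ^ (2 * (t - k)) * ?\<rho> k) + \<gamma> t * (\<theta> * v / (1 + \<beta>))"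
      by (simp only: distrib_left sum_distrib_left mult.assoc)
    finally show ?thesis .
  qed
  have "(\<Sum>t\<le>m. \<gamma> t * E t) \<le> (\<Sum>t\<le>m. \<gamma> t * \<beta> ^ (2 * t) * (v / real bt)
      + (\<Sum>k<t. \<gamma> t * \<beta> ^ (2 * (t - k)) * ?\<rho> k) + \<gamma> t * (\<theta> * v / (1 + \<beta>)))"
    using per by (intro sum_mono) auto
  also have "\<dots> = (\<Sum>t\<le>m. \<gamma> t * \<beta> ^ (2 * t)) * (v / real bt)
      + (\<Sum>t\<le>m. \<Sum>k<t. \<gamma> t * \<beta> ^ (2 * (t - k)) * ?\<rho> k) + ?\<Sigma> * (\<theta> * v / (1 + \<beta>))"
    by (simp only: sum.distrib sum_distrib_right)
  \<comment> \<open>Interchanging the sums groups the terms by the step k that caused the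
    displacement. Including k = m costs nothing since \<open>A m\<close> is an empty sum.\<close>
  also have "(\<Sum>t\<le>m. \<Sum>k<t. \<gamma> t * \<beta> ^ (2 * (t - k)) * ?\<rho> k) = (\<Sum>k\<le>m. A k * ?\<rho> k)"
  proof -
    have "(\<Sum>t\<le>m. \<Sum>k<t. \<gamma> t * \<beta> ^ (2 * (t - k)) * ?\<rho> k)
        = (\<Sum>k<m. \<Sum>t=Suc k..m. \<gamma> t * \<beta> ^ (2 * (t - k)) * ?\<rho> k)"
      by (rule sum.nested_swap')
    also have "\<dots> = (\<Sum>k<m. A k * ?\<rho> k)"
      unfolding A_def sum_distrib_right by (intro sum.cong) (simp_all add: mult.commute)
    also have "\<dots> = (\<Sum>k\<le>m. A k * ?\<rho> k)"
      by (simp add: A_def lessThan_Suc_atMost[symmetric])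
    finally show ?thesis .
  qed
  \<comment> \<open>Initial noise is largest at early steps, where the weights should be small.
    Almost monotonicity allows a comparison with the uniform average, at the cost of 1 + 2
    \<beta>.\<close>
  also have "(\<Sum>t\<le>m. \<gamma> t * \<beta> ^ (2 * t)) * (v / real bt) \<le> ?\<Sigma> * ((1 + 2 * \<beta>) * \<theta> * v / (1 + \<beta>))"
  proof -
    have "(real m + 1) * (\<Sum>t\<le>m. \<gamma> t * \<beta> ^ (2 * t)) \<le> (1 + 2 * \<beta>) * ?\<Sigma> * (\<Sum>t\<le>m. \<beta> ^ (2 * t))"
      using \<beta> \<gamma>_range \<gamma>_almost_mono
      by (intro sum_mult_le_of_almost_monotone) (auto simp: less_imp_le intro!: power_decreasing)
    also have "\<dots> \<le> (1 + 2 * \<beta>) * ?\<Sigma> * (1 / (1 - \<beta>\<^sup>2))"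
      using geometric_le[of "Suc m"] \<beta> \<Sigma> by (intro mult_left_mono) (auto simp: lessThan_Suc_atMost)
    finally have *: "(\<Sum>t\<le>m. \<gamma> t * \<beta> ^ (2 * t)) \<le> (1 + 2 * \<beta>) * ?\<Sigma> / (1 - \<beta>\<^sup>2) / (real m + 1)"
      by (subst pos_le_divide_eq) (simp_all add: mult.commute)
    have "(\<Sum>t\<le>m. \<gamma> t * \<beta> ^ (2 * t)) * (v / real bt)
        \<le> (1 + 2 * \<beta>) * ?\<Sigma> / (1 - \<beta>\<^sup>2) / (real m + 1) * (v / real bt)"
      using * v by (intro mult_right_mono) auto
    also have "\<dots> = ?\<Sigma> * ((1 + 2 * \<beta>) * v / (1 + \<beta>)) * (1 / (real bt * (real m + 1) * (1 - \<beta>)))"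
      unfolding b1(2) by (simp add: mult.commute mult.left_commute)
    also have "1 / (real bt * (real m + 1) * (1 - \<beta>)) = \<theta>"
      using w(2) nonzero_eq_divide_eq[of "real bt * (real m + 1) * (1 - \<beta>)" \<theta> 1] w(3)
      by (metis mult.commute mult_zero_left zero_neq_one)
    finally show ?thesis by (simp add: mult.commute mult.left_commute)
  qed
  finally have "(\<Sum>t\<le>m. \<gamma> t * E t) \<le> (\<Sum>k\<le>m. A k * ?\<rho> k)
      + (?\<Sigma> * ((1 + 2 * \<beta>) * \<theta> * v / (1 + \<beta>)) + ?\<Sigma> * (\<theta> * v / (1 + \<beta>)))" by simp
  \<comment> \<open>(1 + 2 \<beta>) + 1 = 2 (1 + \<beta>), so the denominator cancels.\<close>
  also have "?\<Sigma> * ((1 + 2 * \<beta>) * \<theta> * v / (1 + \<beta>)) + ?\<Sigma> * (\<theta> * v / (1 + \<beta>)) = 2 * \<theta> * v * ?\<Sigma>"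
  proof -
    have "?\<Sigma> * ((1 + 2 * \<beta>) * \<theta> * v / (1 + \<beta>)) + ?\<Sigma> * (\<theta> * v / (1 + \<beta>))
      = ((2 * \<theta> * v * ?\<Sigma>) * (1 + \<beta>)) / (1 + \<beta>)"
      unfolding times_divide_eq_right add_divide_distrib[symmetric]
      by (rule arg_cong[where f = "\<lambda>x. x / (1 + \<beta>)"]) (simp add: algebra_simps)
    then show ?thesis using \<beta> by simp
  qed
  finally have "?c * (\<Sum>t\<le>m. \<gamma> t * E t) \<le> ?c * ((\<Sum>k\<le>m. A k * ?\<rho> k) + 2 * \<theta> * v * ?\<Sigma>)"
    using c by (intro mult_left_mono)
  also have "\<dots> = (\<Sum>k\<le>m. ?c * (A k * ?\<rho> k)) + ?c * (2 * \<theta> * v * ?\<Sigma>)"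
    by (simp only: distrib_left sum_distrib_left)
  also have "(\<Sum>k\<le>m. ?c * (A k * ?\<rho> k)) = (\<Sum>t\<le>m. \<gamma> t / 2 * (\<delta> - L * \<gamma> t) * D t)"
  proof (rule sum.cong)
    fix t assume "t \<in> {..m}"
    then have t: "t \<le> m" by simp
    have "\<gamma> t / 2 * (\<delta> - L * \<gamma> t) * D t = \<gamma> t / 2 * (L * \<gamma> t * (1 + L\<^sup>2 * \<eta>\<^sup>2) / real b * A t) * D t"
      by (subst \<gamma>_balance[OF t, symmetric]) simp
    also have "\<dots> = ?c * (A t * ?\<rho> t)" using L by (simp add: power2_eq_square)
    finally show "?c * (A t * ?\<rho> t) = \<gamma> t / 2 * (\<delta> - L * \<gamma> t) * D t" ..
  qed simp
  also have "?c * (2 * \<theta> * v * ?\<Sigma>) \<le> 1 / L * (2 * \<theta> * v * ?\<Sigma>)"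
    using c w(3) v \<Sigma> by (intro mult_right_mono) auto
  finally show ?thesis by (simp add: mult.commute mult.left_commute)
qed

end

section \<open>One proximal step\<close>

text \<open>The moment bounds use nonnegative integrals, so that they entail finiteness. The domain
  of \<psi> stands for that of F, since f is finite everywhere.\<close>

locale composite_problem = prox_friendly \<psi> for \<psi> :: "'a::euclidean_space \<Rightarrow> ereal" +
  fixes P :: "'z measure" and fs :: "'z \<Rightarrow> 'a \<Rightarrow> real" and f :: "'a \<Rightarrow> real" and L \<sigma> :: real
  assumes P: "prob_space P"
    and grad_cont: "\<And>z. z \<in> space P \<Longrightarrow> continuous_on UNIV (grad (fs z))"
    and f_diff: "\<And>x. f differentiable (at x)"
    and grad_int: "\<And>x. integrable P (\<lambda>z. grad (fs z) x)"
    and unbiased: "\<And>x. (LINT z|P. grad (fs z) x) = grad f x"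
    and L_pos: "0 < L"
    and mean_square_lipschitz: "\<And>x y. x \<in> edom \<psi> \<Longrightarrow> y \<in> edom \<psi> \<Longrightarrow>
        (\<integral>\<^sup>+z. ennreal ((norm (grad (fs z) x - grad (fs z) y))\<^sup>2) \<partial>P)
          \<le> ennreal (L\<^sup>2 * (norm (x - y))\<^sup>2)"
    and bounded_variance: "\<And>x. x \<in> edom \<psi> \<Longrightarrow>
        (\<integral>\<^sup>+z. ennreal ((norm (grad (fs z) x - grad f x))\<^sup>2) \<partial>P) \<le> ennreal (\<sigma>\<^sup>2)"
begin

lemma grad_measurable [measurable (raw)]:
  assumes "\<zeta> \<in> N \<rightarrow>\<^sub>M P" "X \<in> borel_measurable N"
  shows "(\<lambda>w. grad (fs (\<zeta> w)) (X w)) \<in> borel_measurable N"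
proof -
  have "(\<lambda>(z, x). grad (fs z) x) \<in> borel_measurable (P \<Otimes>\<^sub>M borel)"
    using grad_int grad_cont by (intro borel_measurable_pair_continuous_snd) auto
  from measurable_compose[OF measurable_Pair[OF assms] this] show ?thesis by simp
qed

lemma grad_f_measurable [measurable (raw)]: "grad f \<in> borel_measurable borel"
proof -
  interpret sigma_finite_measure P using P by (rule prob_space_imp_sigma_finite)
  have "(\<lambda>x. LINT z|P. grad (fs z) x) \<in> borel_measurable borel"
    by (rule borel_measurable_lebesgue_integral) measurable
  then show ?thesis by (simp add: unbiased)
qed

lemma grad_f_lipschitz:
  assumes "x \<in> edom \<psi>" "y \<in> edom \<psi>"
  shows "norm (grad f x - grad f y) \<le> L * norm (x - y)"
proof -
  interpret prob_space P by (rule P)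
  have "(norm (LINT z|P. grad (fs z) x - grad (fs z) y))\<^sup>2 \<le> L\<^sup>2 * (norm (x - y))\<^sup>2"
    using mean_square_lipschitz[OF assms] grad_int
    by (intro mean_square_and_variance_le_second_moment(1)) auto
  then have "(norm (grad f x - grad f y))\<^sup>2 \<le> (L * norm (x - y))\<^sup>2"
    using grad_int by (simp add: unbiased power_mult_distrib)
  then show ?thesis using L_pos by (simp add: power2_le_iff_abs_le)
qed

lemma difference_variance:
  assumes "x \<in> edom \<psi>" "y \<in> edom \<psi>"
  shows "(\<integral>\<^sup>+z. ennreal ((norm (grad (fs z) x - grad (fs z) y - (grad f x - grad f y)))\<^sup>2) \<partial>P)
    \<le> ennreal (L\<^sup>2 * (norm (x - y))\<^sup>2)"
proof -
  interpret prob_space P by (rule P)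
  have "(\<integral>\<^sup>+z. ennreal ((norm (grad (fs z) x - grad (fs z) y
      - (LINT z|P. grad (fs z) x - grad (fs z) y)))\<^sup>2) \<partial>P) \<le> ennreal (L\<^sup>2 * (norm (x - y))\<^sup>2)"
    using mean_square_lipschitz[OF assms] grad_int
    by (intro mean_square_and_variance_le_second_moment(2)) auto
  then show ?thesis using grad_int by (simp add: unbiased)
qed

lemma convex_edom: "Convex.convex (edom \<psi>)"
  unfolding convex_alt using convex_comb(1) by auto

abbreviation \<Phi> :: "'a \<Rightarrow> real" where "\<Phi> x \<equiv> f x + p x"

text \<open>A deterministic estimate for an arbitrary direction \<open>v\<close>. In the coefficient
  of the squared displacement, 2 / \<eta> comes from the variational inequality, one L from Young's
  inequality, one L from replacing the displacement by the gradient mapping, and L \<gamma> from the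
  quadratic upper bound. The term L^2 \<eta>^2 in front of the error stems from nonexpansiveness of
  the proximal map.\<close>

lemma prox_grad_step:
  fixes x v :: 'a
  assumes \<eta>: "0 < \<eta>" and \<gamma>: "0 \<le> \<gamma>" "\<gamma> \<le> 1" and x: "x \<in> edom \<psi>"
  defines "xh \<equiv> prox \<eta> \<psi> (x - \<eta> *\<^sub>R v)"
  shows "(1 - \<gamma>) *\<^sub>R x + \<gamma> *\<^sub>R xh \<in> edom \<psi>"
    and "\<Phi> ((1 - \<gamma>) *\<^sub>R x + \<gamma> *\<^sub>R xh) + L * \<eta>\<^sup>2 / 4 * \<gamma> * (norm (grad_map f \<psi> \<eta> x))\<^sup>2
      \<le> \<Phi> x + (1 + L\<^sup>2 * \<eta>\<^sup>2) / (2 * L) * \<gamma> * (norm (v - grad f x))\<^sup>2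
        - \<gamma> / 2 * (2 / \<eta> - 2 * L - L * \<gamma>) * (norm (xh - x))\<^sup>2"
proof -
  define d e where "d = xh - x" and "e = v - grad f x"
  have xh: "xh \<in> edom \<psi>" unfolding xh_def by (rule prox_in_edom[OF \<eta>])
  show x': "(1 - \<gamma>) *\<^sub>R x + \<gamma> *\<^sub>R xh \<in> edom \<psi>"
    by (rule convex_comb(1)[OF x xh \<gamma>])
  have eq: "(1 - \<gamma>) *\<^sub>R x + \<gamma> *\<^sub>R xh - x = \<gamma> *\<^sub>R d" by (simp add: d_def algebra_simps)
  have 1: "f ((1 - \<gamma>) *\<^sub>R x + \<gamma> *\<^sub>R xh) \<le> f x + \<gamma> * inner (grad f x) d + L / 2 * (\<gamma>\<^sup>2 * (norm d)\<^sup>2)"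
    using lipschitz_gradient_descent_lemma[OF f_diff convex_edom x x' grad_f_lipschitz]
    unfolding eq by (simp add: power_mult_distrib)
  have "\<eta> * p xh + inner (x - \<eta> *\<^sub>R v - xh) (x - xh) \<le> \<eta> * p x"
    unfolding xh_def by (rule prox_variational_inequality[OF \<eta> x])
  moreover have "inner (x - \<eta> *\<^sub>R v - xh) (x - xh) = (norm d)\<^sup>2 + \<eta> * inner v d"
    unfolding power2_norm_eq_inner d_def by (simp add: algebra_simps inner_commute)
  ultimately have "\<eta> * (p xh - p x) \<le> - ((norm d)\<^sup>2 + \<eta> * inner v d)" by (simp add: algebra_simps)
  then have "p xh - p x \<le> - ((norm d)\<^sup>2 / \<eta> + inner v d)" using \<eta> by (simp add: field_simps)
  then have "\<gamma> * (p xh - p x) \<le> \<gamma> * - ((norm d)\<^sup>2 / \<eta> + inner v d)"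
    using \<gamma> by (intro mult_left_mono)
  then have 2: "p ((1 - \<gamma>) *\<^sub>R x + \<gamma> *\<^sub>R xh) \<le> p x - \<gamma> * ((norm d)\<^sup>2 / \<eta>) - \<gamma> * inner v d"
    using convex_comb(2)[OF x xh \<gamma>] by (simp add: algebra_simps)
  \<comment> \<open>Young's inequality with weight \<open>L\<close>\<close>
  have "0 \<le> (norm (e + L *\<^sub>R d))\<^sup>2 / (2 * L)" using L_pos by simp
  also have "\<dots> = (norm e)\<^sup>2 / (2 * L) + inner e d + L / 2 * (norm d)\<^sup>2"
    unfolding power2_norm_eq_inner using L_pos
    by (simp add: inner_add_left inner_add_right inner_commute field_simps)
  finally have "\<gamma> * - inner e d \<le> \<gamma> * ((norm e)\<^sup>2 / (2 * L) + L / 2 * (norm d)\<^sup>2)"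
    using \<gamma> by (intro mult_left_mono) auto
  then have 3: "\<gamma> * inner (grad f x) d - \<gamma> * inner v d
      \<le> \<gamma> * (norm e)\<^sup>2 / (2 * L) + \<gamma> * L / 2 * (norm d)\<^sup>2"
    by (simp add: e_def inner_diff_left algebra_simps)
  have "\<eta>\<^sup>2 * (norm (grad_map f \<psi> \<eta> x))\<^sup>2 = (norm (x - prox \<eta> \<psi> (x - \<eta> *\<^sub>R grad f x)))\<^sup>2"
    using \<eta> by (simp add: grad_map_def power_mult_distrib power_divide)
  also have "x - prox \<eta> \<psi> (x - \<eta> *\<^sub>R grad f x) = - d + (xh - prox \<eta> \<psi> (x - \<eta> *\<^sub>R grad f x))"
    by (simp add: d_def)
  also have "(norm \<dots>)\<^sup>2 \<le> 2 * (norm (- d))\<^sup>2 + 2 * (norm (xh - prox \<eta> \<psi> (x - \<eta> *\<^sub>R grad f x)))\<^sup>2"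
    by (rule norm_add_power2_le)
  also have "norm (xh - prox \<eta> \<psi> (x - \<eta> *\<^sub>R grad f x)) \<le> norm (\<eta> *\<^sub>R e)"
    using prox_nonexpansive[OF \<eta>, of "x - \<eta> *\<^sub>R v" "x - \<eta> *\<^sub>R grad f x"]
    by (simp add: xh_def e_def norm_minus_commute algebra_simps)
  then have "2 * (norm (- d))\<^sup>2 + 2 * (norm (xh - prox \<eta> \<psi> (x - \<eta> *\<^sub>R grad f x)))\<^sup>2
      \<le> 2 * (norm d)\<^sup>2 + 2 * (norm (\<eta> *\<^sub>R e))\<^sup>2" by (simp add: power_mono)
  finally have "L / 4 * \<gamma> * (\<eta>\<^sup>2 * (norm (grad_map f \<psi> \<eta> x))\<^sup>2)
      \<le> L / 4 * \<gamma> * (2 * (norm d)\<^sup>2 + 2 * (norm (\<eta> *\<^sub>R e))\<^sup>2)"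
    using \<gamma> L_pos by (intro mult_left_mono) auto
  then have 4: "L * \<eta>\<^sup>2 / 4 * \<gamma> * (norm (grad_map f \<psi> \<eta> x))\<^sup>2
      \<le> L / 2 * \<gamma> * (norm d)\<^sup>2 + L / 2 * \<gamma> * \<eta>\<^sup>2 * (norm e)\<^sup>2"
    by (simp add: power_mult_distrib algebra_simps)
  have "\<Phi> ((1 - \<gamma>) *\<^sub>R x + \<gamma> *\<^sub>R xh) + L * \<eta>\<^sup>2 / 4 * \<gamma> * (norm (grad_map f \<psi> \<eta> x))\<^sup>2
      \<le> \<Phi> x + (\<gamma> * (norm e)\<^sup>2 / (2 * L) + L / 2 * \<gamma> * \<eta>\<^sup>2 * (norm e)\<^sup>2)
        - (\<gamma> * ((norm d)\<^sup>2 / \<eta>) - \<gamma> * L / 2 * (norm d)\<^sup>2 - L / 2 * \<gamma> * (norm d)\<^sup>2 - L / 2 * (\<gamma>\<^sup>2 * (norm d)\<^sup>2))"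
    using 1 2 3 4 by linarith
  also have "\<gamma> * (norm e)\<^sup>2 / (2 * L) + L / 2 * \<gamma> * \<eta>\<^sup>2 * (norm e)\<^sup>2
      = (1 + L\<^sup>2 * \<eta>\<^sup>2) / (2 * L) * \<gamma> * (norm e)\<^sup>2"
    using L_pos by (simp add: field_simps power2_eq_square)
  also have "\<gamma> * ((norm d)\<^sup>2 / \<eta>) - \<gamma> * L / 2 * (norm d)\<^sup>2 - L / 2 * \<gamma> * (norm d)\<^sup>2 - L / 2 * (\<gamma>\<^sup>2 * (norm d)\<^sup>2)
      = \<gamma> / 2 * (2 / \<eta> - 2 * L - L * \<gamma>) * (norm d)\<^sup>2"
    using \<eta> by (simp add: field_simps power2_eq_square)
  finally show "\<Phi> ((1 - \<gamma>) *\<^sub>R x + \<gamma> *\<^sub>R xh) + L * \<eta>\<^sup>2 / 4 * \<gamma> * (norm (grad_map f \<psi> \<eta> x))\<^sup>2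
      \<le> \<Phi> x + (1 + L\<^sup>2 * \<eta>\<^sup>2) / (2 * L) * \<gamma> * (norm (v - grad f x))\<^sup>2
        - \<gamma> / 2 * (2 / \<eta> - 2 * L - L * \<gamma>) * (norm (xh - x))\<^sup>2"
    by (simp add: d_def e_def)
qed

definition residual :: "real \<Rightarrow> 'a \<Rightarrow> 'a" where
  "residual \<eta> x = prox \<eta> \<psi> (x - \<eta> *\<^sub>R grad f x) - x"

lemma norm_grad_map_power2: "(norm (grad_map f \<psi> \<eta> x))\<^sup>2 = (1 / \<eta>)\<^sup>2 * (norm (residual \<eta> x))\<^sup>2"
  by (simp add: grad_map_def residual_def norm_minus_commute power_mult_distrib power_divide)

lemma residual_measurable [measurable (raw)]:
  assumes "0 < \<eta>" shows "residual \<eta> \<in> borel_measurable borel"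
proof -
  note [measurable] = prox_borel_measurable[OF assms]
  show ?thesis unfolding residual_def by measurable
qed

text \<open>Linear growth away from a reference point of the domain: through it square integrability
  passes from an iterate to its gradient mapping.\<close>

lemma residual_growth:
  assumes \<eta>: "0 < \<eta>" and x: "x \<in> edom \<psi>" and y: "y \<in> edom \<psi>"
  shows "norm (residual \<eta> x) \<le> norm (residual \<eta> y) + (2 + \<eta> * L) * norm (x - y)"
proof -
  let ?u = "x - \<eta> *\<^sub>R grad f x" and ?w = "y - \<eta> *\<^sub>R grad f y"
  have "norm (prox \<eta> \<psi> ?u - prox \<eta> \<psi> ?w) \<le> norm (?u - ?w)" by (rule prox_nonexpansive[OF \<eta>])
  also have "?u - ?w = (x - y) - \<eta> *\<^sub>R (grad f x - grad f y)" by (simp add: algebra_simps)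
  also have "norm \<dots> \<le> norm (x - y) + \<eta> * norm (grad f x - grad f y)"
    using norm_triangle_ineq4[of "x - y" "\<eta> *\<^sub>R (grad f x - grad f y)"] \<eta> by simp
  also have "\<dots> \<le> norm (x - y) + \<eta> * (L * norm (x - y))"
    using grad_f_lipschitz[OF x y] \<eta> by (intro add_left_mono mult_left_mono) auto
  finally have 1: "norm (prox \<eta> \<psi> ?u - prox \<eta> \<psi> ?w) \<le> norm (x - y) + \<eta> * (L * norm (x - y))" .
  have "residual \<eta> x = residual \<eta> y + ((prox \<eta> \<psi> ?u - prox \<eta> \<psi> ?w) - (x - y))"
    by (simp add: residual_def)
  then have "norm (residual \<eta> x) \<le> norm (residual \<eta> y) + norm ((prox \<eta> \<psi> ?u - prox \<eta> \<psi> ?w) - (x - y))"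
    by (metis norm_triangle_ineq)
  also have "norm ((prox \<eta> \<psi> ?u - prox \<eta> \<psi> ?w) - (x - y)) \<le> norm (prox \<eta> \<psi> ?u - prox \<eta> \<psi> ?w) + norm (x - y)"
    by (rule norm_triangle_ineq4)
  finally show ?thesis using 1 by (simp add: algebra_simps)
qed

end

lemma integrable_norm_add_power2:
  fixes g h :: "'w \<Rightarrow> 'a::euclidean_space"
  assumes [measurable]: "g \<in> borel_measurable N" "h \<in> borel_measurable N"
    and int: "integrable N (\<lambda>w. (norm (g w))\<^sup>2)" "integrable N (\<lambda>w. (norm (h w))\<^sup>2)"
  shows "integrable N (\<lambda>w. (norm (g w + h w))\<^sup>2)"
proof (rule Bochner_Integration.integrable_bound)
  show "integrable N (\<lambda>w. 2 * (norm (g w))\<^sup>2 + 2 * (norm (h w))\<^sup>2)" using int by simp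
qed (use norm_add_power2_le in auto)

lemma integrable_norm_power2_dominated:
  fixes g :: "'w \<Rightarrow> 'a::euclidean_space"
  assumes [measurable]: "g \<in> borel_measurable N" and h: "integrable N h"
    and le: "\<And>w. w \<in> space N \<Longrightarrow> (norm (g w))\<^sup>2 \<le> h w"
  shows "integrable N (\<lambda>w. (norm (g w))\<^sup>2)"
proof (rule Bochner_Integration.integrable_bound[OF h])
  show "AE w in N. norm ((norm (g w))\<^sup>2) \<le> norm (h w)"
    using le by (intro AE_I2) (smt (verit) real_norm_def zero_le_power2)
qed simp

section \<open>Variance of the hybrid estimator\<close>

text \<open>The raw material for independence: only these labels are read, so a sample with any
  other label may be changed freely.\<close>

lemma hsgd_cong:
  assumes "\<And>i. i < bt \<Longrightarrow> Z (Init s i) = Z' (Init s i)"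
    and "\<And>u i. 1 \<le> u \<Longrightarrow> u \<le> t \<Longrightarrow> i < b \<Longrightarrow> Z (Diff s u i) = Z' (Diff s u i)"
    and "\<And>u i. 1 \<le> u \<Longrightarrow> u \<le> t \<Longrightarrow> i < bh \<Longrightarrow> Z (Fresh s u i) = Z' (Fresh s u i)"
  shows "hsgd_x fs \<psi> \<eta> \<beta> \<gamma> bt b bh Z s x0 t = hsgd_x fs \<psi> \<eta> \<beta> \<gamma> bt b bh Z' s x0 t \<and>
    hsgd_v fs \<psi> \<eta> \<beta> \<gamma> bt b bh Z s x0 t = hsgd_v fs \<psi> \<eta> \<beta> \<gamma> bt b bh Z' s x0 t"
  using assms
proof (induction t)
  case (Suc t)
  have IH: "hsgd_x fs \<psi> \<eta> \<beta> \<gamma> bt b bh Z s x0 t = hsgd_x fs \<psi> \<eta> \<beta> \<gamma> bt b bh Z' s x0 t"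
    "hsgd_v fs \<psi> \<eta> \<beta> \<gamma> bt b bh Z s x0 t = hsgd_v fs \<psi> \<eta> \<beta> \<gamma> bt b bh Z' s x0 t"
    using Suc by auto
  show ?case using Suc.prems by (simp add: IH del: sum_subtractf)
qed simp

text \<open>\<theta> equals 1 / sqrt (bh bt (m + 1)); its two equations keep the square roots of
  \<beta> out of the variance argument. \<open>Fst\<close> may be any real lower bound of the
  objective.\<close>

locale hsgd_rs = composite_problem \<psi> P fs f L \<sigma> + hsgd_weights L \<eta> \<delta> \<beta> \<gamma> m b
  for \<psi> :: "'a::euclidean_space \<Rightarrow> ereal" and P :: "'z measure" and fs f L \<sigma> \<eta> \<delta> \<beta> \<gamma> m b +
  fixes S bh bt :: nat and xb0 :: 'a and \<theta> Fst :: real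
  assumes bh: "1 \<le> bh" and bt: "1 \<le> bt" and xb0: "xb0 \<in> edom \<psi>"
    and \<theta>: "1 - \<beta> = real bh * \<theta>" "real bt * (real m + 1) * (1 - \<beta>) * \<theta> = 1" "0 < \<theta>"
    and Fst: "\<And>x. x \<in> edom \<psi> \<Longrightarrow> Fst \<le> f x + real_of_ereal (\<psi> x)"
begin

abbreviation "lbl \<equiv> sample_labels S m bt b bh"

abbreviation "Q \<equiv> PiM lbl (\<lambda>_. P)"

abbreviation xbar :: "nat \<Rightarrow> (sample_label \<Rightarrow> 'z) \<Rightarrow> 'a" where
  "xbar s Z \<equiv> rs_xbar fs \<psi> \<eta> \<beta> \<gamma> m bt b bh Z xb0 s"

abbreviation X :: "nat \<Rightarrow> nat \<Rightarrow> (sample_label \<Rightarrow> 'z) \<Rightarrow> 'a" where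
  "X s t Z \<equiv> rs_iterate fs \<psi> \<eta> \<beta> \<gamma> m bt b bh Z xb0 s t"

definition V :: "nat \<Rightarrow> nat \<Rightarrow> (sample_label \<Rightarrow> 'z) \<Rightarrow> 'a" where
  "V s t Z = hsgd_v fs \<psi> \<eta> \<beta> \<gamma> bt b bh Z s (xbar (s - 1) Z) t"

definition err :: "nat \<Rightarrow> nat \<Rightarrow> (sample_label \<Rightarrow> 'z) \<Rightarrow> 'a" where
  "err s t Z = V s t Z - grad f (X s t Z)"

definition dir :: "nat \<Rightarrow> nat \<Rightarrow> (sample_label \<Rightarrow> 'z) \<Rightarrow> 'a" where
  "dir s t Z = prox \<eta> \<psi> (X s t Z - \<eta> *\<^sub>R V s t Z) - X s t Z"

lemma X_Suc: "X s (Suc t) Z = (1 - \<gamma> t) *\<^sub>R X s t Z + \<gamma> t *\<^sub>R prox \<eta> \<psi> (X s t Z - \<eta> *\<^sub>R V s t Z)"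
  by (simp add: rs_iterate_def V_def)

lemma X_Suc_dir: "X s (Suc t) Z = X s t Z + \<gamma> t *\<^sub>R dir s t Z"
  by (simp add: X_Suc dir_def algebra_simps)

lemma X_0: "X s 0 Z = xbar (s - 1) Z"
  by (simp add: rs_iterate_def)

lemma xbar_Suc: "xbar (Suc s) Z = X (Suc s) (Suc m) Z"
  by (simp add: rs_iterate_def)

lemma V_Suc:
  "V s (Suc t) Z = \<beta> *\<^sub>R V s t Z
      + (\<beta> / real b) *\<^sub>R (\<Sum>i<b. grad (fs (Z (Diff s (Suc t) i))) (X s (Suc t) Z)
          - grad (fs (Z (Diff s (Suc t) i))) (X s t Z))
    + ((1 - \<beta>) / real bh) *\<^sub>R (\<Sum>i<bh. grad (fs (Z (Fresh s (Suc t) i))) (X s (Suc t) Z))"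
  by (simp add: V_def rs_iterate_def del: hsgd_x.simps)

lemma X_in_edom_aux: "xbar (s - 1) Z \<in> edom \<psi> \<Longrightarrow> t \<le> Suc m \<Longrightarrow> X s t Z \<in> edom \<psi>"
proof (induction t)
  case (Suc t)
  then have "0 \<le> \<gamma> t" "\<gamma> t \<le> 1" using \<gamma>_range[of t] by auto
  then show ?case
    using Suc prox_grad_step(1)[OF \<eta>(1)] by (simp add: X_Suc)
qed (simp add: X_0)

lemma xbar_in_edom: "xbar s Z \<in> edom \<psi>"
proof (induction s)
  case (Suc s)
  then show ?case unfolding xbar_Suc by (intro X_in_edom_aux) auto
qed (simp add: xb0)

lemma X_in_edom: "t \<le> Suc m \<Longrightarrow> X s t Z \<in> edom \<psi>"
  by (rule X_in_edom_aux[OF xbar_in_edom])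

text \<open>Plays the role of a filtration: the labels read up to the estimator
  \<open>V s t\<close>. Since \<open>X s (Suc t)\<close> is computed from that estimator, it too
  depends on \<open>drawn s t\<close> only, so the batches of step t + 1 are fresh for both points
  at which they are evaluated.\<close>

definition drawn :: "nat \<Rightarrow> nat \<Rightarrow> sample_label set" where
  "drawn s t = {l \<in> lbl. case l of Init s' _ \<Rightarrow> s' \<le> s
     | Diff s' t' _ \<Rightarrow> s' < s \<or> s' = s \<and> t' \<le> t | Fresh s' t' _ \<Rightarrow> s' < s \<or> s' = s \<and> t' \<le> t}"

lemma stage_cong:
  assumes s: "s \<in> {1..S}" and t: "t \<le> m" and x: "xbar (s - 1) Z = xbar (s - 1) Z'"
    and Z: "\<And>l. l \<in> drawn s t \<Longrightarrow> Z l = Z' l"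
  shows "X s t Z = X s t Z'" "V s t Z = V s t Z'" "X s (Suc t) Z = X s (Suc t) Z'"
proof -
  have "hsgd_x fs \<psi> \<eta> \<beta> \<gamma> bt b bh Z s x0 t = hsgd_x fs \<psi> \<eta> \<beta> \<gamma> bt b bh Z' s x0 t \<and>
    hsgd_v fs \<psi> \<eta> \<beta> \<gamma> bt b bh Z s x0 t = hsgd_v fs \<psi> \<eta> \<beta> \<gamma> bt b bh Z' s x0 t" for x0
    using s t by (intro hsgd_cong Z) (auto simp: drawn_def sample_labels_def)
  then show 1: "X s t Z = X s t Z'" and 2: "V s t Z = V s t Z'"
    unfolding V_def rs_iterate_def x by auto
  show "X s (Suc t) Z = X s (Suc t) Z'" by (simp add: X_Suc 1 2)
qed

lemma xbar_cong:
  assumes "s \<le> S" "\<And>l. l \<in> drawn s m \<Longrightarrow> Z l = Z' l"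
  shows "xbar s Z = xbar s Z'"
  using assms
proof (induction s)
  case (Suc s)
  have "xbar s Z = xbar s Z'"
  proof (rule Suc.IH)
    fix l assume "l \<in> drawn s m"
    then have "l \<in> drawn (Suc s) m" by (auto simp: drawn_def split: sample_label.splits)
    then show "Z l = Z' l" by (rule Suc.prems)
  qed (use Suc.prems in simp)
  then show ?case
    unfolding xbar_Suc using Suc.prems by (intro stage_cong(3)) auto
qed simp

text \<open>\<open>drawn s 0\<close> contains the initial batch of stage s. For that batch to be
  fresh at the starting point, dependence on the earlier stages alone has to be known.\<close>

lemma X_0_cong:
  assumes s: "s \<in> {1..S}" and Z: "\<And>l. l \<in> drawn (s - 1) m \<Longrightarrow> Z l = Z' l"
  shows "X s 0 Z = X s 0 Z'"
  unfolding X_0 using s by (intro xbar_cong Z) auto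

lemma iterate_cong:
  assumes s: "s \<in> {1..S}" and t: "t \<le> m" and Z: "\<And>l. l \<in> drawn s t \<Longrightarrow> Z l = Z' l"
  shows "X s t Z = X s t Z'" "V s t Z = V s t Z'" "X s (Suc t) Z = X s (Suc t) Z'" "err s t Z = err s t Z'"
proof -
  have "xbar (s - 1) Z = xbar (s - 1) Z'"
  proof (rule xbar_cong)
    fix l assume "l \<in> drawn (s - 1) m"
    then have "l \<in> drawn s t" using s by (auto simp: drawn_def split: sample_label.splits)
    then show "Z l = Z' l" by (rule Z)
  qed (use s in auto)
  from stage_cong[OF s t this Z]
  show "X s t Z = X s t Z'" "V s t Z = V s t Z'" "X s (Suc t) Z = X s (Suc t) Z'" "err s t Z = err s t Z'"
    by (auto simp: err_def)
qed

section \<open>Measurability of the run on the product space of all samples\<close>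

lemma finite_lbl: "finite lbl"
proof -
  have "lbl \<subseteq> (\<Union>s\<in>{1..S}. Init s ` {..<bt})
      \<union> (\<Union>s\<in>{1..S}. \<Union>t\<in>{1..m}. Diff s t ` {..<b}) \<union> (\<Union>s\<in>{1..S}. \<Union>t\<in>{1..m}. Fresh s t ` {..<bh})"
    unfolding sample_labels_def by (intro Un_mono) (blast intro: lessThan_iff[THEN iffD2])+
  then show ?thesis by (rule finite_subset) simp
qed

lemma prob_space_Q: "prob_space Q"
  by (intro prob_space_PiM P)

lemma prox_measurable [measurable (raw)]: "g \<in> borel_measurable N \<Longrightarrow> (\<lambda>w. prox \<eta> \<psi> (g w)) \<in> borel_measurable N"
  by (rule measurable_compose[OF _ prox_borel_measurable[OF \<eta>(1)]])

lemma grad_f_comp_measurable [measurable (raw)]: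
  "g \<in> borel_measurable N \<Longrightarrow> (\<lambda>w. grad f (g w)) \<in> borel_measurable N"
  by (rule measurable_compose[OF _ grad_f_measurable])

lemma stage_measurable:
  assumes s: "s \<in> {1..S}" and x: "xbar (s - 1) \<in> borel_measurable Q" and t: "t \<le> m"
  shows "X s t \<in> borel_measurable Q \<and> V s t \<in> borel_measurable Q"
  using t
proof (induction t)
  case 0
  have "(\<lambda>Z. Z (Init s i)) \<in> Q \<rightarrow>\<^sub>M P" if "i < bt" for i
    using s that by (intro measurable_component_singleton) (auto simp: sample_labels_def)
  then have "(\<lambda>Z. (1 / real bt) *\<^sub>R (\<Sum>i<bt. grad (fs (Z (Init s i))) (xbar (s - 1) Z))) \<in> borel_measurable Q"
    using x by (intro borel_measurable_scaleR borel_measurable_sum grad_measurable) auto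
  then show ?case using x by (simp add: V_def rs_iterate_def)
next
  case (Suc t)
  then have IH [measurable]: "X s t \<in> borel_measurable Q" "V s t \<in> borel_measurable Q" by auto
  have X' [measurable]: "X s (Suc t) \<in> borel_measurable Q" unfolding X_Suc by measurable
  have D: "(\<lambda>Z. Z (Diff s (Suc t) i)) \<in> Q \<rightarrow>\<^sub>M P" if "i < b" for i
    using s that Suc.prems by (intro measurable_component_singleton) (auto simp: sample_labels_def)
  have F: "(\<lambda>Z. Z (Fresh s (Suc t) i)) \<in> Q \<rightarrow>\<^sub>M P" if "i < bh" for i
    using s that Suc.prems by (intro measurable_component_singleton) (auto simp: sample_labels_def)
  have "(\<lambda>Z. V s (Suc t) Z) \<in> borel_measurable Q"
    unfolding V_Suc using D F IH X'
    by (intro borel_measurable_add borel_measurable_scaleR borel_measurable_sum borel_measurable_diff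
        grad_measurable) auto
  with X' show ?case by simp
qed

lemma xbar_measurable: "s \<le> S \<Longrightarrow> xbar s \<in> borel_measurable Q"
proof (induction s)
  case (Suc s)
  have [measurable]: "X (Suc s) m \<in> borel_measurable Q" "V (Suc s) m \<in> borel_measurable Q"
    using stage_measurable[of "Suc s" m] Suc by auto
  show ?case unfolding xbar_Suc X_Suc by measurable
qed simp

lemma iterate_measurable:
  assumes "s \<in> {1..S}" "t \<le> m"
  shows "X s t \<in> borel_measurable Q" "V s t \<in> borel_measurable Q" "X s (Suc t) \<in> borel_measurable Q"
    "err s t \<in> borel_measurable Q" "dir s t \<in> borel_measurable Q"
proof -
  have "xbar (s - 1) \<in> borel_measurable Q" using assms by (intro xbar_measurable) auto
  from stage_measurable[OF assms(1) this assms(2)]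
  show [measurable]: "X s t \<in> borel_measurable Q" "V s t \<in> borel_measurable Q" by auto
  show "X s (Suc t) \<in> borel_measurable Q" "err s t \<in> borel_measurable Q" "dir s t \<in> borel_measurable Q"
    unfolding X_Suc err_def dir_def by measurable
qed

text \<open>Variance reduction by averaging: n independent terms with coefficient c / n contribute n
  (c / n)^2 = c^2 / n.\<close>

lemma second_moment_add_noise_batch:
  fixes U :: "(sample_label \<Rightarrow> 'z) \<Rightarrow> 'a" and N :: "(sample_label \<Rightarrow> 'z) \<Rightarrow> 'z \<Rightarrow> 'a"
    and W :: "(sample_label \<Rightarrow> 'z) \<Rightarrow> real"
  assumes l: "\<And>i. i < n \<Longrightarrow> l i \<in> lbl" "inj_on l {..<n}" and n: "1 \<le> n"
    and U: "U \<in> borel_measurable Q" "\<And>Z z i. i < n \<Longrightarrow> U (Z(l i := z)) = U Z"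
    and N: "(\<lambda>(Z, z). N Z z) \<in> borel_measurable (Q \<Otimes>\<^sub>M P)"
      "\<And>Z z i. i < n \<Longrightarrow> N (Z(l i := z)) = N Z"
    and int: "\<And>Z. Z \<in> space Q \<Longrightarrow> integrable P (N Z)"
    and mean: "\<And>Z. Z \<in> space Q \<Longrightarrow> (LINT z|P. N Z z) = 0"
    and W: "\<And>Z. Z \<in> space Q \<Longrightarrow> (\<integral>\<^sup>+z. ennreal ((norm (N Z z))\<^sup>2) \<partial>P) \<le> ennreal (W Z)"
    and Wm: "W \<in> borel_measurable Q"
  shows "(\<integral>\<^sup>+Z. ennreal ((norm (U Z + (c / real n) *\<^sub>R (\<Sum>i<n. N Z (Z (l i)))))\<^sup>2) \<partial>Q)
    \<le> (\<integral>\<^sup>+Z. ennreal ((norm (U Z))\<^sup>2) \<partial>Q) + ennreal (c\<^sup>2 / real n) * (\<integral>\<^sup>+Z. ennreal (W Z) \<partial>Q)"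
proof -
  let ?H = "\<lambda>Z z. (c / real n) *\<^sub>R N Z z" and ?W = "\<lambda>Z. ennreal ((c / real n)\<^sup>2) * ennreal (W Z)"
  have "(\<integral>\<^sup>+Z. ennreal ((norm (U Z + (\<Sum>i<n. ?H Z (Z (l i)))))\<^sup>2) \<partial>Q)
    \<le> (\<integral>\<^sup>+Z. ennreal ((norm (U Z))\<^sup>2) \<partial>Q) + of_nat n * (\<integral>\<^sup>+Z. ?W Z \<partial>Q)"
  proof (rule second_moment_add_fresh_batch[OF P finite_lbl l U])
    show "(\<lambda>(Z, z). ?H Z z) \<in> borel_measurable (Q \<Otimes>\<^sub>M P)"
      using borel_measurable_scaleR[OF borel_measurable_const[of "c / real n"] N(1)]
      by (simp add: case_prod_beta)
    show "?H (Z(l i := z)) = ?H Z" if "i < n" for Z z i using N(2)[OF that] by simp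
    show "integrable P (?H Z)" if "Z \<in> space Q" for Z using int[OF that] by simp
    show "(LINT z|P. ?H Z z) = 0" if "Z \<in> space Q" for Z using mean[OF that] by simp
    show "(\<integral>\<^sup>+z. ennreal ((norm (?H Z z))\<^sup>2) \<partial>P) \<le> ?W Z" if Z: "Z \<in> space Q" for Z
    proof -
      have [measurable]: "N Z \<in> borel_measurable P" using int[OF Z] by auto
      have "(\<integral>\<^sup>+z. ennreal ((norm (?H Z z))\<^sup>2) \<partial>P)
          = (\<integral>\<^sup>+z. ennreal ((c / real n)\<^sup>2) * ennreal ((norm (N Z z))\<^sup>2) \<partial>P)"
        by (simp add: power_mult_distrib power_divide flip: ennreal_mult)
      also have "\<dots> = ennreal ((c / real n)\<^sup>2) * (\<integral>\<^sup>+z. ennreal ((norm (N Z z))\<^sup>2) \<partial>P)"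
        by (rule nn_integral_cmult) measurable
      finally show ?thesis using W[OF Z] by (simp add: mult_left_mono)
    qed
    show "?W \<in> borel_measurable Q" using Wm by measurable
  qed
  also have "(\<integral>\<^sup>+Z. ?W Z \<partial>Q) = ennreal ((c / real n)\<^sup>2) * (\<integral>\<^sup>+Z. ennreal (W Z) \<partial>Q)"
    using Wm by (intro nn_integral_cmult) measurable
  also have "of_nat n * (ennreal ((c / real n)\<^sup>2) * (\<integral>\<^sup>+Z. ennreal (W Z) \<partial>Q))
      = ennreal (real n * (c / real n)\<^sup>2) * (\<integral>\<^sup>+Z. ennreal (W Z) \<partial>Q)"
    by (simp add: ennreal_mult ennreal_of_nat_eq_real_of_nat mult.assoc)
  also have "real n * (c / real n)\<^sup>2 = c\<^sup>2 / real n" using n by (simp add: power2_eq_square)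
  finally show ?thesis by (simp add: scaleR_sum_right)
qed

lemma emeasure_Q: "emeasure Q (space Q) = 1"
  by (rule prob_space.emeasure_space_1[OF prob_space_Q])

lemma err_0:
  assumes s: "s \<in> {1..S}"
  shows "(\<integral>\<^sup>+Z. ennreal ((norm (err s 0 Z))\<^sup>2) \<partial>Q) \<le> ennreal (\<sigma>\<^sup>2 / real bt)"
proof -
  interpret P: prob_space P by (rule P)
  let ?N = "\<lambda>Z z. grad (fs z) (X s 0 Z) - grad f (X s 0 Z)"
  have [measurable]: "X s 0 \<in> borel_measurable Q" using iterate_measurable[OF s, of 0] by simp
  have X0: "X s 0 (Z(Init s i := z)) = X s 0 Z" for Z i z
    using s by (intro X_0_cong) (auto simp: drawn_def)
  \<comment> \<open>The initial estimator carries nothing over, so the past part \<open>U\<close> of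
    the batch estimate is the constant 0.\<close>
  have "(\<integral>\<^sup>+Z. ennreal ((norm (0 + (1 / real bt) *\<^sub>R (\<Sum>i<bt. ?N Z (Z (Init s i)))))\<^sup>2) \<partial>Q)
    \<le> (\<integral>\<^sup>+Z. ennreal ((norm (0::'a))\<^sup>2) \<partial>Q) + ennreal (1\<^sup>2 / real bt) * (\<integral>\<^sup>+Z. ennreal (\<sigma>\<^sup>2) \<partial>Q)"
  proof (rule second_moment_add_noise_batch)
    show "Init s i \<in> lbl" if "i < bt" for i using s that by (auto simp: sample_labels_def)
    show "inj_on (Init s) {..<bt}" by (auto simp: inj_on_def)
    show "(\<lambda>(Z, z). ?N Z z) \<in> borel_measurable (Q \<Otimes>\<^sub>M P)" by measurable
    show "?N (Z(Init s i := z)) = ?N Z" for Z z i unfolding X0 ..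
    show "integrable P (?N Z)" for Z using grad_int by simp
    show "(LINT z|P. ?N Z z) = 0" for Z using grad_int unbiased by (simp add: P.prob_space)
    show "(\<integral>\<^sup>+z. ennreal ((norm (?N Z z))\<^sup>2) \<partial>P) \<le> ennreal (\<sigma>\<^sup>2)" for Z
      by (intro bounded_variance X_in_edom) simp
  qed (use bt in auto)
  moreover have "0 + (1 / real bt) *\<^sub>R (\<Sum>i<bt. ?N Z (Z (Init s i))) = err s 0 Z" for Z
    using bt by (simp add: err_def V_def rs_iterate_def sum_subtractf scaleR_diff_right sum_constant_scaleR)
  ultimately show ?thesis by (simp only:) (simp add: emeasure_Q flip: ennreal_mult)
qed

text \<open>With g, g' the exact gradients at the old and new point, \<beta> (g' - g) + (1 -
  \<beta>) g' - g' = - \<beta> g. What remains is the damped old error and two centered batch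
  averages, bracketed so that the fresh batch can be split off first.\<close>

lemma err_Suc_eq:
  "err s (Suc t) Z = (\<beta> *\<^sub>R err s t Z
      + (\<beta> / real b) *\<^sub>R (\<Sum>i<b. grad (fs (Z (Diff s (Suc t) i))) (X s (Suc t) Z)
          - grad (fs (Z (Diff s (Suc t) i))) (X s t Z) - (grad f (X s (Suc t) Z) - grad f (X s t Z))))
    + ((1 - \<beta>) / real bh) *\<^sub>R (\<Sum>i<bh. grad (fs (Z (Fresh s (Suc t) i))) (X s (Suc t) Z) - grad f (X s (Suc t) Z))"
proof -
  have *: "(c / real n) *\<^sub>R (\<Sum>i<n. g i - a) = (c / real n) *\<^sub>R (\<Sum>i<n. g i) - c *\<^sub>R a"
    if "1 \<le> n" for c n and g :: "nat \<Rightarrow> 'a" and a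
    using that by (simp add: sum_subtractf scaleR_diff_right sum_constant_scaleR)
  show ?thesis unfolding err_def V_Suc *[OF b] *[OF bh] by (simp add: algebra_simps)
qed

lemma err_Suc:
  assumes s: "s \<in> {1..S}" and t: "t < m"
  shows "(\<integral>\<^sup>+Z. ennreal ((norm (err s (Suc t) Z))\<^sup>2) \<partial>Q)
    \<le> ennreal (\<beta>\<^sup>2) * (\<integral>\<^sup>+Z. ennreal ((norm (err s t Z))\<^sup>2) \<partial>Q)
      + ennreal (\<beta>\<^sup>2 * L\<^sup>2 * (\<gamma> t)\<^sup>2 / real b) * (\<integral>\<^sup>+Z. ennreal ((norm (dir s t Z))\<^sup>2) \<partial>Q)
      + ennreal ((1 - \<beta>)\<^sup>2 * \<sigma>\<^sup>2 / real bh)"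
proof -
  interpret P: prob_space P by (rule P)
  note [measurable] = iterate_measurable[OF s less_imp_le[OF t]] iterate_measurable[OF s Suc_leI[OF t]]
  let ?N = "\<lambda>Z z. grad (fs z) (X s (Suc t) Z) - grad f (X s (Suc t) Z)"
  let ?D = "\<lambda>Z z. grad (fs z) (X s (Suc t) Z) - grad (fs z) (X s t Z) - (grad f (X s (Suc t) Z) - grad f (X s t Z))"
  let ?U = "\<lambda>Z. \<beta> *\<^sub>R err s t Z + (\<beta> / real b) *\<^sub>R (\<Sum>i<b. ?D Z (Z (Diff s (Suc t) i)))"
  have inD: "Diff s (Suc t) i \<in> lbl" if "i < b" for i using s t that by (auto simp: sample_labels_def)
  have inF: "Fresh s (Suc t) i \<in> lbl" if "i < bh" for i using s t that by (auto simp: sample_labels_def)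
  have D: "X s t (Z(Diff s (Suc t) i := z)) = X s t Z" "X s (Suc t) (Z(Diff s (Suc t) i := z)) = X s (Suc t) Z"
      "err s t (Z(Diff s (Suc t) i := z)) = err s t Z" for Z i z
  proof -
    have "Diff s (Suc t) i \<notin> drawn s t" by (simp add: drawn_def)
    then have eq: "(Z(Diff s (Suc t) i := z)) l = Z l" if "l \<in> drawn s t" for l using that by auto
    from iterate_cong[OF s less_imp_le[OF t], of "Z(Diff s (Suc t) i := z)" Z, OF eq]
    show "X s t (Z(Diff s (Suc t) i := z)) = X s t Z" "X s (Suc t) (Z(Diff s (Suc t) i := z)) = X s (Suc t) Z"
      "err s t (Z(Diff s (Suc t) i := z)) = err s t Z" by blast+
  qed
  have F: "X s t (Z(Fresh s (Suc t) i := z)) = X s t Z" "X s (Suc t) (Z(Fresh s (Suc t) i := z)) = X s (Suc t) Z"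
      "err s t (Z(Fresh s (Suc t) i := z)) = err s t Z" for Z i z
  proof -
    have "Fresh s (Suc t) i \<notin> drawn s t" by (simp add: drawn_def)
    then have eq: "(Z(Fresh s (Suc t) i := z)) l = Z l" if "l \<in> drawn s t" for l using that by auto
    from iterate_cong[OF s less_imp_le[OF t], of "Z(Fresh s (Suc t) i := z)" Z, OF eq]
    show "X s t (Z(Fresh s (Suc t) i := z)) = X s t Z" "X s (Suc t) (Z(Fresh s (Suc t) i := z)) = X s (Suc t) Z"
      "err s t (Z(Fresh s (Suc t) i := z)) = err s t Z" by blast+
  qed
  have Um: "?U \<in> borel_measurable Q"
  proof -
    have "(\<lambda>Z. Z (Diff s (Suc t) i)) \<in> Q \<rightarrow>\<^sub>M P" if "i < b" for i
      using inD[OF that] by (intro measurable_component_singleton)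
    then show ?thesis
      by (intro borel_measurable_add borel_measurable_scaleR borel_measurable_sum borel_measurable_diff
          grad_measurable) auto
  qed
  \<comment> \<open>The difference batch counts as past for the fresh batch, so the two are
    separated without a cross term; the next step then splits off the difference batch in the same
    way.\<close>
  have "(\<integral>\<^sup>+Z. ennreal ((norm (err s (Suc t) Z))\<^sup>2) \<partial>Q)
    \<le> (\<integral>\<^sup>+Z. ennreal ((norm (?U Z))\<^sup>2) \<partial>Q) + ennreal ((1 - \<beta>)\<^sup>2 / real bh) * (\<integral>\<^sup>+Z. ennreal (\<sigma>\<^sup>2) \<partial>Q)"
    unfolding err_Suc_eq
  proof (rule second_moment_add_noise_batch)
    show "inj_on (Fresh s (Suc t)) {..<bh}" by (auto simp: inj_on_def)
    show "(\<lambda>(Z, z). ?N Z z) \<in> borel_measurable (Q \<Otimes>\<^sub>M P)" by measurable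
    show "?N (Z(Fresh s (Suc t) i := z)) = ?N Z" for Z z i unfolding F ..
    show "?U (Z(Fresh s (Suc t) i := z)) = ?U Z" for Z z i unfolding F by simp
    show "integrable P (?N Z)" for Z using grad_int by simp
    show "(LINT z|P. ?N Z z) = 0" for Z using grad_int unbiased by (simp add: P.prob_space)
    show "(\<integral>\<^sup>+z. ennreal ((norm (?N Z z))\<^sup>2) \<partial>P) \<le> ennreal (\<sigma>\<^sup>2)" for Z
      using t by (intro bounded_variance X_in_edom) simp
  qed (use bh Um inF in auto)
  also have "(\<integral>\<^sup>+Z. ennreal ((norm (?U Z))\<^sup>2) \<partial>Q)
    \<le> (\<integral>\<^sup>+Z. ennreal ((norm (\<beta> *\<^sub>R err s t Z))\<^sup>2) \<partial>Q)
      + ennreal (\<beta>\<^sup>2 / real b) * (\<integral>\<^sup>+Z. ennreal (L\<^sup>2 * (norm (X s (Suc t) Z - X s t Z))\<^sup>2) \<partial>Q)"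
  proof (rule second_moment_add_noise_batch)
    show "inj_on (Diff s (Suc t)) {..<b}" by (auto simp: inj_on_def)
    show "(\<lambda>(Z, z). ?D Z z) \<in> borel_measurable (Q \<Otimes>\<^sub>M P)" by measurable
    show "?D (Z(Diff s (Suc t) i := z)) = ?D Z" for Z z i unfolding D ..
    show "\<beta> *\<^sub>R err s t (Z(Diff s (Suc t) i := z)) = \<beta> *\<^sub>R err s t Z" for Z z i unfolding D ..
    show "integrable P (?D Z)" for Z using grad_int by simp
    show "(LINT z|P. ?D Z z) = 0" for Z using grad_int unbiased by (simp add: P.prob_space)
    show "(\<integral>\<^sup>+z. ennreal ((norm (?D Z z))\<^sup>2) \<partial>P) \<le> ennreal (L\<^sup>2 * (norm (X s (Suc t) Z - X s t Z))\<^sup>2)" for Z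
      using t by (intro difference_variance X_in_edom) auto
  qed (use b inD in auto)
  also have "(\<integral>\<^sup>+Z. ennreal ((norm (\<beta> *\<^sub>R err s t Z))\<^sup>2) \<partial>Q)
      = ennreal (\<beta>\<^sup>2) * (\<integral>\<^sup>+Z. ennreal ((norm (err s t Z))\<^sup>2) \<partial>Q)"
    by (simp add: power_mult_distrib ennreal_mult nn_integral_cmult)
  also have "(\<integral>\<^sup>+Z. ennreal (L\<^sup>2 * (norm (X s (Suc t) Z - X s t Z))\<^sup>2) \<partial>Q)
      = ennreal (L\<^sup>2 * (\<gamma> t)\<^sup>2) * (\<integral>\<^sup>+Z. ennreal ((norm (dir s t Z))\<^sup>2) \<partial>Q)"
    unfolding X_Suc_dir
    by (subst nn_integral_cmult[symmetric]) (simp_all add: power_mult_distrib mult.assoc flip: ennreal_mult)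
  also have "ennreal (\<beta>\<^sup>2 / real b) * (ennreal (L\<^sup>2 * (\<gamma> t)\<^sup>2) * (\<integral>\<^sup>+Z. ennreal ((norm (dir s t Z))\<^sup>2) \<partial>Q))
      = ennreal (\<beta>\<^sup>2 * L\<^sup>2 * (\<gamma> t)\<^sup>2 / real b) * (\<integral>\<^sup>+Z. ennreal ((norm (dir s t Z))\<^sup>2) \<partial>Q)"
    by (simp add: mult.assoc[symmetric] flip: ennreal_mult)
  finally show ?thesis by (simp add: emeasure_Q flip: ennreal_mult)
qed

end

section \<open>Expected descent over all stages\<close>

context hsgd_rs
begin

lemma dir_power2_le:
  "(norm (dir s t Z))\<^sup>2 \<le> 2 * (norm (residual \<eta> (X s t Z)))\<^sup>2 + 2 * \<eta>\<^sup>2 * (norm (err s t Z))\<^sup>2"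
proof -
  let ?u = "X s t Z - \<eta> *\<^sub>R V s t Z" and ?w = "X s t Z - \<eta> *\<^sub>R grad f (X s t Z)"
  have "(norm (dir s t Z))\<^sup>2 = (norm (residual \<eta> (X s t Z) + (prox \<eta> \<psi> ?u - prox \<eta> \<psi> ?w)))\<^sup>2"
    by (simp add: dir_def residual_def)
  also have "\<dots> \<le> 2 * (norm (residual \<eta> (X s t Z)))\<^sup>2 + 2 * (norm (prox \<eta> \<psi> ?u - prox \<eta> \<psi> ?w))\<^sup>2"
    by (rule norm_add_power2_le)
  also have "norm (prox \<eta> \<psi> ?u - prox \<eta> \<psi> ?w) \<le> norm (?u - ?w)"
    by (rule prox_nonexpansive[OF \<eta>(1)])
  then have "(norm (prox \<eta> \<psi> ?u - prox \<eta> \<psi> ?w))\<^sup>2 \<le> (norm (?u - ?w))\<^sup>2" by (rule power_mono) simp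
  also have "?u - ?w = - (\<eta> *\<^sub>R err s t Z)" by (simp add: err_def algebra_simps)
  finally show ?thesis by (simp add: power_mult_distrib)
qed

lemma residual_X_integrable:
  assumes s: "s \<in> {1..S}" and t: "t \<le> m" and x: "integrable Q (\<lambda>Z. (norm (X s t Z - xb0))\<^sup>2)"
  shows "integrable Q (\<lambda>Z. (norm (residual \<eta> (X s t Z)))\<^sup>2)"
proof (rule integrable_norm_power2_dominated)
  interpret prob_space Q by (rule prob_space_Q)
  note [measurable] = iterate_measurable[OF s t] residual_measurable[OF \<eta>(1)]
  show "(\<lambda>Z. residual \<eta> (X s t Z)) \<in> borel_measurable Q" by measurable
  show "integrable Q (\<lambda>Z. 2 * (norm (residual \<eta> xb0))\<^sup>2 + 2 * ((2 + \<eta> * L)\<^sup>2 * (norm (X s t Z - xb0))\<^sup>2))"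
    using x by simp
  show "(norm (residual \<eta> (X s t Z)))\<^sup>2
      \<le> 2 * (norm (residual \<eta> xb0))\<^sup>2 + 2 * ((2 + \<eta> * L)\<^sup>2 * (norm (X s t Z - xb0))\<^sup>2)" for Z
  proof -
    have "norm (residual \<eta> (X s t Z)) \<le> norm (residual \<eta> xb0) + (2 + \<eta> * L) * norm (X s t Z - xb0)"
      using t by (intro residual_growth[OF \<eta>(1) X_in_edom xb0]) simp
    then have "(norm (residual \<eta> (X s t Z)))\<^sup>2 \<le> (norm (norm (residual \<eta> xb0) + (2 + \<eta> * L) * norm (X s t Z - xb0)))\<^sup>2"
      by (intro power_mono) auto
    also have "\<dots> \<le> 2 * (norm (norm (residual \<eta> xb0)))\<^sup>2 + 2 * (norm ((2 + \<eta> * L) * norm (X s t Z - xb0)))\<^sup>2"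
      by (rule norm_add_power2_le)
    finally show ?thesis by (simp add: power_mult_distrib)
  qed
qed

lemma dir_integrable:
  assumes s: "s \<in> {1..S}" and t: "t \<le> m" and x: "integrable Q (\<lambda>Z. (norm (X s t Z - xb0))\<^sup>2)"
    and e: "integrable Q (\<lambda>Z. (norm (err s t Z))\<^sup>2)"
  shows "integrable Q (\<lambda>Z. (norm (dir s t Z))\<^sup>2)"
proof (rule integrable_norm_power2_dominated)
  show "dir s t \<in> borel_measurable Q" by (rule iterate_measurable(5)[OF s t])
  show "integrable Q (\<lambda>Z. 2 * (norm (residual \<eta> (X s t Z)))\<^sup>2 + 2 * \<eta>\<^sup>2 * (norm (err s t Z))\<^sup>2)"
    using residual_X_integrable[OF s t x] e by simp
qed (rule dir_power2_le)

lemma X_Suc_integrable: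
  assumes s: "s \<in> {1..S}" and t: "t \<le> m" and x: "integrable Q (\<lambda>Z. (norm (X s t Z - xb0))\<^sup>2)"
    and e: "integrable Q (\<lambda>Z. (norm (err s t Z))\<^sup>2)"
  shows "integrable Q (\<lambda>Z. (norm (X s (Suc t) Z - xb0))\<^sup>2)"
proof -
  note [measurable] = iterate_measurable[OF s t]
  have "integrable Q (\<lambda>Z. (norm ((X s t Z - xb0) + \<gamma> t *\<^sub>R dir s t Z))\<^sup>2)"
    using x dir_integrable[OF s t x e]
    by (intro integrable_norm_add_power2) (auto simp: power_mult_distrib)
  then show ?thesis by (simp add: X_Suc_dir algebra_simps)
qed

text \<open>Position and error have to be treated jointly: together they bound the displacement,
  which controls the next position, and the variance recursion, valid also for infinite integrals,
  then makes the next error finite.\<close>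

lemma stage_integrable:
  assumes s: "s \<in> {1..S}" and x: "integrable Q (\<lambda>Z. (norm (X s 0 Z - xb0))\<^sup>2)" and t: "t \<le> m"
  shows "integrable Q (\<lambda>Z. (norm (X s t Z - xb0))\<^sup>2) \<and> integrable Q (\<lambda>Z. (norm (err s t Z))\<^sup>2)"
  using t
proof (induction t)
  case 0
  have "(\<integral>\<^sup>+Z. ennreal ((norm (err s 0 Z))\<^sup>2) \<partial>Q) < \<infinity>"
    using err_0[OF s] by (rule le_less_trans) simp
  then show ?case using x iterate_measurable(4)[OF s, of 0]
    by (auto intro!: integrableI_bounded)
next
  case (Suc t)
  then have IH: "integrable Q (\<lambda>Z. (norm (X s t Z - xb0))\<^sup>2)" "integrable Q (\<lambda>Z. (norm (err s t Z))\<^sup>2)"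
    by auto
  have t: "t \<le> m" "t < m" using Suc.prems by auto
  have fin: "(\<integral>\<^sup>+Z. ennreal (g Z) \<partial>Q) < \<infinity>" if "integrable Q g" "\<And>Z. 0 \<le> g Z" for g
    using nn_integral_eq_integral[OF that(1)] that(2) by simp
  have "ennreal (\<beta>\<^sup>2) * (\<integral>\<^sup>+Z. ennreal ((norm (err s t Z))\<^sup>2) \<partial>Q)
      + ennreal (\<beta>\<^sup>2 * L\<^sup>2 * (\<gamma> t)\<^sup>2 / real b) * (\<integral>\<^sup>+Z. ennreal ((norm (dir s t Z))\<^sup>2) \<partial>Q)
      + ennreal ((1 - \<beta>)\<^sup>2 * \<sigma>\<^sup>2 / real bh) < \<infinity>"
    using fin[OF IH(2)] fin[OF dir_integrable[OF s t(1) IH]]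
    by (auto simp: ennreal_mult_less_top)
  with err_Suc[OF s t(2)] have "(\<integral>\<^sup>+Z. ennreal ((norm (err s (Suc t) Z))\<^sup>2) \<partial>Q) < \<infinity>"
    by (rule le_less_trans)
  then have "integrable Q (\<lambda>Z. (norm (err s (Suc t) Z))\<^sup>2)"
    using iterate_measurable(4)[OF s Suc.prems] by (auto intro!: integrableI_bounded)
  then show ?case using X_Suc_integrable[OF s t(1) IH] by simp
qed

lemma xbar_integrable: "s \<le> S \<Longrightarrow> integrable Q (\<lambda>Z. (norm (xbar s Z - xb0))\<^sup>2)"
proof (induction s)
  case (Suc s)
  have s: "Suc s \<in> {1..S}" using Suc.prems by simp
  have "integrable Q (\<lambda>Z. (norm (X (Suc s) 0 Z - xb0))\<^sup>2)" using Suc by (simp add: X_0)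
  from stage_integrable[OF s this order_refl] X_Suc_integrable[OF s order_refl]
  show ?case unfolding xbar_Suc by blast
qed simp

lemma iterate_integrable:
  assumes s: "s \<in> {1..S}" and t: "t \<le> m"
  shows "integrable Q (\<lambda>Z. (norm (err s t Z))\<^sup>2)" "integrable Q (\<lambda>Z. (norm (dir s t Z))\<^sup>2)"
    "integrable Q (\<lambda>Z. (norm (grad_map f \<psi> \<eta> (X s t Z)))\<^sup>2)"
proof -
  have "integrable Q (\<lambda>Z. (norm (X s 0 Z - xb0))\<^sup>2)"
    unfolding X_0 using s by (intro xbar_integrable) auto
  from stage_integrable[OF s this t]
  show e: "integrable Q (\<lambda>Z. (norm (err s t Z))\<^sup>2)" and "integrable Q (\<lambda>Z. (norm (dir s t Z))\<^sup>2)"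
    "integrable Q (\<lambda>Z. (norm (grad_map f \<psi> \<eta> (X s t Z)))\<^sup>2)"
    using dir_integrable[OF s t] residual_X_integrable[OF s t] by (auto simp: norm_grad_map_power2)
qed

lemma expected_err_0:
  assumes s: "s \<in> {1..S}"
  shows "(LINT Z|Q. (norm (err s 0 Z))\<^sup>2) \<le> \<sigma>\<^sup>2 / real bt"
  using err_0[OF s] nn_integral_eq_integral[OF iterate_integrable(1)[OF s, of 0]] by simp

lemma expected_err_Suc:
  assumes s: "s \<in> {1..S}" and t: "t < m"
  shows "(LINT Z|Q. (norm (err s (Suc t) Z))\<^sup>2) \<le> \<beta>\<^sup>2 * (LINT Z|Q. (norm (err s t Z))\<^sup>2)
      + \<beta>\<^sup>2 * L\<^sup>2 * (\<gamma> t)\<^sup>2 / real b * (LINT Z|Q. (norm (dir s t Z))\<^sup>2) + (1 - \<beta>)\<^sup>2 * \<sigma>\<^sup>2 / real bh"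
proof -
  have t': "t \<le> m" "Suc t \<le> m" using t by auto
  have eq: "(\<integral>\<^sup>+Z. ennreal (g Z) \<partial>Q) = ennreal (LINT Z|Q. g Z)" if "integrable Q g" "\<And>Z. 0 \<le> g Z" for g
    using nn_integral_eq_integral[OF that(1)] that(2) by simp
  show ?thesis
    using err_Suc[OF s t]
    unfolding eq[OF iterate_integrable(1)[OF s t'(1)] zero_le_power2] eq[OF iterate_integrable(2)[OF s t'(1)] zero_le_power2]
      eq[OF iterate_integrable(1)[OF s t'(2)] zero_le_power2]
    by (simp flip: ennreal_mult ennreal_plus)
qed

lemma pathwise_descent:
  assumes t: "t \<le> m"
  shows "L * \<eta>\<^sup>2 / 4 * \<gamma> t * (norm (grad_map f \<psi> \<eta> (X s t Z)))\<^sup>2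
      + \<gamma> t / 2 * (\<delta> - L * \<gamma> t) * (norm (dir s t Z))\<^sup>2
    \<le> \<Phi> (X s t Z) - \<Phi> (X s (Suc t) Z) + (1 + L\<^sup>2 * \<eta>\<^sup>2) / (2 * L) * \<gamma> t * (norm (err s t Z))\<^sup>2"
proof -
  have "X s t Z \<in> edom \<psi>" using t by (intro X_in_edom) simp
  from prox_grad_step(2)[OF \<eta>(1) _ _ this, of "\<gamma> t" "V s t Z"] \<gamma>_range[OF t] show ?thesis
    unfolding X_Suc dir_def err_def \<delta> by (simp add: algebra_simps)
qed

lemma pathwise_descent_sum:
  "(\<Sum>s=1..S. \<Sum>t\<le>m. L * \<eta>\<^sup>2 / 4 * \<gamma> t * (norm (grad_map f \<psi> \<eta> (X s t Z)))\<^sup>2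
      + \<gamma> t / 2 * (\<delta> - L * \<gamma> t) * (norm (dir s t Z))\<^sup>2)
    \<le> \<Phi> xb0 - Fst + (\<Sum>s=1..S. \<Sum>t\<le>m. (1 + L\<^sup>2 * \<eta>\<^sup>2) / (2 * L) * \<gamma> t * (norm (err s t Z))\<^sup>2)"
proof -
  have "(\<Sum>s=1..S. \<Sum>t\<le>m. L * \<eta>\<^sup>2 / 4 * \<gamma> t * (norm (grad_map f \<psi> \<eta> (X s t Z)))\<^sup>2
      + \<gamma> t / 2 * (\<delta> - L * \<gamma> t) * (norm (dir s t Z))\<^sup>2)
    \<le> (\<Sum>s=1..S. \<Sum>t\<le>m. (\<Phi> (X s t Z) - \<Phi> (X s (Suc t) Z))
        + (1 + L\<^sup>2 * \<eta>\<^sup>2) / (2 * L) * \<gamma> t * (norm (err s t Z))\<^sup>2)"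
    by (intro sum_mono pathwise_descent) simp
  also have "\<dots> = (\<Sum>s=1..S. \<Sum>t\<le>m. \<Phi> (X s t Z) - \<Phi> (X s (Suc t) Z))
      + (\<Sum>s=1..S. \<Sum>t\<le>m. (1 + L\<^sup>2 * \<eta>\<^sup>2) / (2 * L) * \<gamma> t * (norm (err s t Z))\<^sup>2)"
    by (simp only: sum.distrib)
  \<comment> \<open>Two nested telescoping sums: the end of each stage is the start of the
    next.\<close>
  also have "(\<Sum>s=1..S. \<Sum>t\<le>m. \<Phi> (X s t Z) - \<Phi> (X s (Suc t) Z))
      = (\<Sum>s=1..S. \<Phi> (xbar (s - 1) Z) - \<Phi> (xbar s Z))"
  proof (rule sum.cong)
    fix s assume "s \<in> {1..S}"
    then have "xbar s Z = X s (Suc m) Z" using xbar_Suc[where s = "s - 1" and Z = Z] by simp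
    moreover have "(\<Sum>t\<le>m. \<Phi> (X s t Z) - \<Phi> (X s (Suc t) Z)) = \<Phi> (X s 0 Z) - \<Phi> (X s (Suc m) Z)"
      using sum_telescope[of "\<lambda>t. \<Phi> (X s t Z)" m] by simp
    ultimately show "(\<Sum>t\<le>m. \<Phi> (X s t Z) - \<Phi> (X s (Suc t) Z)) = \<Phi> (xbar (s - 1) Z) - \<Phi> (xbar s Z)"
      by (simp add: X_0)
  qed simp
  also have "\<dots> = \<Phi> (xbar 0 Z) - \<Phi> (xbar S Z)"
    by (induction S) simp_all
  also have "\<dots> \<le> \<Phi> xb0 - Fst" using Fst[OF xbar_in_edom[of Z S]] by simp
  finally show ?thesis by simp
qed

theorem weighted_expected_grad_map:
  "L * \<eta>\<^sup>2 / 4 * (\<Sum>s=1..S. \<Sum>t\<le>m. \<gamma> t * (LINT Z|Q. (norm (grad_map f \<psi> \<eta> (X s t Z)))\<^sup>2))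
    \<le> \<Phi> xb0 - Fst + real S * (2 * \<theta> * \<sigma>\<^sup>2 / L * (\<Sum>t\<le>m. \<gamma> t))"
proof -
  interpret prob_space Q by (rule prob_space_Q)
  let ?G = "\<lambda>s t. LINT Z|Q. (norm (grad_map f \<psi> \<eta> (X s t Z)))\<^sup>2"
  let ?D = "\<lambda>s t. LINT Z|Q. (norm (dir s t Z))\<^sup>2" and ?E = "\<lambda>s t. LINT Z|Q. (norm (err s t Z))\<^sup>2"
  let ?c = "(1 + L\<^sup>2 * \<eta>\<^sup>2) / (2 * L)"
  note int = iterate_integrable
  have "(LINT Z|Q. (\<Sum>s=1..S. \<Sum>t\<le>m. L * \<eta>\<^sup>2 / 4 * \<gamma> t * (norm (grad_map f \<psi> \<eta> (X s t Z)))\<^sup>2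
      + \<gamma> t / 2 * (\<delta> - L * \<gamma> t) * (norm (dir s t Z))\<^sup>2))
    \<le> (LINT Z|Q. \<Phi> xb0 - Fst + (\<Sum>s=1..S. \<Sum>t\<le>m. ?c * \<gamma> t * (norm (err s t Z))\<^sup>2))"
    using int by (intro integral_mono pathwise_descent_sum Bochner_Integration.integrable_sum
        Bochner_Integration.integrable_add integrable_mult_right integrable_const) auto
  also have "\<dots> = \<Phi> xb0 - Fst + (\<Sum>s=1..S. \<Sum>t\<le>m. ?c * \<gamma> t * ?E s t)"
  proof -
    have "integrable Q (\<lambda>Z. \<Sum>s=1..S. \<Sum>t\<le>m. ?c * \<gamma> t * (norm (err s t Z))\<^sup>2)"
      using int by (intro Bochner_Integration.integrable_sum integrable_mult_right) auto
    then have "(LINT Z|Q. \<Phi> xb0 - Fst + (\<Sum>s=1..S. \<Sum>t\<le>m. ?c * \<gamma> t * (norm (err s t Z))\<^sup>2))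
        = \<Phi> xb0 - Fst + (LINT Z|Q. (\<Sum>s=1..S. \<Sum>t\<le>m. ?c * \<gamma> t * (norm (err s t Z))\<^sup>2))"
      by (subst Bochner_Integration.integral_add) (auto simp: prob_space)
    also have "(LINT Z|Q. (\<Sum>s=1..S. \<Sum>t\<le>m. ?c * \<gamma> t * (norm (err s t Z))\<^sup>2))
        = (\<Sum>s=1..S. LINT Z|Q. (\<Sum>t\<le>m. ?c * \<gamma> t * (norm (err s t Z))\<^sup>2))"
      using int by (intro Bochner_Integration.integral_sum Bochner_Integration.integrable_sum integrable_mult_right) auto
    also have "\<dots> = (\<Sum>s=1..S. \<Sum>t\<le>m. LINT Z|Q. ?c * \<gamma> t * (norm (err s t Z))\<^sup>2)"
      using int by (intro sum.cong refl Bochner_Integration.integral_sum integrable_mult_right) auto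
    finally show ?thesis by simp
  qed
  also have "(LINT Z|Q. (\<Sum>s=1..S. \<Sum>t\<le>m. L * \<eta>\<^sup>2 / 4 * \<gamma> t * (norm (grad_map f \<psi> \<eta> (X s t Z)))\<^sup>2
      + \<gamma> t / 2 * (\<delta> - L * \<gamma> t) * (norm (dir s t Z))\<^sup>2))
    = (\<Sum>s=1..S. LINT Z|Q. (\<Sum>t\<le>m. L * \<eta>\<^sup>2 / 4 * \<gamma> t * (norm (grad_map f \<psi> \<eta> (X s t Z)))\<^sup>2
      + \<gamma> t / 2 * (\<delta> - L * \<gamma> t) * (norm (dir s t Z))\<^sup>2))"
    using int by (intro Bochner_Integration.integral_sum Bochner_Integration.integrable_sum
        Bochner_Integration.integrable_add integrable_mult_right) auto
  also have "\<dots> = (\<Sum>s=1..S. \<Sum>t\<le>m. LINT Z|Q. L * \<eta>\<^sup>2 / 4 * \<gamma> t * (norm (grad_map f \<psi> \<eta> (X s t Z)))\<^sup>2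
      + \<gamma> t / 2 * (\<delta> - L * \<gamma> t) * (norm (dir s t Z))\<^sup>2)"
    using int by (intro sum.cong refl Bochner_Integration.integral_sum
        Bochner_Integration.integrable_add integrable_mult_right) auto
  also have "\<dots> = (\<Sum>s=1..S. \<Sum>t\<le>m. L * \<eta>\<^sup>2 / 4 * \<gamma> t * ?G s t + \<gamma> t / 2 * (\<delta> - L * \<gamma> t) * ?D s t)"
    using int by (intro sum.cong refl, subst Bochner_Integration.integral_add) auto
  also have "\<dots> = L * \<eta>\<^sup>2 / 4 * (\<Sum>s=1..S. \<Sum>t\<le>m. \<gamma> t * ?G s t)
      + (\<Sum>s=1..S. \<Sum>t\<le>m. \<gamma> t / 2 * (\<delta> - L * \<gamma> t) * ?D s t)"
    by (simp only: sum.distrib sum_distrib_left mult.assoc)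
  \<comment> \<open>Stage by stage the errors are paid for by the displacement terms already present
    on the other side; these cancel at the end and only the noise remains.\<close>
  also have "(\<Sum>s=1..S. \<Sum>t\<le>m. ?c * \<gamma> t * ?E s t)
      \<le> (\<Sum>s=1..S. (\<Sum>t\<le>m. \<gamma> t / 2 * (\<delta> - L * \<gamma> t) * ?D s t) + 2 * \<theta> * \<sigma>\<^sup>2 / L * (\<Sum>t\<le>m. \<gamma> t))"
  proof (rule sum_mono)
    fix s assume s: "s \<in> {1..S}"
    have "?c * (\<Sum>t\<le>m. \<gamma> t * ?E s t)
      \<le> (\<Sum>t\<le>m. \<gamma> t / 2 * (\<delta> - L * \<gamma> t) * ?D s t) + 2 * \<theta> * \<sigma>\<^sup>2 / L * (\<Sum>t\<le>m. \<gamma> t)"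
      by (rule weighted_error_bound[OF \<theta> bh bt expected_err_0[OF s] expected_err_Suc[OF s]]) auto
    then show "(\<Sum>t\<le>m. ?c * \<gamma> t * ?E s t)
      \<le> (\<Sum>t\<le>m. \<gamma> t / 2 * (\<delta> - L * \<gamma> t) * ?D s t) + 2 * \<theta> * \<sigma>\<^sup>2 / L * (\<Sum>t\<le>m. \<gamma> t)"
      by (simp only: sum_distrib_left mult.assoc)
  qed
  finally show ?thesis by (simp add: sum.distrib)
qed

end

section \<open>Random output index and complexity\<close>

text \<open>Independence is given for families of preimages, whereas independence of real random
  variables refers to the generated \<sigma>-algebras. Preimages are stable under intersection, so
  independence extends to what they generate.\<close>

lemma (in prob_space) indep_var_compose_of_indep_preimages:
  fixes u :: "'c \<Rightarrow> real" and v :: "'d \<Rightarrow> real"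
  assumes rv: "\<Xi> \<in> M \<rightarrow>\<^sub>M N" "J \<in> M \<rightarrow>\<^sub>M K"
    and ind: "indep_set {\<Xi> -` A \<inter> space M | A. A \<in> sets N} {J -` B \<inter> space M | B. B \<in> sets K}"
    and uv: "u \<in> borel_measurable N" "v \<in> borel_measurable K"
  shows "indep_var borel (\<lambda>\<omega>. u (\<Xi> \<omega>)) borel (\<lambda>\<omega>. v (J \<omega>))"
proof -
  let ?A = "{(\<lambda>\<omega>. u (\<Xi> \<omega>)) -` A \<inter> space M | A. A \<in> sets borel}"
  let ?B = "{(\<lambda>\<omega>. v (J \<omega>)) -` A \<inter> space M | A. A \<in> sets borel}"
  have st: "Int_stable {Y -` A \<inter> space M | A. A \<in> sets borel}" for Y :: "'a \<Rightarrow> real"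
  proof (rule Int_stableI)
    fix a b assume "a \<in> {Y -` A \<inter> space M | A. A \<in> sets borel}" "b \<in> {Y -` A \<inter> space M | A. A \<in> sets borel}"
    then obtain A B where "a = Y -` A \<inter> space M" "b = Y -` B \<inter> space M" "A \<in> sets borel" "B \<in> sets borel"
      by auto
    then show "a \<inter> b \<in> {Y -` A \<inter> space M | A. A \<in> sets borel}"
      by (intro CollectI exI[of _ "A \<inter> B"]) auto
  qed
  have sub: "{(\<lambda>\<omega>. w (Y \<omega>)) -` A \<inter> space M | A. A \<in> sets borel} \<subseteq> {Y -` A \<inter> space M | A. A \<in> sets N'}"
    if Y: "Y \<in> M \<rightarrow>\<^sub>M N'" and w: "w \<in> borel_measurable N'" for Y :: "'a \<Rightarrow> 'e" and w :: "'e \<Rightarrow> real" and N'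
  proof safe
    fix A :: "real set" assume "A \<in> sets borel"
    then have "w -` A \<inter> space N' \<in> sets N'" using w by (rule measurable_sets[rotated])
    moreover have "(\<lambda>\<omega>. w (Y \<omega>)) -` A \<inter> space M = Y -` (w -` A \<inter> space N') \<inter> space M"
      using measurable_space[OF Y] by auto
    ultimately show "\<exists>B. (\<lambda>\<omega>. w (Y \<omega>)) -` A \<inter> space M = Y -` B \<inter> space M \<and> B \<in> sets N'" by blast
  qed
  have "indep_set ?A ?B"
    using ind sub[OF rv(1) uv(1)] sub[OF rv(2) uv(2)] unfolding indep_sets2_eq
    by (meson subset_trans subsetD)
  then show ?thesis
    unfolding indep_var_eq
    by (intro conjI indep_set_sigma_sets st measurable_compose[OF rv(1) uv(1)] measurable_compose[OF rv(2) uv(2)])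
qed

text \<open>Splitting over the finitely many index values makes every summand a function of the
  samples times an indicator of the index, and independence factorizes its expectation.\<close>

lemma (in prob_space) expectation_at_independent_index:
  fixes g :: "'j \<Rightarrow> 'c \<Rightarrow> real"
  assumes \<Xi>: "\<Xi> \<in> M \<rightarrow>\<^sub>M N" and J: "J \<in> M \<rightarrow>\<^sub>M count_space K"
    and ind: "indep_set {\<Xi> -` A \<inter> space M | A. A \<in> sets N} {J -` B \<inter> space M | B. B \<in> sets (count_space K)}"
    and K: "finite K"
    and g: "\<And>j. j \<in> K \<Longrightarrow> integrable (distr M N \<Xi>) (g j)"
  shows "integrable M (\<lambda>\<omega>. g (J \<omega>) (\<Xi> \<omega>))"
    and "(LINT \<omega>|M. g (J \<omega>) (\<Xi> \<omega>))
      = (\<Sum>j\<in>K. prob {\<omega> \<in> space M. J \<omega> = j} * (LINT z|distr M N \<Xi>. g j z))"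
proof -
  define h where "h = (\<lambda>j \<omega>. g j (\<Xi> \<omega>) * indicator {j} (J \<omega>))"
  \<comment> \<open>Measurability into \<open>count_space K\<close> confines the index to
    \<open>K\<close>, so exactly one indicator equals 1.\<close>
  have eq: "g (J \<omega>) (\<Xi> \<omega>) = (\<Sum>j\<in>K. h j \<omega>)" if "\<omega> \<in> space M" for \<omega>
    using K measurable_space[OF J that] by (simp add: h_def indicator_def if_distrib cong: if_cong)
  have *: "integrable M (h j)"
    "(LINT \<omega>|M. h j \<omega>) = prob {\<omega> \<in> space M. J \<omega> = j} * (LINT z|distr M N \<Xi>. g j z)" if j: "j \<in> K" for j
  proof -
    have gm: "g j \<in> borel_measurable N" using g[OF j] by auto
    have i1: "integrable M (\<lambda>\<omega>. g j (\<Xi> \<omega>))"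
      using g[OF j] integrable_distr_eq[OF \<Xi> gm] by simp
    have ev: "{\<omega> \<in> space M. J \<omega> = j} \<in> sets M"
    proof -
      have "J -` {j} \<inter> space M \<in> sets M" using J j by (auto intro: measurable_sets)
      then show ?thesis by (simp add: vimage_def Int_def conj_commute)
    qed
    have ind_eq: "indicator {j} (J \<omega>) = indicator {\<omega> \<in> space M. J \<omega> = j} \<omega>" if "\<omega> \<in> space M" for \<omega>
      using that by (simp add: indicator_def)
    have i2: "integrable M (\<lambda>\<omega>. indicator {j} (J \<omega>) :: real)"
      using ev by (subst Bochner_Integration.integrable_cong[OF refl ind_eq]) (auto simp: emeasure_eq_measure)
    have ind': "indep_var borel (\<lambda>\<omega>. g j (\<Xi> \<omega>)) borel (\<lambda>\<omega>. indicator {j} (J \<omega>) :: real)"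
      by (rule indep_var_compose_of_indep_preimages[OF \<Xi> J ind gm]) simp
    show "integrable M (h j)" unfolding h_def by (rule indep_var_integrable[OF ind' i1 i2])
    have "(LINT \<omega>|M. h j \<omega>) = (LINT \<omega>|M. g j (\<Xi> \<omega>)) * (LINT \<omega>|M. indicator {j} (J \<omega>))"
      unfolding h_def by (rule indep_var_lebesgue_integral[OF ind' i1 i2])
    also have "(LINT \<omega>|M. indicator {j} (J \<omega>) :: real) = (LINT \<omega>|M. indicator {\<omega> \<in> space M. J \<omega> = j} \<omega>)"
      by (rule Bochner_Integration.integral_cong[OF refl ind_eq])
    also have "\<dots> = prob {\<omega> \<in> space M. J \<omega> = j}" using ev by simp
    also have "(LINT \<omega>|M. g j (\<Xi> \<omega>)) = (LINT z|distr M N \<Xi>. g j z)"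
      by (rule integral_distr[OF \<Xi> gm, symmetric])
    finally show "(LINT \<omega>|M. h j \<omega>) = prob {\<omega> \<in> space M. J \<omega> = j} * (LINT z|distr M N \<Xi>. g j z)"
      by (simp add: mult.commute)
  qed
  have "integrable M (\<lambda>\<omega>. \<Sum>j\<in>K. h j \<omega>)" using *(1) by simp
  then show "integrable M (\<lambda>\<omega>. g (J \<omega>) (\<Xi> \<omega>))"
    by (subst Bochner_Integration.integrable_cong[OF refl eq])
  have "(LINT \<omega>|M. g (J \<omega>) (\<Xi> \<omega>)) = (LINT \<omega>|M. (\<Sum>j\<in>K. h j \<omega>))"
    by (rule Bochner_Integration.integral_cong[OF refl eq])
  also have "\<dots> = (\<Sum>j\<in>K. LINT \<omega>|M. h j \<omega>)" using *(1) by (rule Bochner_Integration.integral_sum)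
  finally show "(LINT \<omega>|M. g (J \<omega>) (\<Xi> \<omega>))
      = (\<Sum>j\<in>K. prob {\<omega> \<in> space M. J \<omega> = j} * (LINT z|distr M N \<Xi>. g j z))"
    using *(2) by simp
qed

text \<open>The source of the factor c1^2 + 3: with N = m + 1, a stage costs bt + 3 b N = (c1^2 + 3)
  b N gradient evaluations.\<close>

lemma batch_ratio:
  fixes L \<eta> \<sigma> \<epsilon> c1 N :: real and b bt :: nat
  assumes pos: "0 < L" "0 < \<eta>" "0 < \<epsilon>" "0 < c1" "1 \<le> b"
    and bt: "real bt = 24 * c1 / (L\<^sup>2 * \<eta>\<^sup>2 * \<epsilon>\<^sup>2) * max (\<sigma>\<^sup>2) 1"
    and N: "N = 24 / (c1 * L\<^sup>2 * \<eta>\<^sup>2 * real b * \<epsilon>\<^sup>2) * max (\<sigma>\<^sup>2) 1"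
  shows "real bt / N = c1\<^sup>2 * real b"
proof -
  define \<mu> where "\<mu> = max (\<sigma>\<^sup>2) 1"
  have "0 < \<mu>" by (simp add: \<mu>_def)
  then show ?thesis
    unfolding bt N \<mu>_def[symmetric] using pos by (simp add: field_simps power2_eq_square)
qed

text \<open>The budget \<epsilon>^2 is split into 2/3 for the optimization term and 1/3 for the
  noise, the latter being 8/24 by the constant 24 in the batch sizes. The upper bound on b makes L
  at most the root next to it, so their sum is at most twice the root. The halved constant 4 sqrt 2
  pays for the factor 2 in the hypothesis on \<open>X\<close>.\<close>

lemma complexity_arithmetic:
  fixes L \<eta> \<delta> \<sigma> \<epsilon> c1 N \<Delta> :: real and b bt S :: nat
  defines "X \<equiv> 96 * sqrt 3 * max 1 \<sigma> / (\<eta> ^ 3 * L * sqrt (L * \<delta>) * real b * \<epsilon> ^ 3) * \<Delta>"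
  assumes pos: "0 < L" "0 < \<eta>" "0 < \<delta>" "0 < \<epsilon>" "0 < c1" "0 \<le> \<sigma>" "0 \<le> \<Delta>" and b: "1 \<le> b" and S: "1 \<le> S" and N: "0 < N"
    and b_le: "real b \<le> 2 * sqrt (6 * \<delta>) / (L * sqrt L * \<eta> * \<epsilon>)"
    and bt: "real bt = 24 * c1 / (L\<^sup>2 * \<eta>\<^sup>2 * \<epsilon>\<^sup>2) * max (\<sigma>\<^sup>2) 1"
    and m: "N = 24 / (c1 * L\<^sup>2 * \<eta>\<^sup>2 * real b * \<epsilon>\<^sup>2) * max (\<sigma>\<^sup>2) 1"
    and X: "X \<le> 2 * (real S * N)"
  shows "4 * sqrt 2 * (L + sqrt (L * \<delta> / (real b * (sqrt (real b) / sqrt (real bt * N))))) / (L * \<eta>\<^sup>2 * \<delta> * real S * N) * \<Delta>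
      + 8 * \<sigma>\<^sup>2 / (L\<^sup>2 * \<eta>\<^sup>2 * sqrt (real b * real bt * N)) \<le> \<epsilon>\<^sup>2"
proof -
  define \<mu> where "\<mu> = max 1 \<sigma>"
  have \<mu>: "1 \<le> \<mu>" "\<sigma> \<le> \<mu>" "max (\<sigma>\<^sup>2) 1 = \<mu>\<^sup>2"
  proof -
    show "max (\<sigma>\<^sup>2) 1 = \<mu>\<^sup>2"
    proof (cases "1 \<le> \<sigma>")
      case True
      then have "1 \<le> \<sigma>\<^sup>2" by (simp add: one_le_power)
      with True show ?thesis by (simp add: \<mu>_def)
    next
      case False
      then have "\<sigma>\<^sup>2 \<le> 1" using pos by (simp add: power_le_one)
      with False show ?thesis by (simp add: \<mu>_def)
    qed
  qed (auto simp: \<mu>_def)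
  have b0: "0 < real b" using b by simp
  have S0: "0 < real S" using S by simp
  define a where "a = L * \<eta> * \<epsilon>"
  have a: "0 < a" using pos by (simp add: a_def)
  have bt': "real bt = 24 * c1 * \<mu>\<^sup>2 / a\<^sup>2" by (simp add: bt \<mu> a_def power_mult_distrib)
  have N': "N = 24 * \<mu>\<^sup>2 / (c1 * real b * a\<^sup>2)"
    by (simp add: m \<mu> a_def power_mult_distrib mult.commute mult.left_commute)
  have bN: "real b * real bt * N = (24 * \<mu>\<^sup>2 / a\<^sup>2)\<^sup>2"
    unfolding bt' N' using a b0 pos \<mu>(1) by (simp add: field_simps power2_eq_square)
  have sbN: "sqrt (real b * real bt * N) = 24 * \<mu>\<^sup>2 / a\<^sup>2"
    unfolding bN using a \<mu>(1) by simp
  have "8 * \<sigma>\<^sup>2 / (L\<^sup>2 * \<eta>\<^sup>2 * sqrt (real b * real bt * N)) = \<epsilon>\<^sup>2 / 3 * (\<sigma>\<^sup>2 / \<mu>\<^sup>2)"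
    unfolding sbN a_def using pos \<mu>(1) by (simp add: field_simps)
  also have "\<dots> \<le> \<epsilon>\<^sup>2 / 3 * 1"
    using \<mu> pos by (intro mult_left_mono) (auto intro: power_mono)
  finally have noise: "8 * \<sigma>\<^sup>2 / (L\<^sup>2 * \<eta>\<^sup>2 * sqrt (real b * real bt * N)) \<le> \<epsilon>\<^sup>2 / 3" by simp
  have "sqrt (real b) * sqrt (real bt * N) = 24 * \<mu>\<^sup>2 / a\<^sup>2"
    using sbN by (simp add: real_sqrt_mult mult.assoc)
  then have "sqrt (real bt * N) = 24 * \<mu>\<^sup>2 / a\<^sup>2 / sqrt (real b)"
    using b0 by (subst nonzero_eq_divide_eq) (simp_all only: mult.commute, simp)
  then have sN: "sqrt (real bt * N) = 24 * \<mu>\<^sup>2 / (a\<^sup>2 * sqrt (real b))" by simp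
  define r where "r = sqrt (L * \<delta> / (real b * (sqrt (real b) / sqrt (real bt * N))))"
  have "real b * (sqrt (real b) / sqrt (real bt * N)) = (real b * a)\<^sup>2 / (24 * \<mu>\<^sup>2)"
    unfolding sN using b0 by (simp add: power2_eq_square)
  then have "L * \<delta> / (real b * (sqrt (real b) / sqrt (real bt * N))) = (L * \<delta>) * (24 * (\<mu> / (real b * a))\<^sup>2)"
    by (simp add: power_divide)
  then have "r = sqrt (L * \<delta>) * (sqrt 24 * (\<mu> / (real b * a)))"
    unfolding r_def using \<mu>(1) b0 a by (simp add: real_sqrt_mult)
  moreover have "sqrt 24 = 2 * sqrt 6" using real_sqrt_mult[of 4 6] by simp
  ultimately have r: "r = 2 * sqrt 6 * \<mu> * sqrt (L * \<delta>) / (a * real b)" by (simp add: mult_ac)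
  have Lr: "L \<le> r"
  proof -
    have "real b * (L * sqrt L * \<eta> * \<epsilon>) \<le> 2 * sqrt (6 * \<delta>)"
      using b_le pos by (simp add: pos_le_divide_eq)
    then have "sqrt L * (real b * (L * sqrt L * \<eta> * \<epsilon>)) \<le> sqrt L * (2 * sqrt (6 * \<delta>))"
      using pos by (intro mult_left_mono) auto
    also have "sqrt L * (real b * (L * sqrt L * \<eta> * \<epsilon>)) = (sqrt L * sqrt L) * (real b * a)"
      unfolding a_def by (simp only: mult_ac)
    also have "sqrt L * sqrt L = L" using pos by simp
    also have "sqrt L * (2 * sqrt (6 * \<delta>)) = 2 * sqrt 6 * sqrt (L * \<delta>)"
      by (simp add: real_sqrt_mult)
    also have "\<dots> \<le> \<mu> * (2 * sqrt 6 * sqrt (L * \<delta>))"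
      using \<mu>(1) pos mult_right_mono[of 1 \<mu> "2 * sqrt 6 * sqrt (L * \<delta>)"] by simp
    finally show ?thesis
      unfolding r using a b0 by (simp add: pos_le_divide_eq mult_ac)
  qed
  have D: "0 < L * \<eta>\<^sup>2 * \<delta> * real S * N" using pos S0 N by simp
  have "4 * sqrt 2 * (L + r) / (L * \<eta>\<^sup>2 * \<delta> * real S * N) * \<Delta> \<le> 4 * sqrt 2 * (r + r) / (L * \<eta>\<^sup>2 * \<delta> * real S * N) * \<Delta>"
    using Lr D pos by (intro mult_right_mono divide_right_mono mult_left_mono) auto
  also have "\<dots> = X * \<epsilon>\<^sup>2 / (3 * (real S * N))"
  proof -
    define q where "q = sqrt (L * \<delta>)"
    have q: "0 < q" "q * q = L * \<delta>" using pos by (auto simp: q_def)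
    have "4 * sqrt 2 * (r + r) = 8 * (sqrt 2 * (2 * sqrt 6)) * \<mu> * q / (a * real b)"
      unfolding r q_def by simp
    \<comment> \<open>This is 2 sqrt 12. With the factor 8 it gives 32 sqrt 3, one third of the
      constant 96 sqrt 3 in \<open>X\<close>.\<close>
    also have "sqrt 2 * (2 * sqrt 6) = 4 * sqrt 3"
    proof -
      have "sqrt 2 * sqrt 6 = 2 * sqrt 3"
        using real_sqrt_mult[of 2 6] real_sqrt_mult[of 4 3] by simp
      then show ?thesis by simp
    qed
    finally have "4 * sqrt 2 * (r + r) / (L * \<eta>\<^sup>2 * \<delta> * real S * N) * \<Delta>
        = 32 * sqrt 3 * \<mu> * q / (a * real b) / (\<eta>\<^sup>2 * (q * q) * real S * N) * \<Delta>"
      unfolding q(2) by (simp add: mult_ac)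
    also have "\<dots> = 32 * sqrt 3 * \<mu> / (a * real b * \<eta>\<^sup>2 * q * real S * N) * \<Delta>"
      using q(1) by simp
    also have "\<dots> = X * \<epsilon>\<^sup>2 / (3 * (real S * N))"
      unfolding X_def \<mu>_def[symmetric] q_def[symmetric] a_def using pos q(1) b0 S0 N
      by (simp add: field_simps power2_eq_square power3_eq_cube)
    finally show ?thesis .
  qed
  also have "\<dots> \<le> 2 * (real S * N) * \<epsilon>\<^sup>2 / (3 * (real S * N))"
    using X S0 N by (intro divide_right_mono mult_right_mono) auto
  also have "\<dots> = 2 / 3 * \<epsilon>\<^sup>2" using S0 N by simp
  finally have main: "4 * sqrt 2 * (L + r) / (L * \<eta>\<^sup>2 * \<delta> * real S * N) * \<Delta> \<le> 2 / 3 * \<epsilon>\<^sup>2" .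
  show "4 * sqrt 2 * (L + sqrt (L * \<delta> / (real b * (sqrt (real b) / sqrt (real bt * N))))) / (L * \<eta>\<^sup>2 * \<delta> * real S * N) * \<Delta>
      + 8 * \<sigma>\<^sup>2 / (L\<^sup>2 * \<eta>\<^sup>2 * sqrt (real b * real bt * N)) \<le> \<epsilon>\<^sup>2"
    using main noise unfolding r_def by linarith
qed

lemma sqrt_sqrt_eq_powr: "0 \<le> x \<Longrightarrow> sqrt (sqrt x) = x powr (1/4)"
  by (simp add: powr_powr flip: powr_half_sqrt)

text \<open>Integrability is asserted because the integral of a non-integrable function is 0 by
  convention, so the bound alone would say little. In (b) the number of stages needed is the real
  number \<open>S\<epsilon>\<close>, and the accuracy is claimed for any stage count
  \<open>S\<close> that is at least as large.\<close>

theorem theorem5: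
  fixes P :: "'z measure"
    and fs :: "'z \<Rightarrow> 'a::euclidean_space \<Rightarrow> real"
    and f :: "'a \<Rightarrow> real"
    and \<psi> F :: "'a \<Rightarrow> ereal"
    and Fstar :: ereal
    and L \<sigma> \<eta> \<delta> \<beta> \<Sigma>m :: real
    and \<gamma> :: "nat \<Rightarrow> real"
    and m S b bh bt :: nat
    and xb0 :: 'a
    and M :: "'w measure"
    and \<xi> :: "sample_label \<Rightarrow> 'w \<Rightarrow> 'z"
    and J :: "'w \<Rightarrow> nat \<times> nat"
    and xT :: "'w \<Rightarrow> 'a"
  assumes P: "prob_space P"
    and smooth: "\<And>z. z \<in> space P \<Longrightarrow> C1_fun (fs z)"
    and f_int: "\<And>x. integrable P (\<lambda>z. fs z x)"
    and f_def: "\<And>x. f x = (LINT z|P. fs z x)"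
    and f_diff: "\<And>x. f differentiable (at x)"
    and grad_int: "\<And>x. integrable P (\<lambda>z. grad (fs z) x)"
    and unbiased: "\<And>x. (LINT z|P. grad (fs z) x) = grad f x"
    and F_def: "\<And>x. F x = ereal (f x) + \<psi> x"
    and Fstar_def: "Fstar = (INF x. F x)"
    and A1: "proper_fun \<psi>" "closed_fun \<psi>" "convex_fun \<psi>" "edom F \<noteq> {}" "Fstar > -\<infinity>"
    and L_pos: "L > 0"
    and A2: "\<And>x y. x \<in> edom F \<Longrightarrow> y \<in> edom F \<Longrightarrow>
        (\<integral>\<^sup>+z. ennreal ((norm (grad (fs z) x - grad (fs z) y))\<^sup>2) \<partial>P)
          \<le> ennreal (L\<^sup>2 * (norm (x - y))\<^sup>2)"
    and \<sigma>_nonneg: "\<sigma> \<ge> 0"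
    and A3: "\<And>x. x \<in> edom F \<Longrightarrow>
        (\<integral>\<^sup>+z. ennreal ((norm (grad (fs z) x - grad f x))\<^sup>2) \<partial>P) \<le> ennreal (\<sigma>\<^sup>2)"
    and sizes: "b \<ge> 1" "bh \<ge> 1" "bt \<ge> 1" "S \<ge> 1" "bh \<le> bt * (m + 1)"
    and x0: "xb0 \<in> edom F"
    and \<eta>: "0 < \<eta>" "\<eta> < 1 / L"
    and \<delta>: "\<delta> = 2 / \<eta> - 2 * L"
    and \<beta>: "\<beta> = 1 - sqrt (real bh) / sqrt (real bt * (real m + 1))"
    and \<gamma>_m: "\<gamma> m = \<delta> / L"
    and \<gamma>_t: "\<And>t. t < m \<Longrightarrow> \<gamma> t = \<delta> * real b /
        (L * real b + L * (1 + L\<^sup>2 * \<eta>\<^sup>2) * (\<Sum>k=t+1..m. \<beta> ^ (2 * (k - t)) * \<gamma> k))"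
    and \<gamma>_range: "\<And>t. t \<le> m \<Longrightarrow> 0 < \<gamma> t \<and> \<gamma> t \<le> 1"
    and \<Sigma>m: "\<Sigma>m = (\<Sum>t=0..m. \<gamma> t)"
    and M: "prob_space M"
    and samples_indep:
      "prob_space.indep_vars M (\<lambda>_. P) \<xi> (sample_labels S m bt b bh)"
    and samples_law: "\<And>l. l \<in> sample_labels S m bt b bh \<Longrightarrow> distr M P (\<xi> l) = P"
    and J_meas: "J \<in> M \<rightarrow>\<^sub>M count_space ({1..S} \<times> {0..m})"
    and J_law: "\<And>s t. s \<in> {1..S} \<Longrightarrow> t \<in> {0..m} \<Longrightarrow>
        measure M {\<omega> \<in> space M. J \<omega> = (s, t)} = \<gamma> t / (real S * \<Sigma>m)"
    and J_indep: "prob_space.indep_set M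
        {(\<lambda>\<omega>. \<lambda>l\<in>sample_labels S m bt b bh. \<xi> l \<omega>) -` A \<inter> space M | A.
            A \<in> sets (PiM (sample_labels S m bt b bh) (\<lambda>_. P))}
        {J -` B \<inter> space M | B. B \<in> sets (count_space ({1..S} \<times> {0..m}))}"
    and xT: "\<And>\<omega>. xT \<omega> = rs_iterate fs \<psi> \<eta> \<beta> \<gamma> m bt b bh (\<lambda>l. \<xi> l \<omega>) xb0 (fst (J \<omega>)) (snd (J \<omega>))"
  shows
    "integrable M (\<lambda>\<omega>. (norm (grad_map f \<psi> \<eta> (xT \<omega>)))\<^sup>2) \<and>
     (LINT \<omega>|M. (norm (grad_map f \<psi> \<eta> (xT \<omega>)))\<^sup>2)
       \<le> 8 * sqrt 2 * (real bh powr (1/4) * sqrt (real b) * L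
                       + (real bt * (real m + 1)) powr (1/4) * sqrt (L * \<delta>))
           / (L * \<eta>\<^sup>2 * \<delta> * real S * (real m + 1) * real bh powr (1/4) * sqrt (real b))
           * real_of_ereal (F xb0 - Fstar)
         + 8 * \<sigma>\<^sup>2 / (L\<^sup>2 * \<eta>\<^sup>2 * sqrt (real bh * real bt * (real m + 1)))
     \<and>
     (\<forall>\<epsilon> c1 :: real.
        \<epsilon> > 0 \<and> c1 > 1 / (real m + 1) \<and> bh = b
        \<and> real b \<le> 2 * sqrt (6 * \<delta>) / (L * sqrt L * \<eta> * \<epsilon>)
        \<and> real bt = 24 * c1 / (L\<^sup>2 * \<eta>\<^sup>2 * \<epsilon>\<^sup>2) * max (\<sigma>\<^sup>2) 1
        \<and> real m + 1 = 24 / (c1 * L\<^sup>2 * \<eta>\<^sup>2 * real b * \<epsilon>\<^sup>2) * max (\<sigma>\<^sup>2) 1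
        \<longrightarrow>
        (let T = \<lfloor>96 * sqrt 3 * max 1 \<sigma> / (\<eta> ^ 3 * L * sqrt (L * \<delta>) * real b * \<epsilon> ^ 3)
                    * real_of_ereal (F xb0 - Fstar)\<rfloor>;
             Tgrad = \<lfloor>(c1\<^sup>2 + 3) * (96 * sqrt 3 * max 1 \<sigma> / (\<eta> ^ 3 * L * sqrt (L * \<delta>) * \<epsilon> ^ 3))
                    * real_of_ereal (F xb0 - Fstar)\<rfloor>;
             S\<epsilon> = real_of_int T / (real m + 1)
         in (S\<epsilon> \<le> real S \<longrightarrow> (LINT \<omega>|M. (norm (grad_map f \<psi> \<eta> (xT \<omega>)))\<^sup>2) \<le> \<epsilon>\<^sup>2)
            \<and> num_prox m S\<epsilon> = real_of_int T
            \<and> \<lfloor>num_grad bt b m S\<epsilon>\<rfloor> \<le> Tgrad))"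
proof -
  interpret M: prob_space M by (rule M)
  interpret P: prob_space P by (rule P)
  define N where "N = real m + 1"
  have N: "0 < N" by (simp add: N_def)
  have domF: "edom F = edom \<psi>"
  proof -
    have "F x < \<infinity> \<longleftrightarrow> \<psi> x < \<infinity>" for x by (cases "\<psi> x") (auto simp: F_def)
    then show ?thesis by (auto simp: edom_def)
  qed
  interpret prox_friendly \<psi> using A1 by unfold_locales
  have F_eq: "F x = ereal (f x + p x)" if "x \<in> edom \<psi>" for x
    unfolding F_def by (subst psi_eq[OF that]) simp
  have Fle: "Fstar \<le> F x" for x unfolding Fstar_def by (rule INF_lower) simp
  define Fst where "Fst = real_of_ereal Fstar"
  have Fstar_eq: "Fstar = ereal Fst"
    using A1(5) Fle[of xb0] x0 by (cases Fstar) (auto simp: Fst_def edom_def)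
  have w: "0 < real bh" "0 < real bt" "0 < real b" "0 < real S" using sizes by auto
  have bhle: "real bh \<le> real bt * N"
    using sizes(5) unfolding N_def by (metis of_nat_1 of_nat_add of_nat_le_iff of_nat_mult)
  define \<theta> where "\<theta> = 1 / sqrt (real bh * real bt * N)"
  have \<beta>w: "1 - \<beta> = sqrt (real bh) / sqrt (real bt * N)" by (simp add: \<beta> N_def)
  have \<theta>1: "1 - \<beta> = real bh * \<theta>"
    unfolding \<beta>w \<theta>_def using w N by (simp add: real_sqrt_mult field_simps)
  have \<theta>2: "real bt * N * (1 - \<beta>) * \<theta> = 1"
    unfolding \<beta>w \<theta>_def using w N by (simp add: real_sqrt_mult field_simps)
  have \<theta>0: "0 < \<theta>" using w N by (simp add: \<theta>_def)
  have \<beta>0: "0 \<le> \<beta>" "\<beta> < 1"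
  proof -
    have "sqrt (real bh) / sqrt (real bt * N) \<le> 1" using bhle w N by simp
    then show "0 \<le> \<beta>" using \<beta>w by linarith
    have "0 < sqrt (real bh) / sqrt (real bt * N)" using w N by simp
    then show "\<beta> < 1" using \<beta>w by linarith
  qed
  interpret hsgd_rs \<psi> P fs f L \<sigma> \<eta> \<delta> \<beta> \<gamma> m b S bh bt xb0 \<theta> Fst
  proof
    show "continuous_on UNIV (grad (fs z))" if "z \<in> space P" for z
      using smooth[OF that] by (simp add: C1_fun_def)
    show "Fst \<le> f x + p x" if "x \<in> edom \<psi>" for x
      using Fle[of x] F_eq[OF that] Fstar_eq by simp
    show "real bt * (real m + 1) * (1 - \<beta>) * \<theta> = 1" using \<theta>2 by (simp add: N_def)
  qed (fact P f_diff grad_int unbiased L_pos A2[unfolded domF] A3[unfolded domF] sizes(1-3) \<eta> \<delta> \<beta>0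
      \<gamma>_m \<gamma>_t \<gamma>_range x0[unfolded domF] \<theta>1 \<theta>0)+
  define \<Delta> where "\<Delta> = real_of_ereal (F xb0 - Fstar)"
  have \<Delta>: "\<Delta> = \<Phi> xb0 - Fst" unfolding \<Delta>_def F_eq[OF xb0] Fstar_eq by simp
  have \<Delta>0: "0 \<le> \<Delta>" using Fst[OF xb0] by (simp add: \<Delta>)
  have \<Sigma>eq: "\<Sigma>m = (\<Sum>t\<le>m. \<gamma> t)" by (simp add: \<Sigma>m atMost_atLeast0)
  have \<Sigma>0: "0 < \<Sigma>m" unfolding \<Sigma>eq using \<gamma>_range by (intro sum_pos) auto

  \<comment> \<open>By independence and equal laws the restricted sample vector is distributed as
    the product \<open>Q\<close>, so expectations over the run can be computed there.\<close>
  define \<Xi> where "\<Xi> = (\<lambda>\<omega>. \<lambda>l\<in>lbl. \<xi> l \<omega>)"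
  have \<xi>m: "\<xi> l \<in> M \<rightarrow>\<^sub>M P" if "l \<in> lbl" for l
    using samples_indep that by (auto simp: M.indep_vars_def2)
  have \<Xi>m: "\<Xi> \<in> M \<rightarrow>\<^sub>M Q" unfolding \<Xi>_def using \<xi>m by (intro measurable_restrict) auto
  \<comment> \<open>The characterization of independence by the joint law asks for a nonempty index
    set.\<close>
  have "Init 1 0 \<in> lbl" using sizes by (auto simp: sample_labels_def)
  then have "distr M Q \<Xi> = PiM lbl (\<lambda>l. distr M P (\<xi> l))"
    using samples_indep M.indep_vars_iff_distr_eq_PiM'[of lbl \<xi> "\<lambda>_. P"] \<xi>m unfolding \<Xi>_def by auto
  also have "\<dots> = Q" using samples_law by (intro PiM_cong) auto
  finally have law: "distr M Q \<Xi> = Q" .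
  let ?K = "{1..S} \<times> {0..m}"
  have ind: "M.indep_set {\<Xi> -` A \<inter> space M | A. A \<in> sets Q} {J -` B \<inter> space M | B. B \<in> sets (count_space ?K)}"
    using J_indep unfolding \<Xi>_def .
  let ?g = "\<lambda>j Z. (norm (grad_map f \<psi> \<eta> (X (fst j) (snd j) Z)))\<^sup>2"
  have gint: "integrable (distr M Q \<Xi>) (?g j)" if "j \<in> ?K" for j
    unfolding law using that by (intro iterate_integrable(3)) auto
  \<comment> \<open>The iterates read labels in \<open>lbl\<close> only, so passing from all samples
    to the restricted vector changes nothing.\<close>
  have xT_eq: "(norm (grad_map f \<psi> \<eta> (xT \<omega>)))\<^sup>2 = ?g (J \<omega>) (\<Xi> \<omega>)" if "\<omega> \<in> space M" for \<omega>
  proof -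
    have "J \<omega> \<in> ?K" using measurable_space[OF J_meas that] by simp
    then have "X (fst (J \<omega>)) (snd (J \<omega>)) (\<lambda>l. \<xi> l \<omega>) = X (fst (J \<omega>)) (snd (J \<omega>)) (\<Xi> \<omega>)"
      by (intro iterate_cong(1)) (auto simp: \<Xi>_def drawn_def)
    then show ?thesis by (simp add: xT)
  qed
  have "finite ?K" by simp
  note idx = M.expectation_at_independent_index[where g = ?g, OF \<Xi>m J_meas ind this]
  have integ: "integrable M (\<lambda>\<omega>. (norm (grad_map f \<psi> \<eta> (xT \<omega>)))\<^sup>2)"
    by (subst Bochner_Integration.integrable_cong[OF refl xT_eq], assumption) (rule idx(1)[OF gint])
  define E where "E = (LINT \<omega>|M. (norm (grad_map f \<psi> \<eta> (xT \<omega>)))\<^sup>2)"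
  let ?G = "\<lambda>s t. LINT Z|Q. (norm (grad_map f \<psi> \<eta> (X s t Z)))\<^sup>2"
  have "E = (\<Sum>j\<in>?K. measure M {\<omega> \<in> space M. J \<omega> = j} * (LINT Z|Q. ?g j Z))"
    unfolding E_def
    by (subst Bochner_Integration.integral_cong[OF refl xT_eq], assumption) (rule idx(2)[OF gint, unfolded law])
  also have "\<dots> = (\<Sum>j\<in>?K. \<gamma> (snd j) / (real S * \<Sigma>m) * ?G (fst j) (snd j))"
    using J_law by (intro sum.cong) auto
  also have "\<dots> = (\<Sum>s=1..S. \<Sum>t\<le>m. \<gamma> t / (real S * \<Sigma>m) * ?G s t)"
    by (simp add: sum.cartesian_product atMost_atLeast0 case_prod_beta)
  also have "\<dots> = (\<Sum>s=1..S. \<Sum>t\<le>m. \<gamma> t * ?G s t) / (real S * \<Sigma>m)"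
    by (simp add: sum_divide_distrib)
  finally have "L * \<eta>\<^sup>2 / 4 * (E * (real S * \<Sigma>m)) \<le> \<Delta> + real S * (2 * \<theta> * \<sigma>\<^sup>2 / L * \<Sigma>m)"
    using weighted_expected_grad_map w \<Sigma>0 unfolding \<Delta> \<Sigma>eq by simp
  then have "E \<le> (\<Delta> + real S * (2 * \<theta> * \<sigma>\<^sup>2 / L * \<Sigma>m)) * (4 / (L * \<eta>\<^sup>2 * (real S * \<Sigma>m)))"
    using w \<Sigma>0 L_pos \<eta> by (simp add: field_simps)
  also have "\<dots> = 4 / (L * \<eta>\<^sup>2 * real S) * \<Delta> * (1 / \<Sigma>m) + 8 * \<sigma>\<^sup>2 / (L\<^sup>2 * \<eta>\<^sup>2) * \<theta>"
    using w \<Sigma>0 L_pos \<eta> by (simp add: field_simps power2_eq_square)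
  finally have E1: "E \<le> 4 / (L * \<eta>\<^sup>2 * real S) * \<Delta> * (1 / \<Sigma>m) + 8 * \<sigma>\<^sup>2 / (L\<^sup>2 * \<eta>\<^sup>2) * \<theta>" .
  define r where "r = sqrt (L * \<delta> / (real b * (1 - \<beta>)))"
  have "N * \<delta> \<le> sqrt 2 * (L + r) * \<Sigma>m"
    using sum_\<gamma>_lower unfolding r_def N_def \<Sigma>eq .
  then have "1 / \<Sigma>m \<le> sqrt 2 * (L + r) / (N * \<delta>)"
    using \<Sigma>0 N \<delta>_pos by (simp add: pos_divide_le_eq pos_le_divide_eq)
  then have "4 / (L * \<eta>\<^sup>2 * real S) * \<Delta> * (1 / \<Sigma>m) \<le> 4 / (L * \<eta>\<^sup>2 * real S) * \<Delta> * (sqrt 2 * (L + r) / (N * \<delta>))"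
    using \<Delta>0 w L_pos \<eta> by (intro mult_left_mono) auto
  with E1 have E2: "E \<le> 4 * sqrt 2 * (L + r) / (L * \<eta>\<^sup>2 * \<delta> * real S * N) * \<Delta>
      + 8 * \<sigma>\<^sup>2 / (L\<^sup>2 * \<eta>\<^sup>2 * sqrt (real bh * real bt * N))"
    by (simp add: \<theta>_def mult_ac)

  have partA: "E \<le> 8 * sqrt 2 * (real bh powr (1/4) * sqrt (real b) * L
                       + (real bt * (real m + 1)) powr (1/4) * sqrt (L * \<delta>))
           / (L * \<eta>\<^sup>2 * \<delta> * real S * (real m + 1) * real bh powr (1/4) * sqrt (real b))
           * \<Delta> + 8 * \<sigma>\<^sup>2 / (L\<^sup>2 * \<eta>\<^sup>2 * sqrt (real bh * real bt * (real m + 1)))"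
  proof -
    define u where "u = real bh powr (1/4) * sqrt (real b)"
    define v where "v = (real bt * N) powr (1/4) * sqrt (L * \<delta>)"
    have u: "0 < u" using w by (simp add: u_def)
    have r: "r = v / u"
      unfolding r_def \<beta>w u_def v_def using w N
      by (simp add: real_sqrt_mult real_sqrt_divide mult_ac flip: sqrt_sqrt_eq_powr)
    \<comment> \<open>The constant is doubled only here; (b) starts from the sharper
      \<open>E2\<close>.\<close>
    have "4 * sqrt 2 * (L + r) / (L * \<eta>\<^sup>2 * \<delta> * real S * N) * \<Delta>
        \<le> 8 * sqrt 2 * (L + r) / (L * \<eta>\<^sup>2 * \<delta> * real S * N) * \<Delta>"
      using \<Delta>0 w N L_pos \<delta>_pos \<beta>0
      by (intro mult_right_mono divide_right_mono) (auto simp: r_def)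
    also have "\<dots> = 8 * sqrt 2 * (u * L + v) / (L * \<eta>\<^sup>2 * \<delta> * real S * N * u) * \<Delta>"
    proof -
      have "L + r = (u * L + v) / u" using u by (simp add: r field_simps)
      then show ?thesis by simp
    qed
    finally show ?thesis using E2 by (simp add: u_def v_def N_def mult.assoc)
  qed

  have partB: "let T = \<lfloor>96 * sqrt 3 * max 1 \<sigma> / (\<eta> ^ 3 * L * sqrt (L * \<delta>) * real b * \<epsilon> ^ 3) * \<Delta>\<rfloor>;
             Tgrad = \<lfloor>(c1\<^sup>2 + 3) * (96 * sqrt 3 * max 1 \<sigma> / (\<eta> ^ 3 * L * sqrt (L * \<delta>) * \<epsilon> ^ 3)) * \<Delta>\<rfloor>;
             S\<epsilon> = real_of_int T / (real m + 1)
         in (S\<epsilon> \<le> real S \<longrightarrow> E \<le> \<epsilon>\<^sup>2)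
            \<and> num_prox m S\<epsilon> = real_of_int T
            \<and> \<lfloor>num_grad bt b m S\<epsilon>\<rfloor> \<le> Tgrad"
    if as: "\<epsilon> > 0" "c1 > 1 / (real m + 1)" "bh = b"
        "real b \<le> 2 * sqrt (6 * \<delta>) / (L * sqrt L * \<eta> * \<epsilon>)"
        "real bt = 24 * c1 / (L\<^sup>2 * \<eta>\<^sup>2 * \<epsilon>\<^sup>2) * max (\<sigma>\<^sup>2) 1"
        "real m + 1 = 24 / (c1 * L\<^sup>2 * \<eta>\<^sup>2 * real b * \<epsilon>\<^sup>2) * max (\<sigma>\<^sup>2) 1" for \<epsilon> c1
  proof -
    define Y where "Y = 96 * sqrt 3 * max 1 \<sigma> / (\<eta> ^ 3 * L * sqrt (L * \<delta>) * real b * \<epsilon> ^ 3) * \<Delta>"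
    define T where "T = \<lfloor>Y\<rfloor>"
    have "0 < 1 / (real m + 1)" by simp
    with as(2) have c1: "0 < c1" by (rule less_trans[rotated])
    note ar = complexity_arithmetic[OF L_pos \<eta>(1) \<delta>_pos as(1) c1 \<sigma>_nonneg \<Delta>0 sizes(1,4) N as(4,5) as(6)[folded N_def]]
    \<comment> \<open>The number of stages yields only that the floor \<open>T\<close> of
      \<open>Y\<close> is at most S N. As Y < T + 1 and S N \<ge> 1, this gives Y \<le> 2 S
      N.\<close>
    have 1: "E \<le> \<epsilon>\<^sup>2" if "real_of_int T / N \<le> real S"
    proof -
      have "real_of_int T \<le> real S * N" using that N by (simp add: pos_divide_le_eq)
      moreover have "Y < real_of_int T + 1" unfolding T_def by linarith
      moreover have "1 * 1 \<le> real S * N" using sizes(4) by (intro mult_mono) (auto simp: N_def)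
      ultimately have "Y \<le> 2 * (real S * N)" by linarith
      from ar[OF this[unfolded Y_def]] show ?thesis
        using E2 unfolding r_def \<beta>w as(3) by linarith
    qed
    have 2: "num_prox m (real_of_int T / N) = real_of_int T"
      using N by (simp add: num_prox_def flip: N_def)
    have 3: "\<lfloor>num_grad bt b m (real_of_int T / N)\<rfloor>
        \<le> \<lfloor>(c1\<^sup>2 + 3) * (96 * sqrt 3 * max 1 \<sigma> / (\<eta> ^ 3 * L * sqrt (L * \<delta>) * \<epsilon> ^ 3)) * \<Delta>\<rfloor>"
    proof (rule floor_mono)
      have "num_grad bt b m (real_of_int T / N) = (real bt / N + 3 * real b) * real_of_int T"
        unfolding num_grad_def N_def[symmetric] using N by (simp add: field_simps)
      also have "\<dots> = (c1\<^sup>2 + 3) * real b * real_of_int T"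
        using batch_ratio[OF L_pos \<eta>(1) as(1) c1 sizes(1) as(5) as(6)[folded N_def]]
        by (simp add: algebra_simps)
      also have "\<dots> \<le> (c1\<^sup>2 + 3) * real b * Y"
        unfolding T_def by (intro mult_left_mono) auto
      also have "\<dots> = (c1\<^sup>2 + 3) * (96 * sqrt 3 * max 1 \<sigma> / (\<eta> ^ 3 * L * sqrt (L * \<delta>) * \<epsilon> ^ 3)) * \<Delta>"
        unfolding Y_def using w(3) by (simp add: mult_ac)
      finally show "num_grad bt b m (real_of_int T / N)
        \<le> (c1\<^sup>2 + 3) * (96 * sqrt 3 * max 1 \<sigma> / (\<eta> ^ 3 * L * sqrt (L * \<delta>) * \<epsilon> ^ 3)) * \<Delta>" .
    qed
    show ?thesis
      unfolding Let_def N_def[symmetric] Y_def[symmetric] T_def[symmetric]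
      using 1 2 3 by blast
  qed
  show ?thesis
    using integ partA partB unfolding E_def \<Delta>_def by blast
qed

end
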